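(* Let $\underline{T}=(T_1,\dots,T_k)$ be a tuple of contractions on a Hilbert space $\mathcal{H}$ and $q_{ij}\in\mathbb{T}$ ($1\le i<j\le k$) with $T_iT_j=q_{ij}T_jT_i$ for $i<j$. Then $\underline{T}$ admits a regular $Q$-unitary dilation in each of the following cases: (1) each $T_i$ is an isometry; (2) $\underline{T}$ is doubly $q$-commuting, i.e. additionally $T_iT_j^*=\overline{q_{ij}}\,T_j^*T_i$ for $i<j$; (3) $\|T_1\|^2+\dots+\|T_k\|^2\le1$.
   Context: Set $q_{ji}=q_{ij}^{-1}$. For an integer $m$, $m^+=\max\{m,0\}$, $m^-=-\min\{m,0\}$. The tuple $\underline{T}$ admits a regular $Q$-unitary dilation if there exist a Hilbert space $\mathcal{K}\supseteq\mathcal{H}$, a commuting family $Q=\{Q_{ij}:i\ne j\}$ of unitaries on $\mathcal{K}$ with $Q_{ij}=Q_{ji}^{-1}$, and unitaries $U_1,\dots,U_k$ on $\mathcal{K}$ with $U_iU_j=Q_{ij}U_jU_i$ and $Q_{ij}U_l=U_lQ_{ij}$ for all $i\ne j$ and all $l$, such that for all distinct $\alpha_1,\dots,\alpha_r\in\{1,\dots,k\}$ and all $m_{\alpha_1},\dots,m_{\alpha_r}\in\mathbb{Z}$, \[ \prod_{1\le i<j\le r}q_{\alpha_i\alpha_j}^{-m_{\alpha_i}^+m_{\alpha_j}^-}\big[(T_{\alpha_1}^{m_{\alpha_1}^-})^*\cdots(T_{\alpha_r}^{m_{\alpha_r}^-})^*\big]\big[T_{\alpha_1}^{m_{\alpha_1}^+}\cdots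 T_{\alpha_r}^{m_{\alpha_r}^+}\big]=P_{\mathcal{H}}U_{\alpha_1}^{m_{\alpha_1}}\cdots U_{\alpha_r}^{m_{\alpha_r}}|_{\mathcal{H}}, \] where $P_{\mathcal{H}}$ is the orthogonal projection of $\mathcal{K}$ onto $\mathcal{H}$. *)

theory Defs
  imports "HOL-Analysis.Analysis"
begin

record 'a chs =
  carrier :: "'a set"
  zero :: 'a
  add :: "'a \<Rightarrow> 'a \<Rightarrow> 'a"
  scale :: "complex \<Rightarrow> 'a \<Rightarrow> 'a"
  inner :: "'a \<Rightarrow> 'a \<Rightarrow> complex"

definition hnorm :: "'a chs \<Rightarrow> 'a \<Rightarrow> real" where
  "hnorm S x = sqrt (Re (inner S x x))"

definition hdiff :: "'a chs \<Rightarrow> 'a \<Rightarrow> 'a \<Rightarrow> 'a" where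
  "hdiff S x y = add S x (scale S (-1) y)"

definition hilbert_space :: "'a chs \<Rightarrow> bool" where
  "hilbert_space S \<longleftrightarrow>
     zero S \<in> carrier S \<and>
     (\<forall>x\<in>carrier S. \<forall>y\<in>carrier S. add S x y \<in> carrier S) \<and>
     (\<forall>a. \<forall>x\<in>carrier S. scale S a x \<in> carrier S) \<and>
     (\<forall>x\<in>carrier S. \<forall>y\<in>carrier S. \<forall>z\<in>carrier S. add S (add S x y) z = add S x (add S y z)) \<and>
     (\<forall>x\<in>carrier S. \<forall>y\<in>carrier S. add S x y = add S y x) \<and>
     (\<forall>x\<in>carrier S. add S (zero S) x = x) \<and>
     (\<forall>x\<in>carrier S. \<exists>y\<in>carrier S. add S x y = zero S) \<and>
     (\<forall>a. \<forall>x\<in>carrier S. \<forall>y\<in>carrier S. scale S a (add S x y) = add S (scale S a x) (scale S a y)) \<and>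
     (\<forall>a b. \<forall>x\<in>carrier S. scale S (a + b) x = add S (scale S a x) (scale S b x)) \<and>
     (\<forall>a b. \<forall>x\<in>carrier S. scale S a (scale S b x) = scale S (a * b) x) \<and>
     (\<forall>x\<in>carrier S. scale S 1 x = x) \<and>
     (\<forall>x\<in>carrier S. \<forall>y\<in>carrier S. \<forall>z\<in>carrier S. inner S (add S x y) z = inner S x z + inner S y z) \<and>
     (\<forall>a. \<forall>x\<in>carrier S. \<forall>y\<in>carrier S. inner S (scale S a x) y = a * inner S x y) \<and>
     (\<forall>x\<in>carrier S. \<forall>y\<in>carrier S. inner S y x = cnj (inner S x y)) \<and>
     (\<forall>x\<in>carrier S. 0 \<le> Re (inner S x x)) \<and>
     (\<forall>x\<in>carrier S. inner S x x = 0 \<longrightarrow> x = zero S) \<and>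
     (\<forall>X. (\<forall>n. X n \<in> carrier S) \<longrightarrow>
          (\<forall>e>0. \<exists>N. \<forall>m\<ge>N. \<forall>n\<ge>N. hnorm S (hdiff S (X m) (X n)) < e) \<longrightarrow>
          (\<exists>L\<in>carrier S. (\<lambda>n. hnorm S (hdiff S (X n) L)) \<longlonglongrightarrow> 0))"

definition bounded_op :: "'a chs \<Rightarrow> 'b chs \<Rightarrow> ('a \<Rightarrow> 'b) \<Rightarrow> bool" where
  "bounded_op S1 S2 A \<longleftrightarrow>
     (\<forall>x\<in>carrier S1. A x \<in> carrier S2) \<and>
     (\<forall>x\<in>carrier S1. \<forall>y\<in>carrier S1. A (add S1 x y) = add S2 (A x) (A y)) \<and>
     (\<forall>a. \<forall>x\<in>carrier S1. A (scale S1 a x) = scale S2 a (A x)) \<and>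
     (\<exists>C. \<forall>x\<in>carrier S1. hnorm S2 (A x) \<le> C * hnorm S1 x)"

definition opnorm :: "'a chs \<Rightarrow> 'b chs \<Rightarrow> ('a \<Rightarrow> 'b) \<Rightarrow> real" where
  "opnorm S1 S2 A = Sup {hnorm S2 (A x) | x. x \<in> carrier S1 \<and> hnorm S1 x \<le> 1}"

definition adjoint :: "'a chs \<Rightarrow> 'b chs \<Rightarrow> ('a \<Rightarrow> 'b) \<Rightarrow> 'b \<Rightarrow> 'a" where
  "adjoint S1 S2 A y =
     (THE z. z \<in> carrier S1 \<and> (\<forall>x\<in>carrier S1. inner S2 (A x) y = inner S1 x z))"

definition contraction :: "'a chs \<Rightarrow> ('a \<Rightarrow> 'a) \<Rightarrow> bool" where
  "contraction S A \<longleftrightarrow> bounded_op S S A \<and> opnorm S S A \<le> 1"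

definition isometry :: "'a chs \<Rightarrow> 'b chs \<Rightarrow> ('a \<Rightarrow> 'b) \<Rightarrow> bool" where
  "isometry S1 S2 A \<longleftrightarrow> bounded_op S1 S2 A \<and> (\<forall>x\<in>carrier S1. hnorm S2 (A x) = hnorm S1 x)"

definition unitary :: "'a chs \<Rightarrow> ('a \<Rightarrow> 'a) \<Rightarrow> bool" where
  "unitary S A \<longleftrightarrow> isometry S S A \<and> A ` carrier S = carrier S"

definition upow :: "'a chs \<Rightarrow> ('a \<Rightarrow> 'a) \<Rightarrow> int \<Rightarrow> 'a \<Rightarrow> 'a" where
  "upow S W m = (if 0 \<le> m then W ^^ nat m else (adjoint S S W) ^^ nat (- m))"

definition mplus :: "int \<Rightarrow> nat" where "mplus m = nat (max m 0)"
definition mminus :: "int \<Rightarrow> nat" where "mminus m = nat (- min m 0)"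

definition opprod :: "('a \<Rightarrow> 'a) list \<Rightarrow> 'a \<Rightarrow> 'a" where
  "opprod As = foldr (\<circ>) As id"

text \<open>The dilation space K is a Hilbert space whose elements live in the type
  ('a \<times> nat) set; H sits inside K via an isometric embedding V, and P_H is V^*.
  Indices run over {1..k}.\<close>
definition regular_Q_unitary_dilation ::
  "'a chs \<Rightarrow> (nat \<Rightarrow> 'a \<Rightarrow> 'a) \<Rightarrow> nat \<Rightarrow> (nat \<Rightarrow> nat \<Rightarrow> complex) \<Rightarrow> bool" where
  "regular_Q_unitary_dilation H T k q \<longleftrightarrow>
    (\<exists>(K :: ('a \<times> nat) set chs) (V :: 'a \<Rightarrow> ('a \<times> nat) set) Q U.
       hilbert_space K \<and> isometry H K V \<and>
       (\<forall>i\<in>{1..k}. \<forall>j\<in>{1..k}. i \<noteq> j \<longrightarrow>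
          unitary K (Q i j) \<and> (\<forall>x\<in>carrier K. Q i j (Q j i x) = x)) \<and>
       (\<forall>i\<in>{1..k}. \<forall>j\<in>{1..k}. \<forall>i'\<in>{1..k}. \<forall>j'\<in>{1..k}. i \<noteq> j \<longrightarrow> i' \<noteq> j' \<longrightarrow>
          (\<forall>x\<in>carrier K. Q i j (Q i' j' x) = Q i' j' (Q i j x))) \<and>
       (\<forall>i\<in>{1..k}. unitary K (U i)) \<and>
       (\<forall>i\<in>{1..k}. \<forall>j\<in>{1..k}. i \<noteq> j \<longrightarrow>
          (\<forall>x\<in>carrier K. U i (U j x) = Q i j (U j (U i x)))) \<and>
       (\<forall>i\<in>{1..k}. \<forall>j\<in>{1..k}. \<forall>l\<in>{1..k}. i \<noteq> j \<longrightarrow>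
          (\<forall>x\<in>carrier K. Q i j (U l x) = U l (Q i j x))) \<and>
       (\<forall>(\<alpha>s :: nat list) (ms :: nat \<Rightarrow> int). distinct \<alpha>s \<longrightarrow> set \<alpha>s \<subseteq> {1..k} \<longrightarrow>
          (\<forall>x\<in>carrier H.
             scale H (\<Prod>i<length \<alpha>s. \<Prod>j\<in>{i<..<length \<alpha>s}.
                        inverse (q (\<alpha>s ! i) (\<alpha>s ! j) ^ (mplus (ms (\<alpha>s ! i)) * mminus (ms (\<alpha>s ! j)))))
               (opprod (map (\<lambda>a. adjoint H H (T a ^^ mminus (ms a))) \<alpha>s)
                 (opprod (map (\<lambda>a. T a ^^ mplus (ms a)) \<alpha>s) x))
             = adjoint H K V (opprod (map (\<lambda>a. upow K (U a) (ms a)) \<alpha>s) (V x)))))"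

end

theory Submission
  imports Defs
begin

text \<open>Let \<open>\<Theta>\<^sub>i\<close> be the operation that pulls a positive semidefinite kernel back along \<open>T\<^sub>i\<close>. In
  each of the three cases Brehmer's condition holds: the forms \<open>\<Prod>\<^bsub>i\<in>u\<^esub> (1 - \<Theta>\<^sub>i) \<langle>x, y\<rangle>\<close> are
  positive semidefinite for all \<open>u \<subseteq> {1..k}\<close>; the phases \<open>q\<^sub>i\<^sub>j\<close> cancel, so the \<open>\<Theta>\<^sub>i\<close> commute. A single
  operator \<open>T\<close> is dilated, as a scalar kernel on \<open>\<int> \<times> X\<close>, by
  \<open>F'((n, x), (m, y)) = F (T\<^bsup>max(n-m,0)\<^esup> x, T\<^bsup>max(m-n,0)\<^esup> y)\<close>, which is positive semidefinite as soon as \<open>F\<close> and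
  \<open>(1 - \<Theta>)F\<close> are. The other \<open>T\<^sub>i\<close> extend to \<open>(n, x) \<mapsto> (n, q\<^sub>i\<^sup>n T\<^sub>i x)\<close>, and \<open>1 - \<Theta>\<^sub>i\<close> commutes with the
  dilation, so Brehmer's condition for the remaining operators survives and all of \<open>T\<^sub>1, \<dots>, T\<^sub>k\<close> can
  be dilated one after the other. In the reproducing kernel Hilbert space of the last kernel the
  shifts of the \<open>k\<close> coordinates are the required unitaries, with scalar \<open>Q\<^sub>i\<^sub>j = q\<^sub>i\<^sub>j\<close>.\<close>

text \<open>The phases cancel in the forms because a form is sesquilinear and |q_ij| = 1. They do
  not cancel in the operators, and the dilated operators have to satisfy the relations exactly; this
  is why each extension carries the power of q that it costs to pass the unitary added last. No
  Hilbert space is built between two dilations: the extended operators are maps of formal points,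
  positivity is a property of scalar kernels on those points, and a completion is taken once, at the
  end. A unitary preserves its kernel, so an operator that has been dilated would contribute the
  defect 0 and drops out of the condition. In the regular formula the negative powers can be moved,
  by the relations and by taking adjoints, to the other side of the inner product. What remains are
  pairs of monomials in which no index has a nonzero exponent on both sides, and for such pairs the
  dilated kernel returns the original inner product. The vectors are functions on the points because
  this avoids a quotient by null vectors and allows an injective encoding in the type prescribed for
  K.\<close>

lemma cmod_sq_le_of_quadratic:
  fixes b :: complex and A D :: real
  assumes "\<And>t::complex. 0 \<le> A + 2 * Re (t * b) + (cmod t)\<^sup>2 * D" and "0 \<le> D"
  shows "(cmod b)\<^sup>2 \<le> A * D"
proof (cases "D = 0")
  case True
  have "b = 0"
  proof (rule ccontr)
    assume "b \<noteq> 0"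
    \<comment> \<open>With D = 0 the quadratic is affine in t; this t gives it the value A - (A + 1)
      = -1.\<close>
    define t where "t = complex_of_real (- (A + 1) / (2 * (cmod b)\<^sup>2)) * cnj b"
    have "t * b = complex_of_real (- (A + 1) / (2 * (cmod b)\<^sup>2) * (cmod b)\<^sup>2)"
      unfolding t_def of_real_mult complex_norm_square by (simp add: mult.assoc mult.commute)
    also have "\<dots> = complex_of_real (- (A + 1) / 2)"
      using \<open>b \<noteq> 0\<close> by simp
    finally have "Re (t * b) = - (A + 1) / 2"
      by (simp only: Re_complex_of_real)
    with assms(1)[of t] True show False by simp
  qed
  with True show ?thesis by simp
next
  case False
  with assms(2) have D: "D > 0" by simp
  \<comment> \<open>The minimiser of the quadratic, whose minimum is A - |b|^2 / D.\<close>
  define t where "t = - cnj b / complex_of_real D"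
  have "t * b = - (b * cnj b) / complex_of_real D"
    unfolding t_def by simp
  also have "\<dots> = complex_of_real (- (cmod b)\<^sup>2 / D)"
    unfolding complex_norm_square[symmetric] by simp
  finally have "t * b = complex_of_real (- (cmod b)\<^sup>2 / D)" .
  then have 1: "Re (t * b) = - (cmod b)\<^sup>2 / D" by simp
  have 2: "(cmod t)\<^sup>2 * D = (cmod b)\<^sup>2 / D"
    using D unfolding t_def by (simp add: norm_divide power_divide power2_eq_square)
  have "0 \<le> A - (cmod b)\<^sup>2 / D" using assms(1)[of t] 1 2 by simp
  then show ?thesis using D by (simp add: field_simps)
qed

section \<open>Hilbert space records\<close>

text \<open>Kept apart from the inner product and from positivity because the defects of the inner
  product are such forms too, and their positivity is what has to be proved. Conjugate linearity in
  the second argument follows from the symmetry.\<close>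

definition sesquilinear :: "'a chs \<Rightarrow> ('a \<Rightarrow> 'a \<Rightarrow> complex) \<Rightarrow> bool" where
  "sesquilinear S G \<longleftrightarrow>
     (\<forall>x\<in>carrier S. \<forall>y\<in>carrier S. \<forall>z\<in>carrier S. G (add S x y) z = G x z + G y z) \<and>
     (\<forall>a. \<forall>x\<in>carrier S. \<forall>y\<in>carrier S. G (scale S a x) y = a * G x y) \<and>
     (\<forall>x\<in>carrier S. \<forall>y\<in>carrier S. G y x = cnj (G x y))"

locale hilb =
  fixes S :: "'a chs"
  assumes hs: "hilbert_space S"
begin

lemmas hilbert_axioms = hs[unfolded hilbert_space_def]

lemmas zero_closed [simp, intro] = hilbert_axioms[THEN conjunct1, rule_format]
  and add_closed [simp, intro] = hilbert_axioms[THEN conjunct2, THEN conjunct1, rule_format]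
  and scale_closed [simp, intro] = hilbert_axioms[THEN conjunct2, THEN conjunct2, THEN conjunct1, rule_format]
  and add_assoc = hilbert_axioms[THEN conjunct2, THEN conjunct2, THEN conjunct2, THEN conjunct1, rule_format]
  and add_comm = hilbert_axioms[THEN conjunct2, THEN conjunct2, THEN conjunct2, THEN conjunct2, THEN conjunct1, rule_format]
  and add_zero_left [simp] = hilbert_axioms[THEN conjunct2, THEN conjunct2, THEN conjunct2, THEN conjunct2, THEN conjunct2, THEN conjunct1, rule_format]
  and scale_add_left = hilbert_axioms[THEN conjunct2, THEN conjunct2, THEN conjunct2, THEN conjunct2, THEN conjunct2, THEN conjunct2, THEN conjunct2, THEN conjunct2, THEN conjunct1, rule_format]
  and scale_scale [simp] = hilbert_axioms[THEN conjunct2, THEN conjunct2, THEN conjunct2, THEN conjunct2, THEN conjunct2, THEN conjunct2, THEN conjunct2, THEN conjunct2, THEN conjunct2, THEN conjunct1, rule_format]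
  and scale_one [simp] = hilbert_axioms[THEN conjunct2, THEN conjunct2, THEN conjunct2, THEN conjunct2, THEN conjunct2, THEN conjunct2, THEN conjunct2, THEN conjunct2, THEN conjunct2, THEN conjunct2, THEN conjunct1, rule_format]
  and inner_add_left = hilbert_axioms[THEN conjunct2, THEN conjunct2, THEN conjunct2, THEN conjunct2, THEN conjunct2, THEN conjunct2, THEN conjunct2, THEN conjunct2, THEN conjunct2, THEN conjunct2, THEN conjunct2, THEN conjunct1, rule_format]
  and inner_scale_left = hilbert_axioms[THEN conjunct2, THEN conjunct2, THEN conjunct2, THEN conjunct2, THEN conjunct2, THEN conjunct2, THEN conjunct2, THEN conjunct2, THEN conjunct2, THEN conjunct2, THEN conjunct2, THEN conjunct2, THEN conjunct1, rule_format]
  and inner_commute = hilbert_axioms[THEN conjunct2, THEN conjunct2, THEN conjunct2, THEN conjunct2, THEN conjunct2, THEN conjunct2, THEN conjunct2, THEN conjunct2, THEN conjunct2, THEN conjunct2, THEN conjunct2, THEN conjunct2, THEN conjunct2, THEN conjunct1, rule_format]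
  and inner_self_nonneg = hilbert_axioms[THEN conjunct2, THEN conjunct2, THEN conjunct2, THEN conjunct2, THEN conjunct2, THEN conjunct2, THEN conjunct2, THEN conjunct2, THEN conjunct2, THEN conjunct2, THEN conjunct2, THEN conjunct2, THEN conjunct2, THEN conjunct2, THEN conjunct1, rule_format]
  and inner_self_zeroD = hilbert_axioms[THEN conjunct2, THEN conjunct2, THEN conjunct2, THEN conjunct2, THEN conjunct2, THEN conjunct2, THEN conjunct2, THEN conjunct2, THEN conjunct2, THEN conjunct2, THEN conjunct2, THEN conjunct2, THEN conjunct2, THEN conjunct2, THEN conjunct2, THEN conjunct1, rule_format]

lemma inner_sesquilinear: "sesquilinear S (inner S)"
  unfolding sesquilinear_def
  by (intro conjI ballI allI; (rule inner_add_left inner_scale_left inner_commute; assumption))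

lemma hdiff_closed [simp, intro]: "x \<in> carrier S \<Longrightarrow> y \<in> carrier S \<Longrightarrow> hdiff S x y \<in> carrier S"
  by (simp add: hdiff_def)

lemma complete:
  assumes "\<And>n. X n \<in> carrier S"
    and "\<And>e. e > 0 \<Longrightarrow> \<exists>N. \<forall>m\<ge>N. \<forall>n\<ge>N. hnorm S (hdiff S (X m) (X n)) < e"
  obtains L where "L \<in> carrier S" "(\<lambda>n. hnorm S (hdiff S (X n) L)) \<longlonglongrightarrow> 0"
proof -
  note hilbert_axioms[THEN conjunct2, THEN conjunct2, THEN conjunct2, THEN conjunct2, THEN conjunct2, THEN conjunct2, THEN conjunct2, THEN conjunct2, THEN conjunct2, THEN conjunct2, THEN conjunct2, THEN conjunct2, THEN conjunct2, THEN conjunct2, THEN conjunct2, THEN conjunct2, rule_format, of X]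
  then show thesis using assms that by blast
qed

context
  fixes G assumes G: "sesquilinear S G"
begin

lemma form_add_left: "x \<in> carrier S \<Longrightarrow> y \<in> carrier S \<Longrightarrow> z \<in> carrier S \<Longrightarrow>
    G (add S x y) z = G x z + G y z"
  and form_scale_left: "x \<in> carrier S \<Longrightarrow> y \<in> carrier S \<Longrightarrow> G (scale S a x) y = a * G x y"
  and form_commute: "x \<in> carrier S \<Longrightarrow> y \<in> carrier S \<Longrightarrow> G y x = cnj (G x y)"
  using G unfolding sesquilinear_def by blast+

lemma form_add_right: "x \<in> carrier S \<Longrightarrow> y \<in> carrier S \<Longrightarrow> z \<in> carrier S \<Longrightarrow>
    G z (add S x y) = G z x + G z y"
  by (metis add_closed form_add_left form_commute complex_cnj_add)

lemma form_scale_right: "x \<in> carrier S \<Longrightarrow> y \<in> carrier S \<Longrightarrow> G x (scale S a y) = cnj a * G x y"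
  by (metis scale_closed form_scale_left form_commute complex_cnj_mult)

lemma form_self: "x \<in> carrier S \<Longrightarrow> G x x = complex_of_real (Re (G x x))"
  using form_commute[of x x] by (simp add: complex_eq_iff)

lemma form_self_add_scale:
  assumes "x \<in> carrier S" "y \<in> carrier S"
  shows "Re (G (add S x (scale S t y)) (add S x (scale S t y)))
    = Re (G x x) + 2 * Re (t * G y x) + (cmod t)\<^sup>2 * Re (G y y)"
proof -
  have "G (add S x (scale S t y)) (add S x (scale S t y))
      = G x x + cnj (t * G y x) + t * G y x + (t * cnj t) * G y y"
    using assms form_commute[of y x]
    by (simp add: form_add_left form_add_right form_scale_left form_scale_right algebra_simps)
  moreover have "t * cnj t = complex_of_real ((cmod t)\<^sup>2)"
    by (simp add: complex_norm_square del: of_real_power)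
  ultimately show ?thesis by (simp del: of_real_power)
qed

lemma form_cauchy_schwarz:
  assumes pos: "\<And>x. x \<in> carrier S \<Longrightarrow> 0 \<le> Re (G x x)"
    and x: "x \<in> carrier S" and y: "y \<in> carrier S"
  shows "(cmod (G x y))\<^sup>2 \<le> Re (G x x) * Re (G y y)"
proof -
  have "(cmod (G y x))\<^sup>2 \<le> Re (G x x) * Re (G y y)"
  proof (rule cmod_sq_le_of_quadratic)
    fix t
    show "0 \<le> Re (G x x) + 2 * Re (t * G y x) + (cmod t)\<^sup>2 * Re (G y y)"
      using pos[of "add S x (scale S t y)"] form_self_add_scale[OF x y] x y by simp
  qed (use pos y in auto)
  then show ?thesis using form_commute[OF x y] by simp
qed

end

lemmas inner_add_right = form_add_right[OF inner_sesquilinear]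
  and inner_scale_right = form_scale_right[OF inner_sesquilinear]
  and inner_self = form_self[OF inner_sesquilinear]

lemma inner_zero_left [simp]: "y \<in> carrier S \<Longrightarrow> inner S (zero S) y = 0"
  using inner_add_left[of "zero S" "zero S" y] by simp

lemma inner_zero_right [simp]: "y \<in> carrier S \<Longrightarrow> inner S y (zero S) = 0"
  using inner_commute[of "zero S" y] by simp

lemma inner_hdiff_left: "x \<in> carrier S \<Longrightarrow> y \<in> carrier S \<Longrightarrow> z \<in> carrier S \<Longrightarrow>
    inner S (hdiff S x y) z = inner S x z - inner S y z"
  by (simp add: hdiff_def inner_add_left inner_scale_left)

lemma inner_hdiff_right: "x \<in> carrier S \<Longrightarrow> y \<in> carrier S \<Longrightarrow> z \<in> carrier S \<Longrightarrow>
    inner S z (hdiff S x y) = inner S z x - inner S z y"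
  by (simp add: hdiff_def inner_add_right inner_scale_right)

lemma scale_zero [simp]: "x \<in> carrier S \<Longrightarrow> scale S 0 x = zero S"
  by (rule inner_self_zeroD) (auto simp: inner_scale_left)

lemma hdiff_eq_zeroD:
  assumes x: "x \<in> carrier S" and y: "y \<in> carrier S" and eq: "hdiff S x y = zero S"
  shows "x = y"
proof -
  have "add S (scale S (-1) y) y = zero S"
    using scale_add_left[of y "-1" 1] y by simp
  then have "x = add S x (add S (scale S (-1) y) y)"
    using x add_comm[of x "zero S"] by simp
  also have "\<dots> = y"
    using add_assoc[of x "scale S (-1) y" y] eq x y by (simp add: hdiff_def)
  finally show ?thesis .
qed

lemma inner_eqI:
  assumes "x \<in> carrier S" "y \<in> carrier S"
    and "\<And>z. z \<in> carrier S \<Longrightarrow> inner S x z = inner S y z"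
  shows "x = y"
proof (rule hdiff_eq_zeroD)
  show "hdiff S x y = zero S"
    by (rule inner_self_zeroD) (use assms in \<open>auto simp: inner_hdiff_left\<close>)
qed (use assms in auto)

lemma inner_eqI':
  assumes "x \<in> carrier S" "y \<in> carrier S"
    and "\<And>z. z \<in> carrier S \<Longrightarrow> inner S z x = inner S z y"
  shows "x = y"
  by (rule inner_eqI) (use assms inner_commute in metis)+

lemma hnorm_nonneg [simp]: "x \<in> carrier S \<Longrightarrow> 0 \<le> hnorm S x"
  by (simp add: hnorm_def inner_self_nonneg)

lemma hnorm_sq: "x \<in> carrier S \<Longrightarrow> (hnorm S x)\<^sup>2 = Re (inner S x x)"
  by (simp add: hnorm_def inner_self_nonneg)

lemma inner_self_hnorm: "x \<in> carrier S \<Longrightarrow> inner S x x = complex_of_real ((hnorm S x)\<^sup>2)"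
  using inner_self hnorm_sq by simp

lemma hnorm_scale: "x \<in> carrier S \<Longrightarrow> hnorm S (scale S a x) = cmod a * hnorm S x"
proof -
  assume x: "x \<in> carrier S"
  have "inner S (scale S a x) (scale S a x) = (a * cnj a) * inner S x x"
    using x by (simp add: inner_scale_left inner_scale_right)
  also have "\<dots> = complex_of_real ((cmod a)\<^sup>2 * (hnorm S x)\<^sup>2)"
    unfolding complex_norm_square[symmetric] using x by (simp add: inner_self_hnorm)
  finally have "(hnorm S (scale S a x))\<^sup>2 = (cmod a * hnorm S x)\<^sup>2"
    using x by (simp add: hnorm_sq power_mult_distrib del: of_real_mult)
  then show ?thesis using x by (simp add: power2_eq_iff_nonneg)
qed

lemma cauchy_schwarz:
  assumes "x \<in> carrier S" "y \<in> carrier S"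
  shows "cmod (inner S x y) \<le> hnorm S x * hnorm S y"
proof -
  have "(cmod (inner S x y))\<^sup>2 \<le> (hnorm S x * hnorm S y)\<^sup>2"
    using form_cauchy_schwarz[OF inner_sesquilinear inner_self_nonneg assms] assms
    by (simp add: hnorm_sq power_mult_distrib)
  then show ?thesis using assms by (simp add: power2_le_iff_abs_le)
qed

text \<open>The minimising sequence of \<open>\<parallel>x\<parallel>\<^sup>2 - 2 Re (\<phi> x)\<close> is Cauchy by the parallelogram law, and
  minimality in every direction identifies its limit.\<close>

lemma riesz:
  fixes \<phi> :: "'a \<Rightarrow> complex"
  assumes add: "\<And>x y. x \<in> carrier S \<Longrightarrow> y \<in> carrier S \<Longrightarrow> \<phi> (add S x y) = \<phi> x + \<phi> y"
    and scale: "\<And>a x. x \<in> carrier S \<Longrightarrow> \<phi> (scale S a x) = a * \<phi> x"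
    and bound: "\<And>x. x \<in> carrier S \<Longrightarrow> cmod (\<phi> x) \<le> M * hnorm S x"
  obtains z where "z \<in> carrier S" "\<And>x. x \<in> carrier S \<Longrightarrow> \<phi> x = inner S x z"
proof -
  define J where "J x = (hnorm S x)\<^sup>2 - 2 * Re (\<phi> x)" for x
  have lower: "- M\<^sup>2 \<le> J x" if "x \<in> carrier S" for x
  proof -
    have "Re (\<phi> x) \<le> M * hnorm S x"
      using bound[OF that] complex_Re_le_cmod[of "\<phi> x"] by linarith
    moreover have "0 \<le> (hnorm S x - M)\<^sup>2" by simp
    ultimately show ?thesis unfolding J_def by (simp add: power2_diff algebra_simps)
  qed
  define d where "d = Inf (J ` carrier S)"
  have bdd: "bdd_below (J ` carrier S)"
    using lower by (intro bdd_belowI2[of _ "- M\<^sup>2"])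
  have d_le: "d \<le> J x" if "x \<in> carrier S" for x
    unfolding d_def using bdd that by (intro cInf_lower) auto
  have "\<exists>x\<in>carrier S. J x < d + 1 / real (Suc n)" for n
  proof -
    have "Inf (J ` carrier S) < d + 1 / real (Suc n)"
      unfolding d_def by simp
    then show ?thesis
      using cInf_lessD[of "J ` carrier S"] zero_closed by blast
  qed
  then obtain X where X: "\<And>n. X n \<in> carrier S" "\<And>n. J (X n) < d + 1 / real (Suc n)"
    by metis
  have J_add: "J (add S x (scale S t y))
      = J x + 2 * Re (t * (inner S y x - \<phi> y)) + (cmod t)\<^sup>2 * (hnorm S y)\<^sup>2"
    if "x \<in> carrier S" "y \<in> carrier S" for x y t
    using that form_self_add_scale[OF inner_sesquilinear, of x y t]
    by (simp add: J_def hnorm_sq add scale algebra_simps)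
  \<comment> \<open>\<open>X n\<close> is within 1/(n+1) of the infimum, so no step t in the
    direction y lowers J by more than that; \<open>cmod_sq_le_of_quadratic\<close> converts this
    into an almost vanishing first variation.\<close>
  have close: "(cmod (inner S y (X n) - \<phi> y))\<^sup>2 \<le> 1 / real (Suc n) * (hnorm S y)\<^sup>2"
    if "y \<in> carrier S" for y n
  proof (rule cmod_sq_le_of_quadratic)
    fix t
    show "0 \<le> 1 / real (Suc n) + 2 * Re (t * (inner S y (X n) - \<phi> y)) + (cmod t)\<^sup>2 * (hnorm S y)\<^sup>2"
      using d_le[of "add S (X n) (scale S t y)"] J_add[of "X n" y t] X[of n] that by simp
  qed simp
  have par: "(hnorm S (hdiff S x y))\<^sup>2 = 2 * J x + 2 * J y - 4 * J (scale S (1/2) (add S x y))"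
    if "x \<in> carrier S" "y \<in> carrier S" for x y
  proof -
    have 1: "4 * (hnorm S (scale S (1/2) (add S x y)))\<^sup>2 = (hnorm S (add S x y))\<^sup>2"
      using that by (simp add: hnorm_scale power2_eq_square norm_divide)
    have "(hnorm S (hdiff S x y))\<^sup>2 + (hnorm S (add S x y))\<^sup>2 = 2 * (hnorm S x)\<^sup>2 + 2 * (hnorm S y)\<^sup>2"
      using that form_self_add_scale[OF inner_sesquilinear, of x y 1]
        form_self_add_scale[OF inner_sesquilinear, of x y "-1"]
      by (simp add: hdiff_def hnorm_sq)
    moreover have "J (scale S (1/2) (add S x y))
        = (hnorm S (scale S (1/2) (add S x y)))\<^sup>2 - Re (\<phi> x) - Re (\<phi> y)"
      using that by (simp add: J_def add scale field_simps)
    ultimately show ?thesis using 1 unfolding J_def by argo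
  qed
  \<comment> \<open>The bound is 2 (d + 1/(N+1)) + 2 (d + 1/(N+1)) - 4 d, since J is at least d at
    the midpoint.\<close>
  have cauchy: "(hnorm S (hdiff S (X m) (X n)))\<^sup>2 \<le> 4 / real (Suc N)" if "N \<le> m" "N \<le> n" for N m n
  proof -
    have "1 / real (Suc m) \<le> 1 / real (Suc N)" "1 / real (Suc n) \<le> 1 / real (Suc N)"
      using that by (simp_all add: frac_le)
    then have "J (X m) \<le> d + 1 / real (Suc N)" "J (X n) \<le> d + 1 / real (Suc N)"
      using X(2)[of m] X(2)[of n] by linarith+
    moreover have "4 / real (Suc N) = 4 * (1 / real (Suc N))" by simp
    ultimately show ?thesis
      using par[OF X(1) X(1), of m n] d_le[OF scale_closed[OF add_closed[OF X(1) X(1)]], of "1/2" m n]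
      by argo
  qed
  obtain L where L: "L \<in> carrier S" "(\<lambda>n. hnorm S (hdiff S (X n) L)) \<longlonglongrightarrow> 0"
  proof (rule complete[of X])
    fix e :: real assume e: "e > 0"
    obtain N where "4 / e\<^sup>2 < real N"
      using reals_Archimedean2 by blast
    then have "4 / e\<^sup>2 < real (Suc N)" by simp
    then have "4 / real (Suc N) < e\<^sup>2"
      using e by (simp add: field_simps)
    then have "\<forall>m\<ge>N. \<forall>n\<ge>N. hnorm S (hdiff S (X m) (X n)) < e"
      using cauchy e by (meson le_less_trans less_imp_le power2_less_imp_less)
    then show "\<exists>N. \<forall>m\<ge>N. \<forall>n\<ge>N. hnorm S (hdiff S (X m) (X n)) < e" by blast
  qed (use X in auto)
  have "\<phi> y = inner S y L" if y: "y \<in> carrier S" for y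
  proof -
    have "(\<lambda>n. inner S y (X n) - \<phi> y) \<longlonglongrightarrow> 0"
    proof (rule Lim_null_comparison)
      show "\<forall>\<^sub>F n in sequentially. cmod (inner S y (X n) - \<phi> y) \<le> sqrt (1 / real (Suc n)) * hnorm S y"
      proof (intro always_eventually allI)
        fix n
        have "cmod (inner S y (X n) - \<phi> y) \<le> sqrt (1 / real (Suc n) * (hnorm S y)\<^sup>2)"
          using close[OF y, of n] by (rule real_le_rsqrt)
        then show "cmod (inner S y (X n) - \<phi> y) \<le> sqrt (1 / real (Suc n)) * hnorm S y"
          using y by (simp only: real_sqrt_mult real_sqrt_abs abs_of_nonneg hnorm_nonneg)
      qed
      have "(\<lambda>n. sqrt (1 / real (Suc n)) * hnorm S y) \<longlonglongrightarrow> sqrt 0 * hnorm S y"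
        using LIMSEQ_inverse_real_of_nat
        by (intro tendsto_mult tendsto_real_sqrt tendsto_const) (simp add: inverse_eq_divide)
      then show "(\<lambda>n. sqrt (1 / real (Suc n)) * hnorm S y) \<longlonglongrightarrow> 0" by simp
    qed
    moreover have "(\<lambda>n. inner S y (X n) - \<phi> y) \<longlonglongrightarrow> inner S y L - \<phi> y"
    proof -
      have "(\<lambda>n. inner S y (hdiff S (X n) L)) \<longlonglongrightarrow> 0"
      proof (rule Lim_null_comparison)
        show "\<forall>\<^sub>F n in sequentially. cmod (inner S y (hdiff S (X n) L)) \<le> hnorm S y * hnorm S (hdiff S (X n) L)"
          using cauchy_schwarz y X L by simp
        show "(\<lambda>n. hnorm S y * hnorm S (hdiff S (X n) L)) \<longlonglongrightarrow> 0"
          using tendsto_mult[OF tendsto_const L(2), of "hnorm S y"] by simp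
      qed
      then have "(\<lambda>n. inner S y (hdiff S (X n) L) + (inner S y L - \<phi> y)) \<longlonglongrightarrow> 0 + (inner S y L - \<phi> y)"
        by (intro tendsto_intros)
      then show ?thesis using y X L by (simp add: inner_hdiff_right)
    qed
    ultimately have "inner S y L - \<phi> y = 0"
      by (rule LIMSEQ_unique[rotated])
    then show ?thesis by simp
  qed
  with L that show thesis by blast
qed

section \<open>Adjoints, operator norms and powers of contractions\<close>

lemma adjoint_eqI:
  assumes "z \<in> carrier S" and "\<And>x. x \<in> carrier S \<Longrightarrow> inner S2 (A x) y = inner S x z"
  shows "adjoint S S2 A y = z"
  unfolding adjoint_def
proof (rule the_equality)
  fix z' assume "z' \<in> carrier S \<and> (\<forall>x\<in>carrier S. inner S2 (A x) y = inner S x z')"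
  with assms show "z' = z" by (intro inner_eqI') auto
qed (use assms in auto)

text \<open>The functional mapping x to the inner product of A x with y is bounded by
  Cauchy-Schwarz, so Riesz supplies the vector that the definite description in
  \<open>adjoint\<close> asks for.\<close>

lemma adjoint_exists:
  assumes "bounded_op S S A" and y: "y \<in> carrier S"
  shows "adjoint S S A y \<in> carrier S \<and> (\<forall>x\<in>carrier S. inner S (A x) y = inner S x (adjoint S S A y))"
proof -
  obtain c where c: "\<And>x. x \<in> carrier S \<Longrightarrow> hnorm S (A x) \<le> c * hnorm S x"
    using assms unfolding bounded_op_def by blast
  have A: "A x \<in> carrier S" "A (add S x x') = add S (A x) (A x')" "A (scale S a x) = scale S a (A x)"
    if "x \<in> carrier S" "x' \<in> carrier S" for x x' a
    using assms that unfolding bounded_op_def by auto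
  obtain z where "z \<in> carrier S" "\<And>x. x \<in> carrier S \<Longrightarrow> inner S (A x) y = inner S x z"
  proof (rule riesz[of "\<lambda>x. inner S (A x) y" "c * hnorm S y"])
    fix x assume x: "x \<in> carrier S"
    have "cmod (inner S (A x) y) \<le> hnorm S (A x) * hnorm S y"
      using A x y by (intro cauchy_schwarz) auto
    also have "\<dots> \<le> (c * hnorm S x) * hnorm S y"
      using c[OF x] y by (intro mult_right_mono) auto
    finally show "cmod (inner S (A x) y) \<le> c * hnorm S y * hnorm S x"
      by (simp add: mult_ac)
  qed (use A y in \<open>auto simp: inner_add_left inner_scale_left\<close>)
  then show ?thesis using adjoint_eqI[of z S A y] by auto
qed

lemma adjoint_closed: "bounded_op S S A \<Longrightarrow> y \<in> carrier S \<Longrightarrow> adjoint S S A y \<in> carrier S"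
  and inner_adjoint_right: "bounded_op S S A \<Longrightarrow> x \<in> carrier S \<Longrightarrow> y \<in> carrier S \<Longrightarrow>
    inner S x (adjoint S S A y) = inner S (A x) y"
  using adjoint_exists by simp_all

lemma inner_adjoint_left: "bounded_op S S A \<Longrightarrow> x \<in> carrier S \<Longrightarrow> y \<in> carrier S \<Longrightarrow>
    inner S (adjoint S S A y) x = inner S y (A x)"
  using inner_commute[of x "adjoint S S A y"] inner_commute[of "A x" y] inner_adjoint_right[of A x y]
    adjoint_closed by (simp add: bounded_op_def)

lemma contraction_bounded_op: "contraction S A \<Longrightarrow> bounded_op S S A"
  by (simp add: contraction_def)

lemma hnorm_le_opnorm:
  assumes A: "bounded_op S S A" and x: "x \<in> carrier S"
  shows "hnorm S (A x) \<le> opnorm S S A * hnorm S x"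
proof -
  obtain c where c: "\<And>x. x \<in> carrier S \<Longrightarrow> hnorm S (A x) \<le> c * hnorm S x"
    using A unfolding bounded_op_def by blast
  have bdd: "bdd_above {hnorm S (A x) | x. x \<in> carrier S \<and> hnorm S x \<le> 1}"
  proof (rule bdd_aboveI)
    fix r assume "r \<in> {hnorm S (A x) | x. x \<in> carrier S \<and> hnorm S x \<le> 1}"
    then obtain y where y: "r = hnorm S (A y)" "y \<in> carrier S" "hnorm S y \<le> 1" by blast
    have "c * hnorm S y \<le> \<bar>c\<bar> * 1"
      using y by (intro mult_mono) auto
    then show "r \<le> \<bar>c\<bar>" using c[of y] y by linarith
  qed
  show ?thesis
  proof (cases "hnorm S x = 0")
    case True
    then show ?thesis using c[OF x] by simp
  next
    case False
    then have pos: "hnorm S x > 0" using hnorm_nonneg[OF x] by linarith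
    define y where "y = scale S (complex_of_real (1 / hnorm S x)) x"
    have y: "y \<in> carrier S" "hnorm S y \<le> 1"
      using x pos by (simp_all add: y_def hnorm_scale norm_divide)
    have "hnorm S (A y) \<le> opnorm S S A"
      unfolding opnorm_def using bdd y by (intro cSup_upper) auto
    moreover have "hnorm S (A y) = hnorm S (A x) / hnorm S x"
      using A x pos unfolding y_def bounded_op_def by (simp add: hnorm_scale norm_divide)
    ultimately show ?thesis using pos by (simp add: field_simps)
  qed
qed

lemma contraction_hnorm_le:
  assumes "contraction S A" "x \<in> carrier S"
  shows "hnorm S (A x) \<le> hnorm S x"
  using hnorm_le_opnorm[of A x] mult_right_mono[of "opnorm S S A" 1 "hnorm S x"] assms
  unfolding contraction_def by simp

lemma funpow_closed: "(\<And>x. x \<in> C \<Longrightarrow> A x \<in> C) \<Longrightarrow> x \<in> C \<Longrightarrow> (A ^^ n) x \<in> C"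
  by (induction n) auto

text \<open>The dilation formula takes adjoints of powers of T, not powers of adjoints, so every
  power has to be bounded; for a contraction the constant 1 serves for all n.\<close>

lemma bounded_op_funpow:
  assumes "contraction S A"
  shows "bounded_op S S (A ^^ n)"
proof -
  have A: "bounded_op S S A" using assms by (simp add: contraction_def)
  have cl: "(A ^^ n) x \<in> carrier S" if "x \<in> carrier S" for x
    using A that by (intro funpow_closed) (auto simp: bounded_op_def)
  show ?thesis
    unfolding bounded_op_def
  proof (intro conjI ballI allI exI[of _ 1])
    show "(A ^^ n) (add S x y) = add S ((A ^^ n) x) ((A ^^ n) y)"
      if "x \<in> carrier S" "y \<in> carrier S" for x y
      using that A funpow_closed[of "carrier S" A] unfolding bounded_op_def by (induction n) auto
    show "(A ^^ n) (scale S a x) = scale S a ((A ^^ n) x)" if "x \<in> carrier S" for a x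
      using that A funpow_closed[of "carrier S" A] unfolding bounded_op_def by (induction n) auto
    show "hnorm S ((A ^^ n) x) \<le> 1 * hnorm S x" if "x \<in> carrier S" for x
    proof (induction n)
      case (Suc n)
      have "(A ^^ n) x \<in> carrier S"
        using A that by (intro funpow_closed) (auto simp: bounded_op_def)
      then show ?case using Suc contraction_hnorm_le[OF assms, of "(A ^^ n) x"] by simp
    qed simp
  qed (use cl in auto)
qed

end

section \<open>Positive semidefinite kernels\<close>

text \<open>A list of pairs \<open>(a, x)\<close> stands for the formal linear combination of the points \<open>x\<close> with
  coefficients \<open>a\<close>.\<close>

definition lform :: "('x \<Rightarrow> 'x \<Rightarrow> complex) \<Rightarrow> (complex \<times> 'x) list \<Rightarrow> (complex \<times> 'x) list \<Rightarrow> complex" where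
  "lform F l m = (\<Sum>p\<leftarrow>l. \<Sum>r\<leftarrow>m. fst p * cnj (fst r) * F (snd p) (snd r))"

definition combs :: "'x set \<Rightarrow> (complex \<times> 'x) list set" where
  "combs C = {l. snd ` set l \<subseteq> C}"

definition cscale :: "complex \<Rightarrow> (complex \<times> 'x) list \<Rightarrow> (complex \<times> 'x) list" where
  "cscale c l = map (map_prod ((*) c) id) l"

definition psd_on :: "'x set \<Rightarrow> ('x \<Rightarrow> 'x \<Rightarrow> complex) \<Rightarrow> bool" where
  "psd_on C F \<longleftrightarrow> (\<forall>l\<in>combs C. 0 \<le> Re (lform F l l))"

lemma combs_Nil [simp]: "[] \<in> combs C"
  and combs_Cons [simp]: "p # l \<in> combs C \<longleftrightarrow> snd p \<in> C \<and> l \<in> combs C"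
  and combs_append [simp]: "l @ m \<in> combs C \<longleftrightarrow> l \<in> combs C \<and> m \<in> combs C"
  and combs_cscale [simp]: "cscale c l \<in> combs C \<longleftrightarrow> l \<in> combs C"
  by (auto simp: combs_def cscale_def image_image)

lemma lform_Nil [simp]: "lform F [] m = 0" "lform F l [] = 0"
  by (simp_all add: lform_def)

lemma lform_append_left: "lform F (l @ l') m = lform F l m + lform F l' m"
  by (simp add: lform_def)

lemma lform_append_right: "lform F l (m @ m') = lform F l m + lform F l m'"
  by (simp add: lform_def sum_list_addf)

lemma lform_cscale_left: "lform F (cscale c l) m = c * lform F l m"
  by (simp add: lform_def cscale_def comp_def mult.assoc flip: sum_list_const_mult)

lemma lform_cscale_right: "lform F l (cscale c m) = cnj c * lform F l m"
  by (simp add: lform_def cscale_def comp_def mult_ac flip: sum_list_const_mult)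

lemma lform_Cons_left: "lform F (p # l) m = lform F [p] m + lform F l m"
  by (simp add: lform_def)

lemma lform_Cons_right: "lform F l (p # m) = lform F l [p] + lform F l m"
  by (simp add: lform_def sum_list_addf)

lemma lform_cong:
  assumes "\<And>x y. x \<in> snd ` set l \<Longrightarrow> y \<in> snd ` set m \<Longrightarrow> F x y = G x y"
  shows "lform F l m = lform G l m"
  unfolding lform_def
  by (intro arg_cong[where f = sum_list] map_cong refl) (use assms in auto)

lemma lform_map:
  "lform F (map (map_prod id f) l) (map (map_prod id f) m) = lform (\<lambda>x y. F (f x) (f y)) l m"
  by (simp add: lform_def comp_def)

lemma lform_diff: "lform (\<lambda>x y. F x y - G x y) l m = lform F l m - lform G l m"
  by (simp add: lform_def right_diff_distrib sum_list_subtractf)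

lemma lform_zero: "lform (\<lambda>x y. 0) l m = 0"
  by (simp add: lform_def)

lemma lform_add: "lform (\<lambda>x y. F x y + G x y) l m = lform F l m + lform G l m"
  by (simp add: lform_def distrib_left sum_list_addf)

lemma lform_sum: "lform (\<lambda>x y. \<Sum>t<(N::nat). F t x y) l m = (\<Sum>t<N. lform (F t) l m)"
  by (induction N) (simp_all add: lform_zero lform_add)

lemma lform_commute:
  assumes "\<And>x y. x \<in> C \<Longrightarrow> y \<in> C \<Longrightarrow> F y x = cnj (F x y)" "l \<in> combs C" "m \<in> combs C"
  shows "lform F m l = cnj (lform F l m)"
  using assms(2)
proof (induction l)
  case (Cons p l)
  have "lform F m [p] = cnj (lform F [p] m)"
    using assms(3)
  proof (induction m)
    case (Cons r m)
    have "lform F [r] [p] = cnj (lform F [p] [r])"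
      using Cons.prems \<open>p # l \<in> combs C\<close> assms(1)[of "snd p" "snd r"] by (simp add: lform_def)
    then show ?case
      using Cons lform_Cons_left[of F r m "[p]"] lform_Cons_right[of F "[p]" r m] by simp
  qed simp
  then show ?case
    using Cons lform_Cons_left[of F p l m] lform_Cons_right[of F m p l] by simp
qed simp

lemma psd_on_cong:
  assumes "\<And>x y. x \<in> C \<Longrightarrow> y \<in> C \<Longrightarrow> F x y = G x y"
  shows "psd_on C F \<longleftrightarrow> psd_on C G"
proof -
  have "lform F l l = lform G l l" if "l \<in> combs C" for l
    by (rule lform_cong, rule assms) (use that in \<open>auto simp: combs_def\<close>)
  then show ?thesis by (simp add: psd_on_def)
qed

lemma psd_on_pullback:
  assumes "psd_on D F" "f ` C \<subseteq> D"
  shows "psd_on C (\<lambda>x y. F (f x) (f y))"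
  unfolding psd_on_def
proof
  fix l assume "l \<in> combs C"
  then have "map (map_prod id f) l \<in> combs D"
    using assms(2) by (force simp: combs_def)
  with assms(1) show "0 \<le> Re (lform (\<lambda>x y. F (f x) (f y)) l l)"
    unfolding psd_on_def lform_map[symmetric] by blast
qed

text \<open>\<open>dilate c T\<close> is the kernel of the minimal power dilation of \<open>T\<close>, the point \<open>x\<close> playing the
  role of \<open>U\<^bsup>c x\<^esup> x\<close>.\<close>

definition defect :: "('x \<Rightarrow> 'x) \<Rightarrow> ('x \<Rightarrow> 'x \<Rightarrow> complex) \<Rightarrow> 'x \<Rightarrow> 'x \<Rightarrow> complex" where
  "defect T F x y = F x y - F (T x) (T y)"

definition dilate :: "('x \<Rightarrow> int) \<Rightarrow> ('x \<Rightarrow> 'x) \<Rightarrow> ('x \<Rightarrow> 'x \<Rightarrow> complex) \<Rightarrow> 'x \<Rightarrow> 'x \<Rightarrow> complex" where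
  "dilate c T F x y = F ((T ^^ nat (c x - c y)) x) ((T ^^ nat (c y - c x)) y)"

text \<open>With the formal vectors \<open>Y\<^sub>t = \<Sum>\<^bsub>c x \<ge> t\<^esub> a\<^sub>x T\<^bsup>c x - t\<^esup> x\<close>, the quadratic form of the
  dilated kernel is \<open>\<Sum>\<^sub>t (\<parallel>Y\<^sub>t\<parallel>\<^sup>2 - \<parallel>T Y\<^bsub>t+1\<^esub>\<parallel>\<^sup>2)\<close>, and
  \<open>\<parallel>T Y\<^bsub>t+1\<^esub>\<parallel> \<le> \<parallel>Y\<^bsub>t+1\<^esub>\<parallel>\<close>.\<close>

lemma psd_on_dilate:
  assumes T: "\<And>x. x \<in> C \<Longrightarrow> T x \<in> C" and F: "psd_on C F" and D: "psd_on C (defect T F)"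
  shows "psd_on C (dilate c T F)"
  unfolding psd_on_def
proof
  fix L assume L: "L \<in> combs C"
  have fin: "finite (c ` snd ` set L)" by simp
  obtain lo where lo: "\<And>x. x \<in> snd ` set L \<Longrightarrow> lo \<le> c x"
    using bdd_below_finite[OF fin] unfolding bdd_below_def by auto
  obtain hi where hi: "\<And>x. x \<in> snd ` set L \<Longrightarrow> c x \<le> hi"
    using bdd_above_finite[OF fin] unfolding bdd_above_def by auto
  \<comment> \<open>The number of levels from lo to hi. No point of L reaches the level lo + N,
    hence \<open>g N\<close> vanishes on L and the sum below telescopes without a remainder.\<close>
  define N where "N = nat (hi - lo + 1)"
  define Y where "Y t = map (\<lambda>p. (fst p, (T ^^ nat (c (snd p) - (lo + int t))) (snd p)))
      (filter (\<lambda>p. lo + int t \<le> c (snd p)) L)" for t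
  define g where "g t x y = (if lo + int t \<le> c x \<and> lo + int t \<le> c y
      then F ((T ^^ nat (c x - (lo + int t))) x) ((T ^^ nat (c y - (lo + int t))) y) else 0)" for t x y
  \<comment> \<open>Only points at level t + 1 or higher count, but their powers of T are measured
    from level t, so there is one factor T more than in \<open>Y (Suc t)\<close>.\<close>
  define h where "h t x y = (if lo + int (Suc t) \<le> c x \<and> lo + int (Suc t) \<le> c y
      then F ((T ^^ nat (c x - (lo + int t))) x) ((T ^^ nat (c y - (lo + int t))) y) else 0)" for t x y
  have Y: "Y t \<in> combs C" for t
  proof -
    have "(T ^^ n) x \<in> C" if "x \<in> C" for n x
      using that T by (induction n) auto
    then show ?thesis using L by (auto simp: combs_def Y_def)
  qed
  have lY: "lform K (Y t) (Y t) = lform (\<lambda>x y. if lo + int t \<le> c x \<and> lo + int t \<le> c y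
      then K ((T ^^ nat (c x - (lo + int t))) x) ((T ^^ nat (c y - (lo + int t))) y) else 0) L L" for K t
    unfolding lform_def Y_def map_map comp_def fst_conv snd_conv sum_list_map_filter'
    by (intro arg_cong[where f = sum_list] map_cong refl)
      (auto intro!: arg_cong[where f = sum_list] map_cong)
  have G: "lform F (Y t) (Y t) = lform (g t) L L" for t
    unfolding lY g_def ..
  have H: "lform (\<lambda>x y. F (T x) (T y)) (Y (Suc t)) (Y (Suc t)) = lform (h t) L L" for t
  proof -
    have "T ((T ^^ nat (c x - (lo + int (Suc t)))) x) = (T ^^ nat (c x - (lo + int t))) x"
      if "lo + int (Suc t) \<le> c x" for x
    proof -
      have "nat (c x - (lo + int t)) = Suc (nat (c x - (lo + int (Suc t))))" using that by simp
      then show ?thesis by simp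
    qed
    then show ?thesis
      unfolding lY h_def by (intro lform_cong) (simp del: of_nat_Suc)
  qed
  \<comment> \<open>\<open>g t\<close> and \<open>h t\<close> have the same values and differ only
    in their conditions, which disagree exactly at the level min (c x) (c y). There one of the two
    powers of T is the identity, and the value is that of the dilated kernel.\<close>
  have pointwise: "dilate c T F x y = (\<Sum>t<N. g t x y - h t x y)"
    if x: "x \<in> snd ` set L" and y: "y \<in> snd ` set L" for x y
  proof -
    define t0 where "t0 = nat (min (c x) (c y) - lo)"
    have t0: "t0 < N" "lo + int t0 = min (c x) (c y)"
      using lo[OF x] lo[OF y] hi[OF x] hi[OF y] by (auto simp: t0_def N_def)
    have "g t x y - h t x y = (if t = t0 then dilate c T F x y else 0)" for t
    proof -
      have "t = t0 \<longleftrightarrow> lo + int t = min (c x) (c y)" using t0 by auto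
      then show ?thesis
        by (auto simp: g_def h_def dilate_def min_def)
    qed
    then show ?thesis using t0 by simp
  qed
  have "lform (dilate c T F) L L = lform (\<lambda>x y. \<Sum>t<N. g t x y - h t x y) L L"
    using pointwise by (rule lform_cong)
  then have eq: "Re (lform (dilate c T F) L L) = (\<Sum>t<N. Re (lform (g t) L L) - Re (lform (h t) L L))"
    by (simp add: lform_sum lform_diff)
  have le: "Re (lform (h t) L L) \<le> Re (lform (g (Suc t)) L L)" for t
  proof -
    have "0 \<le> Re (lform (defect T F) (Y (Suc t)) (Y (Suc t)))"
      using D Y unfolding psd_on_def by blast
    then show ?thesis
      unfolding defect_def[abs_def] lform_diff G H by simp
  qed
  have "lform (g N) L L = lform (\<lambda>x y. 0) L L"
  proof (rule lform_cong)
    fix x y assume "x \<in> snd ` set L" "y \<in> snd ` set L"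
    then show "g N x y = 0" using hi[of x] lo[of x] by (simp add: g_def N_def)
  qed
  then have gN: "lform (g N) L L = 0" by (simp add: lform_zero)
  have "0 \<le> Re (lform (g 0) L L)"
    using F Y[of 0] unfolding psd_on_def G[symmetric] by blast
  also have "\<dots> = (\<Sum>t<N. Re (lform (g t) L L) - Re (lform (g (Suc t)) L L))"
    using sum_lessThan_telescope'[of "\<lambda>t. Re (lform (g t) L L)" N] gN by simp
  also have "\<dots> \<le> Re (lform (dilate c T F) L L)"
    unfolding eq by (intro sum_mono diff_left_mono le)
  finally show "0 \<le> Re (lform (dilate c T F) L L)" .
qed

context hilb
begin

text \<open>A sesquilinear form does not distinguish a formal combination from the vector it sums
  to. Hence nonnegative diagonal values already give positive semidefiniteness as a kernel, which is
  how the three cases of the theorem enter.\<close>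

lemma form_lform:
  assumes G: "sesquilinear S G" and l: "l \<in> combs (carrier S)"
  obtains h where "h \<in> carrier S" "lform G l l = G h h"
proof -
  have "\<exists>h\<in>carrier S. \<forall>m\<in>combs (carrier S). lform G l m = lform G [(1, h)] m"
    using l
  proof (induction l)
    case Nil
    have "G (zero S) y = 0" if "y \<in> carrier S" for y
      using form_add_left[OF G, of "zero S" "zero S" y] that by simp
    then have "lform G [(1, zero S)] m = lform (\<lambda>x y. 0) [(1, zero S)] m"
      if "m \<in> combs (carrier S)" for m
      by (intro lform_cong) (use that in \<open>auto simp: combs_def\<close>)
    then show ?case by (intro bexI[of _ "zero S"]) (auto simp: lform_zero)
  next
    case (Cons p l)
    then obtain h where h: "h \<in> carrier S" "\<forall>m\<in>combs (carrier S). lform G l m = lform G [(1, h)] m"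
      by auto
    define h' where "h' = add S (scale S (fst p) (snd p)) h"
    have "lform G (p # l) m = lform G [(1, h')] m" if m: "m \<in> combs (carrier S)" for m
    proof -
      have "lform G [(1, h')] m = lform G [p] m + lform G [(1, h)] m"
        using m
      proof (induction m)
        case (Cons r m)
        have "lform G [(1, h')] [r] = lform G [p] [r] + lform G [(1, h)] [r]"
          using Cons.prems h \<open>p # l \<in> _\<close>
          by (simp add: lform_def h'_def form_add_left[OF G] form_scale_left[OF G] algebra_simps)
        then show ?case
          using Cons lform_Cons_right[of G "[(1, h')]" r m] lform_Cons_right[of G "[p]" r m]
            lform_Cons_right[of G "[(1, h)]" r m] by simp
      qed simp
      then show ?thesis using lform_Cons_left[of G p l m] h m by simp
    qed
    moreover have "h' \<in> carrier S" using h Cons.prems by (simp add: h'_def)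
    ultimately show ?case by blast
  qed
  then obtain h where h: "h \<in> carrier S" "\<And>m. m \<in> combs (carrier S) \<Longrightarrow> lform G l m = lform G [(1, h)] m"
    by blast
  have comm: "lform G m' m = cnj (lform G m m')" if "m \<in> combs (carrier S)" "m' \<in> combs (carrier S)" for m m'
    by (rule lform_commute[OF form_commute[OF G] that])
  have "lform G l l = cnj (lform G l [(1, h)])"
    using h(2)[OF l] comm[OF l, of "[(1, h)]"] h(1) by simp
  also have "\<dots> = cnj (lform G [(1, h)] [(1, h)])"
    using h by simp
  also have "\<dots> = G h h"
    using form_commute[OF G h(1) h(1)] by (simp add: lform_def)
  finally show thesis using that h(1) by blast
qed

lemma psd_on_form:
  assumes "sesquilinear S G" "\<And>h. h \<in> carrier S \<Longrightarrow> 0 \<le> Re (G h h)"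
  shows "psd_on (carrier S) G"
  unfolding psd_on_def
proof
  fix l assume "l \<in> combs (carrier S)"
  then obtain h where "h \<in> carrier S" "lform G l l = G h h"
    by (rule form_lform[OF assms(1)])
  then show "0 \<le> Re (lform G l l)" using assms(2) by simp
qed

end

section \<open>Dilating the operators one at a time\<close>

text \<open>The product of the operations 1 - Theta_i along a list, the head being applied last.
  Lists are used so that independence of the order never has to be shown: increasing lists stand for
  the subsets of indices.\<close>

definition defects :: "(nat \<Rightarrow> 'x \<Rightarrow> 'x) \<Rightarrow> nat list \<Rightarrow> ('x \<Rightarrow> 'x \<Rightarrow> complex) \<Rightarrow> 'x \<Rightarrow> 'x \<Rightarrow> complex" where
  "defects R is F = foldr (\<lambda>i. defect (R i)) is F"

lemma defects_Nil [simp]: "defects R [] F = F"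
  and defects_Cons [simp]: "defects R (i # is) F = defect (R i) (defects R is F)"
  by (simp_all add: defects_def)

lemma opprod_Nil [simp]: "opprod [] = id"
  and opprod_Cons [simp]: "opprod (A # As) = A \<circ> opprod As"
  by (simp_all add: opprod_def)

lemma opprod_append: "opprod (As @ Bs) x = opprod As (opprod Bs x)"
  by (induction As) auto

lemma opprod_closed: "(\<And>A x. A \<in> set As \<Longrightarrow> x \<in> C \<Longrightarrow> A x \<in> C) \<Longrightarrow> x \<in> C \<Longrightarrow> opprod As x \<in> C"
  by (induction As) auto

text \<open>The relations are recorded for all i \<noteq> j, since the reordering arguments move
  operators in both directions; the relations for i < j yield the others by inversion.\<close>

locale q_tuple = hilb H for H :: "'a chs" +
  fixes T :: "nat \<Rightarrow> 'a \<Rightarrow> 'a" and q :: "nat \<Rightarrow> nat \<Rightarrow> complex" and k :: nat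
  assumes contr: "i \<in> {1..k} \<Longrightarrow> contraction H (T i)"
    and q_norm: "i \<in> {1..k} \<Longrightarrow> j \<in> {1..k} \<Longrightarrow> i \<noteq> j \<Longrightarrow> cmod (q i j) = 1"
    and q_inverse: "i \<in> {1..k} \<Longrightarrow> j \<in> {1..k} \<Longrightarrow> i \<noteq> j \<Longrightarrow> q j i = inverse (q i j)"
    and q_commute: "i \<in> {1..k} \<Longrightarrow> j \<in> {1..k} \<Longrightarrow> i \<noteq> j \<Longrightarrow> x \<in> carrier H \<Longrightarrow>
      T i (T j x) = scale H (q i j) (T j (T i x))"
begin

lemma T_bounded: "i \<in> {1..k} \<Longrightarrow> bounded_op H H (T i)"
  using contr contraction_bounded_op by blast

lemma T_closed [simp]: "i \<in> {1..k} \<Longrightarrow> x \<in> carrier H \<Longrightarrow> T i x \<in> carrier H"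
  and T_add: "i \<in> {1..k} \<Longrightarrow> x \<in> carrier H \<Longrightarrow> y \<in> carrier H \<Longrightarrow> T i (add H x y) = add H (T i x) (T i y)"
  and T_scale: "i \<in> {1..k} \<Longrightarrow> x \<in> carrier H \<Longrightarrow> T i (scale H a x) = scale H a (T i x)"
  using T_bounded unfolding bounded_op_def by blast+

lemma q_nonzero: "i \<in> {1..k} \<Longrightarrow> j \<in> {1..k} \<Longrightarrow> i \<noteq> j \<Longrightarrow> q i j \<noteq> 0"
  using q_norm by fastforce

text \<open>The point \<open>(n, x)\<close> stands for the vector \<open>U\<^sub>k\<^bsup>n k\<^esup> \<cdots> U\<^sub>1\<^bsup>n 1\<^esup> x\<close> of the dilation space.\<close>

definition pts :: "((nat \<Rightarrow> int) \<times> 'a) set" where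
  "pts = {z. snd z \<in> carrier H \<and> (\<forall>i. i \<notin> {1..k} \<longrightarrow> fst z i = 0)}"

definition pscale :: "complex \<Rightarrow> (nat \<Rightarrow> int) \<times> 'a \<Rightarrow> (nat \<Rightarrow> int) \<times> 'a" where
  "pscale a z = (fst z, scale H a (snd z))"

definition shift :: "nat \<Rightarrow> int \<Rightarrow> (nat \<Rightarrow> int) \<times> 'a \<Rightarrow> (nat \<Rightarrow> int) \<times> 'a" where
  "shift l d z = ((fst z)(l := fst z l + d), snd z)"

lemma fst_pscale [simp]: "fst (pscale a z) = fst z"
  and fst_shift: "fst (shift l d z) = (fst z)(l := fst z l + d)"
  by (simp_all add: pscale_def shift_def)

lemma pscale_closed [simp]: "z \<in> pts \<Longrightarrow> pscale a z \<in> pts"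
  and shift_closed [simp]: "z \<in> pts \<Longrightarrow> l \<in> {1..k} \<Longrightarrow> shift l d z \<in> pts"
  and pscale_pscale [simp]: "z \<in> pts \<Longrightarrow> pscale a (pscale b z) = pscale (a * b) z"
  and pscale_one [simp]: "z \<in> pts \<Longrightarrow> pscale 1 z = z"
  and shift_pscale: "shift l d (pscale a z) = pscale a (shift l d z)"
  and shift_shift_same: "shift l d (shift l e z) = shift l (d + e) z"
  and shift_zero [simp]: "shift l 0 z = z"
  and shift_commute: "l \<noteq> m \<Longrightarrow> shift l d (shift m e z) = shift m e (shift l d z)"
  by (auto simp: pts_def pscale_def shift_def fun_eq_iff prod_eq_iff)

text \<open>\<open>stage_op j i\<close> is T_i after T_1, ..., T_j have been dilated. In the point,
  the power of U_(j+1) stands to the left of those of the earlier unitaries: U_(j+1) itself raises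
  its exponent n, and every other operator, dilated before or not, has to pass its n-th power at the
  cost of q_(i,j+1)^n.\<close>

primrec stage_op :: "nat \<Rightarrow> nat \<Rightarrow> (nat \<Rightarrow> int) \<times> 'a \<Rightarrow> (nat \<Rightarrow> int) \<times> 'a" where
  "stage_op 0 i z = (fst z, T i (snd z))"
| "stage_op (Suc j) i z = (if i = Suc j then shift i 1 z
     else pscale (q i (Suc j) powi fst z (Suc j)) (stage_op j i z))"

primrec stage_kernel :: "nat \<Rightarrow> (nat \<Rightarrow> int) \<times> 'a \<Rightarrow> (nat \<Rightarrow> int) \<times> 'a \<Rightarrow> complex" where
  "stage_kernel 0 = (\<lambda>z w. inner H (snd z) (snd w))"
| "stage_kernel (Suc j) = dilate (\<lambda>z. fst z (Suc j)) (stage_op j (Suc j)) (stage_kernel j)"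

lemma stage_op_closed [simp]: "i \<in> {1..k} \<Longrightarrow> z \<in> pts \<Longrightarrow> stage_op j i z \<in> pts"
proof (induction j)
  case 0 then show ?case by (auto simp: pts_def)
qed auto

lemma stage_op_pscale: "i \<in> {1..k} \<Longrightarrow> z \<in> pts \<Longrightarrow> stage_op j i (pscale a z) = pscale a (stage_op j i z)"
proof (induction j)
  case 0 then show ?case by (auto simp: pts_def pscale_def T_scale)
next
  case (Suc j) then show ?case by (auto simp: shift_pscale mult.commute)
qed

lemma fst_stage_op:
  "fst (stage_op j i z) = (if 1 \<le> i \<and> i \<le> j then (fst z)(i := fst z i + 1) else fst z)"
  by (induction j) (auto simp: fst_shift)

lemma fst_funpow_stage_op: "l \<noteq> i \<Longrightarrow> fst ((stage_op j i ^^ n) z) l = fst z l"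
  by (induction n) (auto simp: fst_stage_op)

lemma stage_op_shift: "j < l \<Longrightarrow> stage_op j i (shift l d z) = shift l d (stage_op j i z)"
proof (induction j)
  case 0 then show ?case by (simp add: shift_def)
next
  case (Suc j)
  then have "shift (Suc j) 1 (shift l d z) = shift l d (shift (Suc j) 1 z)"
    by (intro shift_commute) simp
  with Suc show ?case by (simp add: shift_pscale fst_shift)
qed

text \<open>Induction on the stage. If i or l is the operator just dilated, its shift changes the
  exponent of the other operator's phase by one, which is exactly the factor q_il; otherwise the new
  phases commute with everything.\<close>

lemma stage_op_commute:
  assumes "i \<in> {1..k}" "l \<in> {1..k}" "i \<noteq> l" "z \<in> pts" "j \<le> k"
  shows "stage_op j i (stage_op j l z) = pscale (q i l) (stage_op j l (stage_op j i z))"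
  using assms(5)
proof (induction j)
  case 0
  then show ?case using assms q_commute[of i l "snd z"] by (auto simp: pts_def pscale_def)
next
  case (Suc j)
  let ?n = "fst z (Suc j)"
  have coord: "fst (stage_op j i' z) (Suc j) = ?n" for i' by (simp add: fst_stage_op)
  consider "i = Suc j" | "l = Suc j" | "i \<noteq> Suc j" "l \<noteq> Suc j" by blast
  then show ?case
  proof cases
    case 1
    have "q i l * q l i powi (?n + 1) = q l i powi ?n"
      using assms q_inverse[of l i] q_nonzero[of l i] by (simp add: power_int_add)
    then show ?thesis
      using 1 assms by (simp add: shift_pscale stage_op_shift fst_shift)
  next
    case 2
    have "q i l powi (?n + 1) = q i l * q i l powi ?n"
      using assms q_nonzero[of i l] by (simp add: power_int_add)
    then show ?thesis
      using 2 assms by (simp add: shift_pscale stage_op_shift fst_shift coord)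
  next
    case 3
    then show ?thesis using assms Suc by (simp add: stage_op_pscale coord mult_ac)
  qed
qed

lemma funpow_commute_phase:
  assumes f: "\<And>z. z \<in> pts \<Longrightarrow> f z \<in> pts" and g: "\<And>z. z \<in> pts \<Longrightarrow> g z \<in> pts"
    and fs: "\<And>a z. z \<in> pts \<Longrightarrow> f (pscale a z) = pscale a (f z)"
    and fg: "\<And>z. z \<in> pts \<Longrightarrow> f (g z) = pscale c (g (f z))"
    and z: "z \<in> pts"
  shows "(f ^^ n) (g z) = pscale (c ^ n) (g ((f ^^ n) z))"
proof (induction n)
  case (Suc n)
  then show ?case
    using funpow_closed[of pts f z n] assms by (simp add: mult.commute)
qed (use g z in simp)

lemma funpow_stage_op_closed [simp]: "i \<in> {1..k} \<Longrightarrow> z \<in> pts \<Longrightarrow> (stage_op j i ^^ n) z \<in> pts"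
  by (rule funpow_closed) auto

lemma funpow_stage_op_pscale:
  "i \<in> {1..k} \<Longrightarrow> z \<in> pts \<Longrightarrow> (stage_op j i ^^ n) (pscale a z) = pscale a ((stage_op j i ^^ n) z)"
  by (induction n) (simp_all add: stage_op_pscale)

lemma funpow_stage_op_shift:
  "j < l \<Longrightarrow> (stage_op j i ^^ n) (shift l d z) = shift l d ((stage_op j i ^^ n) z)"
  by (induction n) (simp_all add: stage_op_shift)

text \<open>What is kept of sesquilinearity on \<open>pts\<close>, where points can be scaled but
  not added. It suffices for pulling phases out of a kernel.\<close>

definition homogeneous :: "((nat \<Rightarrow> int) \<times> 'a \<Rightarrow> (nat \<Rightarrow> int) \<times> 'a \<Rightarrow> complex) \<Rightarrow> bool" where
  "homogeneous G \<longleftrightarrow> (\<forall>a. \<forall>z\<in>pts. \<forall>w\<in>pts.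
     G (pscale a z) w = a * G z w \<and> G z (pscale a w) = cnj a * G z w)"

lemma homogeneousD:
  assumes "homogeneous G" "z \<in> pts" "w \<in> pts"
  shows "G (pscale a z) w = a * G z w" "G z (pscale a w) = cnj a * G z w"
  using assms unfolding homogeneous_def by auto

lemma homogeneous_defect:
  assumes "i \<in> {1..k}" "homogeneous G"
  shows "homogeneous (defect (stage_op j i) G)"
  using assms unfolding homogeneous_def
  by (simp add: defect_def stage_op_pscale right_diff_distrib)

lemma homogeneous_defects:
  "set is \<subseteq> {1..k} \<Longrightarrow> homogeneous G \<Longrightarrow> homogeneous (defects (stage_op j) is G)"
  by (induction "is") (auto intro: homogeneous_defect)

lemma homogeneous_stage_kernel: "j \<le> k \<Longrightarrow> homogeneous (stage_kernel j)"
proof (induction j)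
  case 0
  show ?case
    unfolding homogeneous_def
    by (auto simp: pts_def pscale_def inner_scale_left inner_scale_right)
next
  case (Suc j)
  then have "Suc j \<in> {1..k}" by simp
  then show ?case
    using Suc unfolding homogeneous_def
    by (simp add: dilate_def funpow_stage_op_pscale)
qed

lemma stage_kernel_commute:
  "j \<le> k \<Longrightarrow> z \<in> pts \<Longrightarrow> w \<in> pts \<Longrightarrow> stage_kernel j w z = cnj (stage_kernel j z w)"
proof (induction j arbitrary: z w)
  case 0
  then show ?case using inner_commute[of "snd z" "snd w"] by (simp add: pts_def)
next
  case (Suc j)
  then have "Suc j \<in> {1..k}" by simp
  with Suc show ?case
    unfolding stage_kernel.simps dilate_def by (intro Suc.IH) auto
qed

text \<open>The kernel of stage j reads only the coordinates 1, ..., j and the vector. This lets all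
  stages share one set of points, the later coordinates being idle until they are dilated.\<close>

lemma stage_kernel_shift:
  "j < l \<Longrightarrow> stage_kernel j (shift l d z) (shift l e w) = stage_kernel j z w"
  by (induction j arbitrary: z w d e)
    (simp_all add: dilate_def fst_shift funpow_stage_op_shift, simp add: shift_def)

text \<open>The phases picked up by moving \<open>T\<^sub>i\<close> past powers of \<open>T\<^bsub>j+1\<^esub>\<close> in the two arguments of the
  dilated kernel are \<open>q\<close> to the power \<open>min (z\<^bsub>j+1\<^esub>) (w\<^bsub>j+1\<^esub>)\<close> and its conjugate.\<close>

lemma dilate_stage_op:
  assumes G: "homogeneous G" and i: "i \<in> {1..k}" "i \<noteq> Suc j" and j: "Suc j \<in> {1..k}"
    and z: "z \<in> pts" and w: "w \<in> pts"
  shows "dilate (\<lambda>z. fst z (Suc j)) (stage_op j (Suc j)) G (stage_op (Suc j) i z) (stage_op (Suc j) i w)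
    = dilate (\<lambda>z. fst z (Suc j)) (stage_op j (Suc j)) (\<lambda>z w. G (stage_op j i z) (stage_op j i w)) z w"
proof -
  let ?f = "stage_op j (Suc j)" and ?n = "\<lambda>z. fst z (Suc j)"
  let ?a = "nat (?n z - ?n w)" and ?b = "nat (?n w - ?n z)"
  define u where "u = q i (Suc j) powi min (?n z) (?n w)"
  have u: "u * cnj u = 1"
    using q_norm[of i "Suc j"] i j complex_norm_square[of u, symmetric]
    by (simp add: u_def norm_power_int)
  then have u': "cnj u * u = 1" by (simp only: mult.commute)
  have coord: "?n (stage_op (Suc j) i y) = ?n y" for y
    using i by (simp add: fst_stage_op)
  have inv: "q (Suc j) i = inverse (q i (Suc j))" and nz: "q i (Suc j) \<noteq> 0"
    using q_inverse[of i "Suc j"] q_nonzero[of i "Suc j"] i j by auto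
  have ph: "q i (Suc j) powi m * q (Suc j) i ^ c = q i (Suc j) powi (m - int c)" for m c
    using nz by (simp add: inv power_int_diff power_int_of_nat field_simps)
  have move: "(?f ^^ c) (stage_op (Suc j) i y)
      = pscale (q i (Suc j) powi (?n y - int c)) (stage_op j i ((?f ^^ c) y))"
    if "y \<in> pts" for c y
  proof -
    have "(?f ^^ c) (stage_op j i y) = pscale (q (Suc j) i ^ c) (stage_op j i ((?f ^^ c) y))"
      by (rule funpow_commute_phase)
        (use i j that stage_op_commute[of "Suc j" i _ j] in \<open>auto simp: stage_op_pscale\<close>)
    then show ?thesis
      using i j that by (simp add: funpow_stage_op_pscale ph)
  qed
  have "?n z - int ?a = min (?n z) (?n w)" "?n w - int ?b = min (?n z) (?n w)" by auto
  then show ?thesis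
    unfolding dilate_def coord move[OF z] move[OF w]
    using i j z w homogeneousD[OF G] u u' by (simp add: u_def[symmetric])
qed

text \<open>By \<open>dilate_stage_op\<close>, pulling the dilated kernel back along the extended
  T_i is the same as dilating the pulled-back kernel, so the difference that forms a defect passes
  through the dilation. Homogeneity is inherited by the defects, so the argument can be repeated
  along the list.\<close>

lemma defects_dilate:
  assumes "homogeneous G" "Suc j \<in> {1..k}" "set is \<subseteq> {1..k} - {Suc j}"
  shows "z \<in> pts \<Longrightarrow> w \<in> pts \<Longrightarrow>
    defects (stage_op (Suc j)) is (dilate (\<lambda>z. fst z (Suc j)) (stage_op j (Suc j)) G) z w
    = dilate (\<lambda>z. fst z (Suc j)) (stage_op j (Suc j)) (defects (stage_op j) is G) z w"
  using assms(3)
proof (induction "is" arbitrary: z w)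
  case (Cons i "is")
  let ?c = "\<lambda>z::(nat \<Rightarrow> int) \<times> 'a. fst z (Suc j)"
  let ?f = "stage_op j (Suc j)" and ?D = "defects (stage_op j) is G"
  have i: "i \<in> {1..k}" "i \<noteq> Suc j" "set is \<subseteq> {1..k}" "set is \<subseteq> {1..k} - {Suc j}" using Cons.prems by auto
  have cl: "stage_op (Suc j) i z \<in> pts" "stage_op (Suc j) i w \<in> pts"
    using i Cons.prems stage_op_closed by blast+
  have "defects (stage_op (Suc j)) (i # is) (dilate ?c ?f G) z w
      = dilate ?c ?f ?D z w - dilate ?c ?f ?D (stage_op (Suc j) i z) (stage_op (Suc j) i w)"
    unfolding defects_Cons defect_def Cons.IH[OF Cons.prems(1,2) i(4)] Cons.IH[OF cl i(4)] ..
  also have "\<dots> = dilate ?c ?f ?D z w - dilate ?c ?f (\<lambda>z w. ?D (stage_op j i z) (stage_op j i w)) z w"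
    using dilate_stage_op[OF homogeneous_defects[OF i(3) assms(1)] i(1,2) assms(2) Cons.prems(1,2)]
    by simp
  also have "\<dots> = dilate ?c ?f (defects (stage_op j) (i # is) G) z w"
    unfolding dilate_def defect_def defects_Cons ..
  finally show ?case .
qed simp

text \<open>The invariant is Brehmer's condition for the operators not yet dilated. To dilate
  T_(j+1), \<open>psd_on_dilate\<close> needs positivity of a kernel and of its defect along
  T_(j+1); for the kernel belonging to the list \<open>is\<close> these are the invariant at stage j
  for \<open>is\<close> and for \<open>Suc j # is\<close>.\<close>

lemma psd_on_stage_kernel:
  assumes brehmer: "\<And>is. sorted_wrt (<) is \<Longrightarrow> set is \<subseteq> {1..k} \<Longrightarrow>
      psd_on pts (defects (stage_op 0) is (stage_kernel 0))"
  shows "j \<le> k \<Longrightarrow> sorted_wrt (<) is \<Longrightarrow> set is \<subseteq> {Suc j..k} \<Longrightarrow>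
      psd_on pts (defects (stage_op j) is (stage_kernel j))"
proof (induction j arbitrary: "is")
  case 0
  then show ?case using brehmer[of "is"] by (simp only: One_nat_def)
next
  case (Suc j)
  let ?c = "\<lambda>z::(nat \<Rightarrow> int) \<times> 'a. fst z (Suc j)" and ?f = "stage_op j (Suc j)"
  let ?D = "defects (stage_op j) is (stage_kernel j)"
  have J: "Suc j \<in> {1..k}" using Suc.prems by simp
  have "sorted_wrt (<) (Suc j # is)"
    using Suc.prems by (fastforce simp: subset_iff)
  then have "psd_on pts (defects (stage_op j) (Suc j # is) (stage_kernel j))"
    using Suc by (intro Suc.IH) (auto simp: subset_iff)
  then have "psd_on pts (defect ?f ?D)" by simp
  moreover have "psd_on pts ?D"
    using Suc by (intro Suc.IH) (auto simp: subset_iff)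
  ultimately have "psd_on pts (dilate ?c ?f ?D)"
    using J by (intro psd_on_dilate) auto
  moreover have "set is \<subseteq> {1..k} - {Suc j}" using Suc.prems by (auto simp: subset_iff)
  ultimately show ?case
    using defects_dilate[OF homogeneous_stage_kernel J, of j "is"] Suc.prems
    by (subst psd_on_cong) auto
qed

text \<open>At the stage where T_i is dilated the kernel depends on the i-th coordinates only
  through their difference, so the shift preserves it. Later dilations keep this, because they
  commute with pulling back along stage operators of other indices.\<close>

lemma stage_kernel_invariant:
  "1 \<le> i \<Longrightarrow> i \<le> j \<Longrightarrow> j \<le> k \<Longrightarrow> z \<in> pts \<Longrightarrow> w \<in> pts \<Longrightarrow>
    stage_kernel j (stage_op j i z) (stage_op j i w) = stage_kernel j z w"
proof (induction j arbitrary: z w)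
  case (Suc j)
  show ?case
  proof (cases "i = Suc j")
    case True
    then show ?thesis
      by (simp add: dilate_def fst_shift funpow_stage_op_shift stage_kernel_shift)
  next
    case False
    have J: "Suc j \<in> {1..k}" "i \<in> {1..k}" using Suc.prems by auto
    have "stage_kernel (Suc j) (stage_op (Suc j) i z) (stage_op (Suc j) i w)
      = dilate (\<lambda>z. fst z (Suc j)) (stage_op j (Suc j))
          (\<lambda>z w. stage_kernel j (stage_op j i z) (stage_op j i w)) z w"
      unfolding stage_kernel.simps
      using dilate_stage_op[OF homogeneous_stage_kernel J(2) False J(1)] Suc.prems by simp
    also have "\<dots> = stage_kernel (Suc j) z w"
      using Suc J False by (simp add: dilate_def)
    finally show ?thesis .
  qed
qed simp

text \<open>Invertibility is settled on the points, before there is a Hilbert space: a dilated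
  operator is a shift followed by multiplications by nonzero phases.\<close>

lemma bij_betw_stage_op:
  assumes "1 \<le> i"
  shows "i \<le> j \<Longrightarrow> j \<le> k \<Longrightarrow> bij_betw (stage_op j i) pts pts"
proof (induction j)
  case (Suc j)
  have i: "i \<in> {1..k}" using assms Suc.prems by simp
  show ?case
  proof (cases "i = Suc j")
    case True
    then show ?thesis
      using i by (intro bij_betw_byWitness[where f' = "shift i (-1)"])
        (auto simp: shift_shift_same)
  next
    case False
    let ?R = "stage_op j i" and ?p = "\<lambda>z::(nat \<Rightarrow> int) \<times> 'a. q i (Suc j) powi fst z (Suc j)"
    \<comment> \<open>The phase has to be removed using the coordinate \<open>Suc j\<close> of the
      image point; this is legitimate because \<open>stage_op j i\<close> leaves that coordinate
      unchanged.\<close>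
    let ?inv = "\<lambda>z. inv_into pts ?R (pscale (inverse (?p z)) z)"
    have bij: "bij_betw ?R pts pts" using Suc False by simp
    have J: "Suc j \<in> {1..k}" using Suc.prems by simp
    have nz: "?p z \<noteq> 0" for z
      using q_nonzero[OF i J False] by simp
    have inv_p: "?p z * inverse (?p z) = 1" for z
      by (rule right_inverse[OF nz])
    have inv_in: "inv_into pts ?R z \<in> pts" "?R (inv_into pts ?R z) = z" if "z \<in> pts" for z
      using that bij by (metis bij_betw_imp_surj_on inv_into_into, metis bij_betw_imp_surj_on f_inv_into_f)
    have coord: "fst (inv_into pts ?R z) (Suc j) = fst z (Suc j)" if "z \<in> pts" for z
      using inv_in(2)[OF that] fst_stage_op[of j i "inv_into pts ?R z"] False by (metis fun_upd_other)
    show ?thesis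
    proof (rule bij_betw_byWitness[where f' = ?inv])
      show "\<forall>z\<in>pts. ?inv (stage_op (Suc j) i z) = z"
      proof
        fix z assume z: "z \<in> pts"
        have "inv_into pts ?R (?R z) = z"
          using z bij by (simp add: bij_betw_inv_into_left)
        then show "?inv (stage_op (Suc j) i z) = z"
          using z i False nz[of z] by (simp add: fst_stage_op)
      qed
      show "\<forall>z\<in>pts. stage_op (Suc j) i (?inv z) = z"
        using False inv_in coord inv_p by simp
      show "stage_op (Suc j) i ` pts \<subseteq> pts"
        using i stage_op_closed by blast
      show "?inv ` pts \<subseteq> pts"
        by (intro image_subsetI inv_in pscale_closed)
    qed
  qed
qed (use assms in simp)

section \<open>Ordered products of powers and the regular formula for the kernel\<close>

definition stage_prod :: "nat \<Rightarrow> nat list \<Rightarrow> (nat \<Rightarrow> nat) \<Rightarrow> (nat \<Rightarrow> int) \<times> 'a \<Rightarrow> (nat \<Rightarrow> int) \<times> 'a" where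
  "stage_prod j as p = opprod (map (\<lambda>a. stage_op j a ^^ p a) as)"

lemma stage_prod_Nil [simp]: "stage_prod j [] p z = z"
  and stage_prod_Cons [simp]: "stage_prod j (a # as) p z = (stage_op j a ^^ p a) (stage_prod j as p z)"
  by (simp_all add: stage_prod_def)

lemma stage_prod_closed: "set as \<subseteq> {1..k} \<Longrightarrow> z \<in> pts \<Longrightarrow> stage_prod j as p z \<in> pts"
  by (induction as) auto

text \<open>The phase is the same at all stages, because the commutation relations are.\<close>

lemma stage_prod_move:
  assumes "distinct as" "set as \<subseteq> {1..k}" "J \<in> {1..k}"
  shows "\<exists>\<theta>. \<forall>t\<le>k. \<forall>z\<in>pts. stage_prod t as p z
    = pscale \<theta> ((stage_op t J ^^ (if J \<in> set as then p J else 0)) (stage_prod t as (p(J := 0)) z))"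
  using assms(1,2)
proof (induction as)
  case Nil
  show ?case by (intro exI[of _ 1]) simp
next
  case (Cons a as)
  have "distinct as" "set as \<subseteq> {1..k}" using Cons.prems by auto
  from Cons.IH[OF this] obtain \<theta> where \<theta>: "\<forall>t\<le>k. \<forall>z\<in>pts. stage_prod t as p z
    = pscale \<theta> ((stage_op t J ^^ (if J \<in> set as then p J else 0)) (stage_prod t as (p(J := 0)) z))"
    by blast
  have a: "a \<in> {1..k}" "a \<notin> set as" "set as \<subseteq> {1..k}" using Cons.prems by auto
  show ?case
  proof (cases "a = J")
    case True
    have "stage_prod t (a # as) p z = pscale \<theta> ((stage_op t J ^^ p J) (stage_prod t (a # as) (p(J := 0)) z))"
      if "t \<le> k" "z \<in> pts" for t z
      using that \<theta> True a assms(3) stage_prod_closed[of as z t] by (simp add: funpow_stage_op_pscale)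
    moreover have mem: "J \<in> set (a # as)" using True by simp
    ultimately show ?thesis unfolding if_P[OF mem] by blast
  next
    case False
    let ?e = "if J \<in> set as then p J else 0"
    have "stage_prod t (a # as) p z = pscale (\<theta> * (q a J ^ ?e) ^ p a)
        ((stage_op t J ^^ ?e) (stage_prod t (a # as) (p(J := 0)) z))"
      if t: "t \<le> k" and z: "z \<in> pts" for t z
    proof -
      let ?A = "stage_op t a" and ?B = "stage_op t J ^^ ?e" and ?w = "stage_prod t as (p(J := 0)) z"
      have w: "?w \<in> pts" using a z stage_prod_closed by blast
      have AB: "?A (?B y) = pscale (q a J ^ ?e) (?B (?A y))" if y: "y \<in> pts" for y
      proof -
        have "(stage_op t J ^^ n) (?A y) = pscale (q J a ^ n) (?A ((stage_op t J ^^ n) y))" for n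
          by (rule funpow_commute_phase)
            (use a assms(3) False t y stage_op_commute[of J a _ t] in \<open>auto simp: stage_op_pscale\<close>)
        moreover have "q a J ^ ?e * q J a ^ ?e = 1"
          using q_inverse[of J a] q_nonzero[of J a] a assms(3) False
          by (simp flip: power_mult_distrib)
        ultimately show ?thesis using y a assms(3) by simp
      qed
      have "(?A ^^ p a) (?B ?w) = pscale ((q a J ^ ?e) ^ p a) (?B ((?A ^^ p a) ?w))"
        by (rule funpow_commute_phase) (use a assms(3) w AB in \<open>auto simp: stage_op_pscale\<close>)
      moreover have "stage_prod t as p z = pscale \<theta> (?B ?w)"
        using \<theta> t z by blast
      ultimately show ?thesis
        using a assms(3) w False by (simp add: funpow_stage_op_pscale)
    qed
    then have main: "\<forall>t\<le>k. \<forall>z\<in>pts. stage_prod t (a # as) p z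
        = pscale (\<theta> * (q a J ^ ?e) ^ p a) ((stage_op t J ^^ ?e) (stage_prod t (a # as) (p(J := 0)) z))"
      by blast
    have eq: "(if J \<in> set (a # as) then p J else 0) = ?e" using False by auto
    show ?thesis unfolding eq by (rule exI) (rule main)
  qed
qed

lemma fst_stage_prod: "J \<notin> {1..t} \<or> p J = 0 \<Longrightarrow> fst (stage_prod t as p z) J = fst z J"
proof (induction as)
  case (Cons a as)
  have "fst ((stage_op t a ^^ p a) y) J = fst y J" for y
  proof (cases "a = J")
    case True
    have "fst ((stage_op t J ^^ n) y) J = fst y J" if "J \<notin> {1..t}" for n
      using that by (induction n) (auto simp: fst_stage_op)
    then show ?thesis using True Cons.prems by auto
  qed (simp add: fst_funpow_stage_op)
  then show ?case using Cons by simp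
qed simp

text \<open>For operators other than U_(j+1) the two stages differ by powers of q whose exponent is
  the coordinate j + 1. This coordinate starts at 0 and stays there, as U_(j+1) occurs with exponent
  0.\<close>

lemma stage_prod_Suc:
  assumes "set as \<subseteq> {1..k}" "z \<in> pts" "fst z (Suc j) = 0" "p (Suc j) = 0"
  shows "stage_prod (Suc j) as p z = stage_prod j as p z"
  using assms(1)
proof (induction as)
  case (Cons a as)
  let ?w = "stage_prod j as p z"
  have w: "?w \<in> pts" "fst ?w (Suc j) = 0"
    using Cons.prems assms by (auto simp: stage_prod_closed fst_stage_prod)
  have "(stage_op (Suc j) a ^^ n) ?w = (stage_op j a ^^ n) ?w" if "a \<noteq> Suc j" for n
  proof (induction n)
    case (Suc n)
    have "fst ((stage_op j a ^^ n) ?w) (Suc j) = 0"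
      using that w by (simp add: fst_funpow_stage_op)
    then show ?case using Suc that w Cons.prems by simp
  qed simp
  then show ?case using Cons assms by (cases "a = Suc j") auto
qed simp

text \<open>Descent through the stages, undoing one dilation at a time. The powers of U_(j+1) are
  brought to the front of both products, at the cost of phases. There the dilated kernel replaces
  them by powers of the operator \<open>stage_op j (Suc j)\<close> of the previous stage, and the
  same phases bring these back to their places in the products of stage j. Stage 0 is the inner
  product of H.\<close>

lemma stage_kernel_regular:
  assumes as: "distinct as" "set as \<subseteq> {1..k}" and bs: "distinct bs" "set bs \<subseteq> {1..k}"
    and pr: "\<And>i. p i = 0 \<or> r i = 0" and x: "x \<in> carrier H" and y: "y \<in> carrier H"
  shows "j \<le> k \<Longrightarrow> stage_kernel j (stage_prod j as p (\<lambda>_. 0, x)) (stage_prod j bs r (\<lambda>_. 0, y))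
    = inner H (opprod (map (\<lambda>a. T a ^^ p a) as) x) (opprod (map (\<lambda>a. T a ^^ r a) bs) y)"
proof (induction j)
  case 0
  have pow: "(stage_op 0 a ^^ n) z = (fst z, (T a ^^ n) (snd z))" for a n z
    by (induction n) simp_all
  have "stage_prod 0 as p z = (fst z, opprod (map (\<lambda>a. T a ^^ p a) as) (snd z))" for as p z
    by (induction as) (simp_all add: pow)
  then show ?case by simp
next
  case (Suc j)
  let ?J = "Suc j"
  have J: "?J \<in> {1..k}" using Suc.prems by simp
  define a where "a = (if ?J \<in> set as then p ?J else 0)"
  define b where "b = (if ?J \<in> set bs then r ?J else 0)"
  \<comment> \<open>The kernel sees the coordinates a and b only through a - b; its positive and
    negative parts recover a and b precisely because one of them is 0.\<close>
  have ab: "a = 0 \<or> b = 0" using pr by (auto simp: a_def b_def)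
  define z w where "z = (\<lambda>_::nat. 0::int, x)" and "w = (\<lambda>_::nat. 0::int, y)"
  have zw: "z \<in> pts" "w \<in> pts" "fst z ?J = 0" "fst w ?J = 0"
    using x y by (auto simp: z_def w_def pts_def)
  obtain \<theta> where \<theta>: "\<And>t. t \<le> k \<Longrightarrow> stage_prod t as p z
      = pscale \<theta> ((stage_op t ?J ^^ a) (stage_prod t as (p(?J := 0)) z))"
    using stage_prod_move[OF as J, of p] zw unfolding a_def by blast
  obtain \<eta> where \<eta>: "\<And>t. t \<le> k \<Longrightarrow> stage_prod t bs r w
      = pscale \<eta> ((stage_op t ?J ^^ b) (stage_prod t bs (r(?J := 0)) w))"
    using stage_prod_move[OF bs J, of r] zw unfolding b_def by blast
  define z' w' where "z' = stage_prod j as (p(?J := 0)) z" and "w' = stage_prod j bs (r(?J := 0)) w"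
  have zw': "z' \<in> pts" "w' \<in> pts" "fst z' ?J = 0" "fst w' ?J = 0"
    using zw as bs by (auto simp: z'_def w'_def stage_prod_closed fst_stage_prod)
  have "(stage_op ?J ?J ^^ n) v = shift ?J (int n) v" for n v
    by (induction n) (simp_all add: shift_shift_same add.commute)
  then have 1: "stage_prod ?J as p z = pscale \<theta> (shift ?J (int a) z')"
    "stage_prod ?J bs r w = pscale \<eta> (shift ?J (int b) w')"
    using \<theta>[of ?J] \<eta>[of ?J] Suc.prems zw as bs by (simp_all add: stage_prod_Suc z'_def w'_def)
  have 2: "stage_prod j as p z = pscale \<theta> ((stage_op j ?J ^^ a) z')"
    "stage_prod j bs r w = pscale \<eta> ((stage_op j ?J ^^ b) w')"
    using \<theta>[of j] \<eta>[of j] Suc.prems by (simp_all add: z'_def w'_def)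
  have cl: "shift ?J (int a) z' \<in> pts" "shift ?J (int b) w' \<in> pts" using zw' J by auto
  have "stage_kernel ?J (stage_prod ?J as p z) (stage_prod ?J bs r w)
      = \<theta> * (cnj \<eta> * stage_kernel ?J (shift ?J (int a) z') (shift ?J (int b) w'))"
    unfolding 1 using homogeneousD[OF homogeneous_stage_kernel[OF Suc.prems]] cl by simp
  also have "stage_kernel ?J (shift ?J (int a) z') (shift ?J (int b) w')
      = stage_kernel j ((stage_op j ?J ^^ a) z') ((stage_op j ?J ^^ b) w')"
    using ab zw' by (auto simp: dilate_def fst_shift funpow_stage_op_shift stage_kernel_shift
        stage_kernel_shift[where d = 0, simplified] stage_kernel_shift[where e = 0, simplified])
  also have "\<theta> * (cnj \<eta> * \<dots>) = stage_kernel j (stage_prod j as p z) (stage_prod j bs r w)"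
    unfolding 2 using homogeneousD[OF homogeneous_stage_kernel[of j]] Suc.prems zw' J by simp
  finally show ?case using Suc by (simp add: z_def w_def)
qed

end

section \<open>The reproducing kernel Hilbert space\<close>

locale psd_kernel =
  fixes C :: "'x set" and F :: "'x \<Rightarrow> 'x \<Rightarrow> complex"
  assumes hermitian: "x \<in> C \<Longrightarrow> y \<in> C \<Longrightarrow> F y x = cnj (F x y)"
    and psd: "psd_on C F"
begin

text \<open>The combination read as a function, each point x standing for its kernel section F x. A
  combination of seminorm 0 gives the zero function, so passing to functions performs the quotient
  by null vectors. The value 0 outside C makes a function determined by its values on C.\<close>

definition ev :: "(complex \<times> 'x) list \<Rightarrow> 'x \<Rightarrow> complex" where
  "ev l x = (if x \<in> C then lform F l [(1, x)] else 0)"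

definition sub :: "(complex \<times> 'x) list \<Rightarrow> (complex \<times> 'x) list \<Rightarrow> (complex \<times> 'x) list" where
  "sub l m = l @ cscale (-1) m"

definition nrm :: "(complex \<times> 'x) list \<Rightarrow> real" where
  "nrm l = sqrt (Re (lform F l l))"

lemma sub_combs [simp]: "sub l m \<in> combs C \<longleftrightarrow> l \<in> combs C \<and> m \<in> combs C"
  by (simp add: sub_def)

lemma ev_append: "ev (l @ m) x = ev l x + ev m x"
  and ev_cscale: "ev (cscale a l) x = a * ev l x"
  and ev_sub: "ev (sub l m) x = ev l x - ev m x"
  by (simp_all add: ev_def sub_def lform_append_left lform_cscale_left)

lemma lform_sub_left: "lform F (sub l l') m = lform F l m - lform F l' m"
  and lform_sub_right: "lform F l (sub m m') = lform F l m - lform F l m'"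
  by (simp_all add: sub_def lform_append_left lform_append_right lform_cscale_left lform_cscale_right)

lemma lform_self_nonneg: "l \<in> combs C \<Longrightarrow> 0 \<le> Re (lform F l l)"
  using psd by (simp add: psd_on_def)

lemma nrm_nonneg [simp]: "l \<in> combs C \<Longrightarrow> 0 \<le> nrm l"
  by (simp add: nrm_def lform_self_nonneg)

lemma nrm_sq: "l \<in> combs C \<Longrightarrow> (nrm l)\<^sup>2 = Re (lform F l l)"
  by (simp add: nrm_def lform_self_nonneg)

lemma lform_swap: "l \<in> combs C \<Longrightarrow> m \<in> combs C \<Longrightarrow> lform F m l = cnj (lform F l m)"
  by (rule lform_commute[OF hermitian])

lemma lform_le_nrm:
  assumes l: "l \<in> combs C" and m: "m \<in> combs C"
  shows "cmod (lform F l m) \<le> nrm l * nrm m"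
proof -
  have "(cmod (lform F m l))\<^sup>2 \<le> Re (lform F l l) * Re (lform F m m)"
  proof (rule cmod_sq_le_of_quadratic)
    fix t
    have "lform F (l @ cscale t m) (l @ cscale t m)
        = lform F l l + t * lform F m l + cnj (t * lform F m l) + (t * cnj t) * lform F m m"
      using lform_swap[OF m l]
      by (simp add: lform_append_left lform_append_right lform_cscale_left lform_cscale_right algebra_simps)
    also have "t * cnj t = complex_of_real ((cmod t)\<^sup>2)"
      by (simp add: complex_norm_square del: of_real_power)
    finally have "Re (lform F (l @ cscale t m) (l @ cscale t m))
        = Re (lform F l l) + 2 * Re (t * lform F m l) + (cmod t)\<^sup>2 * Re (lform F m m)"
      by (simp del: of_real_power)
    then show "0 \<le> Re (lform F l l) + 2 * Re (t * lform F m l) + (cmod t)\<^sup>2 * Re (lform F m m)"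
      using lform_self_nonneg[of "l @ cscale t m"] l m by simp
  qed (rule lform_self_nonneg[OF m])
  then have "(cmod (lform F l m))\<^sup>2 \<le> (nrm l * nrm m)\<^sup>2"
    using l m lform_swap[OF l m] by (simp add: nrm_sq power_mult_distrib)
  then show ?thesis using l m by (simp add: power2_le_iff_abs_le)
qed

lemma ev_le_nrm:
  assumes "l \<in> combs C" "x \<in> C"
  shows "cmod (ev l x) \<le> nrm l * nrm [(1, x)]"
  using lform_le_nrm[of l "[(1, x)]"] assms by (simp add: ev_def)

lemma nrm_append_le:
  assumes l: "l \<in> combs C" and m: "m \<in> combs C"
  shows "nrm (l @ m) \<le> nrm l + nrm m"
proof -
  have "(nrm (l @ m))\<^sup>2 = (nrm l)\<^sup>2 + (nrm m)\<^sup>2 + 2 * Re (lform F l m)"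
    using l m lform_swap[OF l m] by (simp add: nrm_sq lform_append_left lform_append_right)
  also have "\<dots> \<le> (nrm l + nrm m)\<^sup>2"
    using lform_le_nrm[OF l m] complex_Re_le_cmod[of "lform F l m"] by (simp add: power2_sum)
  finally show ?thesis using l m by (simp add: power2_le_iff_abs_le)
qed

lemma nrm_cscale: "l \<in> combs C \<Longrightarrow> nrm (cscale a l) = cmod a * nrm l"
proof -
  have "lform F (cscale a l) (cscale a l) = complex_of_real ((cmod a)\<^sup>2) * lform F l l"
    unfolding complex_norm_square by (simp add: lform_cscale_left lform_cscale_right mult_ac)
  then show ?thesis by (simp add: nrm_def real_sqrt_mult del: of_real_power)
qed

section \<open>Completion of the space of combinations\<close>

definition cauchy :: "(nat \<Rightarrow> (complex \<times> 'x) list) \<Rightarrow> bool" where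
  "cauchy L \<longleftrightarrow> (\<forall>n. L n \<in> combs C) \<and> (\<forall>e>0. \<exists>N. \<forall>m\<ge>N. \<forall>n\<ge>N. nrm (sub (L m) (L n)) < e)"

text \<open>Evaluation at a point is bounded for the seminorm, so a Cauchy sequence has a pointwise
  limit and the completion can be realised by functions instead of classes of sequences.\<close>

definition rep :: "(nat \<Rightarrow> (complex \<times> 'x) list) \<Rightarrow> ('x \<Rightarrow> complex) \<Rightarrow> bool" where
  "rep L f \<longleftrightarrow> cauchy L \<and> (\<forall>x. (\<lambda>n. ev (L n) x) \<longlonglongrightarrow> f x)"

lemma cauchy_combs [simp]: "cauchy L \<Longrightarrow> L n \<in> combs C"
  by (simp add: cauchy_def)

lemma cauchyD: "cauchy L \<Longrightarrow> e > 0 \<Longrightarrow> \<exists>N. \<forall>m\<ge>N. \<forall>n\<ge>N. nrm (sub (L m) (L n)) < e"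
  unfolding cauchy_def by blast

lemma rep_cauchy: "rep L f \<Longrightarrow> cauchy L"
  by (simp add: rep_def)

lemma cauchy_bounded:
  assumes "cauchy L"
  obtains B where "B > 0" "\<And>n. nrm (L n) \<le> B"
proof -
  obtain N where N: "\<forall>m\<ge>N. \<forall>n\<ge>N. nrm (sub (L m) (L n)) < 1"
    using cauchyD[OF assms zero_less_one] by blast
  define B where "B = (\<Sum>n<N. nrm (L n)) + nrm (L N) + 1"
  have nn: "0 \<le> (\<Sum>n<N. nrm (L n))" using assms by (intro sum_nonneg) simp
  have "nrm (L n) \<le> B" for n
  proof (cases "n < N")
    case True
    then have "nrm (L n) \<le> (\<Sum>n<N. nrm (L n))"
      using assms by (intro member_le_sum) auto
    then show ?thesis using nrm_nonneg[OF cauchy_combs[OF assms], of N] unfolding B_def by linarith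
  next
    case False
    have "nrm (L n) = nrm (sub (L n) (L N) @ L N)"
      by (simp add: nrm_def sub_def lform_append_left lform_append_right lform_cscale_left lform_cscale_right)
    also have "\<dots> \<le> nrm (sub (L n) (L N)) + nrm (L N)"
      using assms by (intro nrm_append_le) auto
    moreover have "nrm (sub (L n) (L N)) < 1" using False N by simp
    ultimately show ?thesis using nn unfolding B_def by linarith
  qed
  moreover have "B > 0" using nn nrm_nonneg[OF cauchy_combs[OF assms], of N] unfolding B_def by linarith
  ultimately show thesis using that by blast
qed

lemma cauchy_append:
  assumes L: "cauchy L" and M: "cauchy M"
  shows "cauchy (\<lambda>n. L n @ M n)"
  unfolding cauchy_def
proof (intro conjI allI impI)
  fix e :: real assume "e > 0"
  then obtain N1 N2 where N1: "\<forall>m\<ge>N1. \<forall>n\<ge>N1. nrm (sub (L m) (L n)) < e/2"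
    and N2: "\<forall>m\<ge>N2. \<forall>n\<ge>N2. nrm (sub (M m) (M n)) < e/2"
    using cauchyD[OF L, of "e/2"] cauchyD[OF M, of "e/2"] by auto
  have "nrm (sub (L m @ M m) (L n @ M n)) < e" if "m \<ge> max N1 N2" "n \<ge> max N1 N2" for m n
  proof -
    have "nrm (sub (L m @ M m) (L n @ M n)) = nrm (sub (L m) (L n) @ sub (M m) (M n))"
      by (simp add: nrm_def lform_sub_left lform_sub_right lform_append_left lform_append_right)
    also have "\<dots> \<le> nrm (sub (L m) (L n)) + nrm (sub (M m) (M n))"
      using L M by (intro nrm_append_le) auto
    also have "\<dots> < e"
      using N1[rule_format, of m n] N2[rule_format, of m n] that by simp
    finally show ?thesis .
  qed
  then show "\<exists>N. \<forall>m\<ge>N. \<forall>n\<ge>N. nrm (sub (L m @ M m) (L n @ M n)) < e" by blast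
qed (use L M in simp)

lemma cauchy_cscale:
  assumes L: "cauchy L"
  shows "cauchy (\<lambda>n. cscale a (L n))"
  unfolding cauchy_def
proof (intro conjI allI impI)
  fix e :: real assume "e > 0"
  then obtain N where N: "\<forall>m\<ge>N. \<forall>n\<ge>N. nrm (sub (L m) (L n)) < e / (cmod a + 1)"
    using cauchyD[OF L, of "e / (cmod a + 1)"] by (auto simp: add_nonneg_pos)
  have "nrm (sub (cscale a (L m)) (cscale a (L n))) < e" if "m \<ge> N" "n \<ge> N" for m n
  proof -
    have "nrm (sub (cscale a (L m)) (cscale a (L n))) = nrm (cscale a (sub (L m) (L n)))"
      by (simp add: nrm_def lform_sub_left lform_sub_right lform_cscale_left lform_cscale_right
          right_diff_distrib)
    also have "\<dots> = cmod a * nrm (sub (L m) (L n))"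
      using L by (simp add: nrm_cscale)
    also have "\<dots> \<le> (cmod a + 1) * nrm (sub (L m) (L n))"
      using L by (intro mult_right_mono) auto
    also have "\<dots> < e"
      using N that by (simp add: pos_less_divide_eq add_nonneg_pos mult.commute)
    finally show ?thesis .
  qed
  then show "\<exists>N. \<forall>m\<ge>N. \<forall>n\<ge>N. nrm (sub (cscale a (L m)) (cscale a (L n))) < e" by blast
qed (use L in simp)

lemma rep_append: "rep L f \<Longrightarrow> rep M g \<Longrightarrow> rep (\<lambda>n. L n @ M n) (\<lambda>x. f x + g x)"
  by (simp add: rep_def cauchy_append ev_append tendsto_add)

lemma rep_cscale: "rep L f \<Longrightarrow> rep (\<lambda>n. cscale a (L n)) (\<lambda>x. a * f x)"
  by (simp add: rep_def cauchy_cscale ev_cscale tendsto_mult_left)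

lemma rep_sub: "rep L f \<Longrightarrow> rep M g \<Longrightarrow> rep (\<lambda>n. sub (L n) (M n)) (\<lambda>x. f x - g x)"
  using rep_append[of L f "\<lambda>n. cscale (-1) (M n)" "\<lambda>x. (-1) * g x"] rep_cscale[of M g "-1"]
  by (simp add: sub_def)

lemma rep_const:
  assumes "l \<in> combs C"
  shows "rep (\<lambda>_. l) (ev l)"
proof -
  have "nrm (sub l l) = 0" by (simp add: nrm_def lform_sub_left lform_sub_right)
  then show ?thesis using assms by (simp add: rep_def cauchy_def)
qed

lemma cauchy_rep:
  assumes L: "cauchy L"
  shows "\<exists>f. rep L f"
proof -
  have "convergent (\<lambda>n. ev (L n) x)" for x
  proof (cases "x \<in> C")
    case True
    have "Cauchy (\<lambda>n. ev (L n) x)"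
    proof (rule metric_CauchyI)
      fix e :: real assume e: "e > 0"
      let ?B = "nrm [(1, x)] + 1"
      have B: "?B > 0" using True by (intro add_nonneg_pos) auto
      obtain N where N: "\<forall>m\<ge>N. \<forall>n\<ge>N. nrm (sub (L m) (L n)) < e / ?B"
        using cauchyD[OF L, of "e / ?B"] e B by auto
      have "dist (ev (L m) x) (ev (L n) x) < e" if "m \<ge> N" "n \<ge> N" for m n
      proof -
        have "dist (ev (L m) x) (ev (L n) x) = cmod (ev (sub (L m) (L n)) x)"
          by (simp add: dist_norm ev_sub)
        also have "\<dots> \<le> nrm (sub (L m) (L n)) * nrm [(1, x)]"
          using L True by (intro ev_le_nrm) auto
        also have "\<dots> \<le> nrm (sub (L m) (L n)) * ?B"
          using L by (intro mult_left_mono) auto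
        also have "\<dots> < e" using N that B by (simp add: pos_less_divide_eq)
        finally show ?thesis .
      qed
      then show "\<exists>N. \<forall>m\<ge>N. \<forall>n\<ge>N. dist (ev (L m) x) (ev (L n) x) < e" by blast
    qed
    then show ?thesis by (simp add: Cauchy_convergent_iff)
  qed (simp add: ev_def convergent_const)
  then have "rep L (\<lambda>x. lim (\<lambda>n. ev (L n) x))"
    using L by (simp add: rep_def convergent_LIMSEQ_iff)
  then show ?thesis by blast
qed

lemma lform_tendsto_zero:
  assumes "\<And>n. L n \<in> combs C" "\<And>n. M n \<in> combs C"
    and "(\<lambda>n. nrm (L n)) \<longlonglongrightarrow> 0" "\<And>n. nrm (M n) \<le> B"
  shows "(\<lambda>n. lform F (L n) (M n)) \<longlonglongrightarrow> 0"
proof (rule Lim_null_comparison)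
  have "cmod (lform F (L n) (M n)) \<le> nrm (L n) * B" for n
    using lform_le_nrm[of "L n" "M n"] mult_left_mono[OF assms(4), of "nrm (L n)" n] assms(1,2)
    by (meson nrm_nonneg order_trans)
  then show "\<forall>\<^sub>F n in sequentially. cmod (lform F (L n) (M n)) \<le> nrm (L n) * B" by simp
  show "(\<lambda>n. nrm (L n) * B) \<longlonglongrightarrow> 0"
    using tendsto_mult_right[OF assms(3), of B] by simp
qed

text \<open>The reason why a function determines its class of Cauchy sequences. For fixed N split
  the squared seminorm of \<open>D n\<close> into its pairings with \<open>D N\<close> and with the
  difference of \<open>D n\<close> and \<open>D N\<close>. The first tends to 0, being a fixed
  finite combination of point evaluations; the second is small by boundedness and the Cauchy
  property.\<close>

lemma rep_zero_nrm:
  assumes "rep D (\<lambda>_. 0)"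
  shows "(\<lambda>n. nrm (D n)) \<longlonglongrightarrow> 0"
proof -
  have D: "cauchy D" using assms rep_cauchy by blast
  obtain B where B: "B > 0" "\<And>n. nrm (D n) \<le> B" using cauchy_bounded[OF D] by blast
  have weak: "(\<lambda>n. lform F (D n) l) \<longlonglongrightarrow> 0" if "l \<in> combs C" for l
    using that
  proof (induction l)
    case (Cons p l)
    have "lform F (D n) [p] = cnj (fst p) * ev (D n) (snd p)" for n
      using Cons.prems lform_cscale_right[of F "D n" "fst p" "[(1, snd p)]"]
      by (simp add: ev_def cscale_def)
    moreover have "(\<lambda>n. cnj (fst p) * ev (D n) (snd p)) \<longlonglongrightarrow> cnj (fst p) * 0"
      using assms by (intro tendsto_mult_left) (simp add: rep_def)
    ultimately have "(\<lambda>n. lform F (D n) [p]) \<longlonglongrightarrow> 0" by simp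
    then have "(\<lambda>n. lform F (D n) [p] + lform F (D n) l) \<longlonglongrightarrow> 0 + 0"
      using Cons by (intro tendsto_add) auto
    then show ?case by (simp add: lform_Cons_right[of F _ p l])
  qed simp
  have "(\<lambda>n. (nrm (D n))\<^sup>2) \<longlonglongrightarrow> 0"
  proof (rule LIMSEQ_I)
    fix e :: real assume e: "e > 0"
    obtain N where N: "\<forall>m\<ge>N. \<forall>n\<ge>N. nrm (sub (D m) (D n)) < e / (2 * B)"
      using cauchyD[OF D, of "e / (2 * B)"] e B by auto
    obtain N' where N': "\<forall>n\<ge>N'. cmod (lform F (D n) (D N)) < e / 2"
      using LIMSEQ_D[OF weak[of "D N"], of "e / 2"] D e by auto
    have "norm ((nrm (D n))\<^sup>2 - 0) < e" if "n \<ge> max N N'" for n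
    proof -
      have "(nrm (D n))\<^sup>2 = Re (lform F (D n) (D N)) + Re (lform F (D n) (sub (D n) (D N)))"
        using D by (simp add: nrm_sq lform_sub_right)
      also have "\<dots> \<le> cmod (lform F (D n) (D N)) + nrm (D n) * nrm (sub (D n) (D N))"
        using lform_le_nrm[of "D n" "sub (D n) (D N)"] D
        by (intro add_mono complex_Re_le_cmod) (auto intro: order_trans[OF complex_Re_le_cmod])
      also have "\<dots> \<le> cmod (lform F (D n) (D N)) + B * nrm (sub (D n) (D N))"
        using D B by (intro add_left_mono mult_right_mono) auto
      also have "\<dots> < e / 2 + B * (e / (2 * B))"
        using N[rule_format, of n N] N'[rule_format, of n] that B
        by (intro add_strict_mono mult_strict_left_mono) auto
      also have "\<dots> = e" using B by simp
      finally show ?thesis by simp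
    qed
    then show "\<exists>no. \<forall>n\<ge>no. norm ((nrm (D n))\<^sup>2 - 0) < e" by blast
  qed
  then have "(\<lambda>n. sqrt ((nrm (D n))\<^sup>2)) \<longlonglongrightarrow> sqrt 0" by (intro tendsto_real_sqrt)
  then show ?thesis using D by simp
qed

lemma lform_convergent:
  assumes L: "cauchy L" and M: "cauchy M"
  shows "convergent (\<lambda>n. lform F (L n) (M n))"
proof -
  obtain A where A: "A > 0" "\<And>n. nrm (L n) \<le> A" using cauchy_bounded[OF L] by blast
  obtain B where B: "B > 0" "\<And>n. nrm (M n) \<le> B" using cauchy_bounded[OF M] by blast
  have "Cauchy (\<lambda>n. lform F (L n) (M n))"
  proof (rule metric_CauchyI)
    fix e :: real assume e: "e > 0"
    obtain N1 where N1: "\<forall>m\<ge>N1. \<forall>n\<ge>N1. nrm (sub (L m) (L n)) < e / (2 * B)"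
      using cauchyD[OF L, of "e / (2 * B)"] e B by auto
    obtain N2 where N2: "\<forall>m\<ge>N2. \<forall>n\<ge>N2. nrm (sub (M m) (M n)) < e / (2 * A)"
      using cauchyD[OF M, of "e / (2 * A)"] e A by auto
    have "dist (lform F (L m) (M m)) (lform F (L n) (M n)) < e"
      if "m \<ge> max N1 N2" "n \<ge> max N1 N2" for m n
    proof -
      have "lform F (L m) (M m) - lform F (L n) (M n)
          = lform F (sub (L m) (L n)) (M m) + lform F (L n) (sub (M m) (M n))"
        by (simp add: lform_sub_left lform_sub_right)
      then have "dist (lform F (L m) (M m)) (lform F (L n) (M n))
          \<le> cmod (lform F (sub (L m) (L n)) (M m)) + cmod (lform F (L n) (sub (M m) (M n)))"
        by (simp add: dist_norm norm_triangle_ineq)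
      also have "\<dots> \<le> nrm (sub (L m) (L n)) * nrm (M m) + nrm (L n) * nrm (sub (M m) (M n))"
        using L M by (intro add_mono lform_le_nrm) auto
      also have "\<dots> \<le> nrm (sub (L m) (L n)) * B + A * nrm (sub (M m) (M n))"
        using L M A B by (intro add_mono mult_left_mono mult_right_mono) auto
      also have "\<dots> < e / (2 * B) * B + A * (e / (2 * A))"
        using N1[rule_format, of m n] N2[rule_format, of m n] that A B
        by (intro add_strict_mono mult_strict_left_mono mult_strict_right_mono) auto
      also have "\<dots> = e" using A B by simp
      finally show ?thesis .
    qed
    then show "\<exists>N. \<forall>m\<ge>N. \<forall>n\<ge>N. dist (lform F (L m) (M m)) (lform F (L n) (M n)) < e" by blast
  qed
  then show ?thesis by (simp add: Cauchy_convergent_iff)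
qed

section \<open>The inner product on the completion\<close>

definition ip :: "('x \<Rightarrow> complex) \<Rightarrow> ('x \<Rightarrow> complex) \<Rightarrow> complex" where
  "ip f g = lim (\<lambda>n. lform F ((SOME L. rep L f) n) ((SOME L. rep L g) n))"

text \<open>Independence of the representatives chosen in \<open>ip\<close>: the difference of two
  representatives of one function converges pointwise to 0, hence in seminorm by
  \<open>rep_zero_nrm\<close>, and the other argument stays bounded.\<close>

lemma ip_limit:
  assumes L: "rep L f" and M: "rep M g"
  shows "(\<lambda>n. lform F (L n) (M n)) \<longlonglongrightarrow> ip f g"
proof -
  define L' M' where "L' = (SOME L. rep L f)" and "M' = (SOME L. rep L g)"
  have L': "rep L' f" unfolding L'_def by (rule someI[of "\<lambda>L. rep L f", OF L])
  have M': "rep M' g" unfolding M'_def by (rule someI[of "\<lambda>L. rep L g", OF M])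
  note c = rep_cauchy[OF L] rep_cauchy[OF M] rep_cauchy[OF L'] rep_cauchy[OF M']
  have lim: "(\<lambda>n. lform F (L' n) (M' n)) \<longlonglongrightarrow> ip f g"
    using lform_convergent[OF c(3,4)] unfolding ip_def L'_def M'_def by (simp add: convergent_LIMSEQ_iff)
  obtain A where A: "\<And>n. nrm (L' n) \<le> A" using cauchy_bounded[OF c(3)] by blast
  obtain B where B: "\<And>n. nrm (M n) \<le> B" using cauchy_bounded[OF c(2)] by blast
  have dL: "(\<lambda>n. nrm (sub (L n) (L' n))) \<longlonglongrightarrow> 0"
    using rep_sub[OF L L'] by (intro rep_zero_nrm) simp
  have dM: "(\<lambda>n. nrm (sub (M n) (M' n))) \<longlonglongrightarrow> 0"
    using rep_sub[OF M M'] by (intro rep_zero_nrm) simp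
  have 1: "(\<lambda>n. lform F (sub (L n) (L' n)) (M n)) \<longlonglongrightarrow> 0"
    using c dL B by (intro lform_tendsto_zero) auto
  have "(\<lambda>n. lform F (sub (M n) (M' n)) (L' n)) \<longlonglongrightarrow> 0"
    using c dM A by (intro lform_tendsto_zero) auto
  then have "(\<lambda>n. cnj (lform F (sub (M n) (M' n)) (L' n))) \<longlonglongrightarrow> cnj 0"
    by (rule tendsto_cnj)
  moreover have "lform F (L' n) (sub (M n) (M' n)) = cnj (lform F (sub (M n) (M' n)) (L' n))" for n
    by (rule lform_swap) (use c in auto)
  ultimately have 2: "(\<lambda>n. lform F (L' n) (sub (M n) (M' n))) \<longlonglongrightarrow> 0" by simp
  have "(\<lambda>n. lform F (sub (L n) (L' n)) (M n) + lform F (L' n) (sub (M n) (M' n)) + lform F (L' n) (M' n))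
      \<longlonglongrightarrow> 0 + 0 + ip f g"
    by (intro tendsto_add 1 2 lim)
  then show ?thesis by (simp add: lform_sub_left lform_sub_right)
qed

lemma ip_eqI: "rep L f \<Longrightarrow> rep M g \<Longrightarrow> (\<lambda>n. lform F (L n) (M n)) \<longlonglongrightarrow> c \<Longrightarrow> ip f g = c"
  using ip_limit LIMSEQ_unique by blast

definition rkhs :: "('x \<Rightarrow> complex) chs" where
  "rkhs = \<lparr>carrier = {f. \<exists>L. rep L f}, zero = (\<lambda>_. 0), add = (\<lambda>f g x. f x + g x),
     scale = (\<lambda>a f x. a * f x), inner = ip\<rparr>"

lemma rkhs_simps [simp]: "carrier rkhs = {f. \<exists>L. rep L f}" "zero rkhs = (\<lambda>_. 0)"
  "add rkhs f g = (\<lambda>x. f x + g x)" "scale rkhs a f = (\<lambda>x. a * f x)" "inner rkhs = ip"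
  "hdiff rkhs f g = (\<lambda>x. f x - g x)"
  by (simp_all add: rkhs_def hdiff_def)

lemma ip_add_left:
  assumes "rep L f" "rep M g" "rep N h"
  shows "ip (\<lambda>x. f x + g x) h = ip f h + ip g h"
  by (rule ip_eqI[OF rep_append[OF assms(1,2)] assms(3)])
    (simp add: lform_append_left tendsto_add ip_limit assms)

lemma ip_scale_left:
  assumes "rep L f" "rep M g"
  shows "ip (\<lambda>x. a * f x) g = a * ip f g"
  by (rule ip_eqI[OF rep_cscale[OF assms(1)] assms(2)])
    (simp add: lform_cscale_left tendsto_mult_left ip_limit assms)

lemma ip_commute:
  assumes "rep L f" "rep M g"
  shows "ip g f = cnj (ip f g)"
proof (rule ip_eqI[OF assms(2,1)])
  have "lform F (M n) (L n) = cnj (lform F (L n) (M n))" for n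
    by (rule lform_swap) (use assms rep_cauchy cauchy_combs in blast)+
  then show "(\<lambda>n. lform F (M n) (L n)) \<longlonglongrightarrow> cnj (ip f g)"
    using tendsto_cnj[OF ip_limit[OF assms]] by simp
qed

lemma ip_uminus_self:
  assumes "rep L f"
  shows "ip (\<lambda>x. (-1) * f x) (\<lambda>x. (-1) * f x) = ip f f"
  by (rule ip_eqI[OF rep_cscale[OF assms] rep_cscale[OF assms]])
    (simp add: lform_cscale_left lform_cscale_right ip_limit assms)

lemma ip_limit_self:
  assumes "rep L f"
  shows "(\<lambda>n. (nrm (L n))\<^sup>2) \<longlonglongrightarrow> Re (ip f f)"
  using tendsto_Re[OF ip_limit[OF assms assms]] rep_cauchy[OF assms] by (simp add: nrm_sq)

lemma ip_self_nonneg: "rep L f \<Longrightarrow> 0 \<le> Re (ip f f)"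
  by (rule LIMSEQ_le_const[OF ip_limit_self]) auto

lemma ip_self_zeroD:
  assumes L: "rep L f" and z: "ip f f = 0"
  shows "f = (\<lambda>_. 0)"
proof
  fix x
  have c: "cauchy L" using rep_cauchy[OF L] .
  have "(\<lambda>n. sqrt ((nrm (L n))\<^sup>2)) \<longlonglongrightarrow> sqrt 0"
    using ip_limit_self[OF L] z by (intro tendsto_real_sqrt) simp
  then have n: "(\<lambda>n. nrm (L n)) \<longlonglongrightarrow> 0" using c by simp
  have "(\<lambda>n. ev (L n) x) \<longlonglongrightarrow> 0"
  proof (cases "x \<in> C")
    case True
    then have "(\<lambda>n. lform F (L n) [(1, x)]) \<longlonglongrightarrow> 0"
      using c n by (intro lform_tendsto_zero[where B = "nrm [(1, x)]"]) auto
    then show ?thesis using True by (simp add: ev_def)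
  qed (simp add: ev_def)
  then show "f x = 0" using L LIMSEQ_unique unfolding rep_def by blast
qed

lemma ip_ev:
  assumes "rep L f" "x \<in> C"
  shows "ip f (ev [(1, x)]) = f x"
proof (rule ip_eqI[OF assms(1) rep_const])
  have "(\<lambda>n. ev (L n) x) \<longlonglongrightarrow> f x" using assms(1) by (simp add: rep_def)
  then show "(\<lambda>n. lform F (L n) [(1, x)]) \<longlonglongrightarrow> f x" using assms(2) by (simp add: ev_def)
qed (use assms in simp)

text \<open>The parallelogram law with the nonnegative term of f - g dropped. It replaces the
  triangle inequality in the completeness proof and needs no square roots.\<close>

lemma ip_add_self_le:
  assumes f: "rep L f" and g: "rep M g"
  shows "Re (ip (\<lambda>x. f x + g x) (\<lambda>x. f x + g x)) \<le> 2 * Re (ip f f) + 2 * Re (ip g g)"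
proof -
  note d = rep_sub[OF f g] and s = rep_append[OF f g]
  have "(\<lambda>n. (nrm (L n @ M n))\<^sup>2 + (nrm (sub (L n) (M n)))\<^sup>2) \<longlonglongrightarrow>
      Re (ip (\<lambda>x. f x + g x) (\<lambda>x. f x + g x)) + Re (ip (\<lambda>x. f x - g x) (\<lambda>x. f x - g x))"
    by (intro tendsto_add ip_limit_self d s)
  moreover have "(\<lambda>n. 2 * (nrm (L n))\<^sup>2 + 2 * (nrm (M n))\<^sup>2) \<longlonglongrightarrow> 2 * Re (ip f f) + 2 * Re (ip g g)"
    by (intro tendsto_add tendsto_mult_left ip_limit_self f g)
  moreover have "(nrm (L n @ M n))\<^sup>2 + (nrm (sub (L n) (M n)))\<^sup>2 = 2 * (nrm (L n))\<^sup>2 + 2 * (nrm (M n))\<^sup>2" for n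
    using rep_cauchy[OF f] rep_cauchy[OF g]
    by (simp add: nrm_sq lform_sub_left lform_sub_right lform_append_left lform_append_right)
  ultimately have "Re (ip (\<lambda>x. f x + g x) (\<lambda>x. f x + g x)) + Re (ip (\<lambda>x. f x - g x) (\<lambda>x. f x - g x))
      = 2 * Re (ip f f) + 2 * Re (ip g g)"
    by (simp add: LIMSEQ_unique)
  then show ?thesis using ip_self_nonneg[OF d] by linarith
qed

lemma rep_close:
  assumes L: "rep L f" and N: "\<forall>m\<ge>N. nrm (sub (L m) l) \<le> e" and l: "l \<in> combs C" and e: "0 \<le> e"
  shows "Re (ip (\<lambda>x. f x - ev l x) (\<lambda>x. f x - ev l x)) \<le> e\<^sup>2"
proof (rule LIMSEQ_le_const2[OF ip_limit_self[OF rep_sub[OF L rep_const[OF l]]]])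
  show "\<exists>N. \<forall>n\<ge>N. (nrm (sub (L n) l))\<^sup>2 \<le> e\<^sup>2"
    using N l rep_cauchy[OF L] by (intro exI[of _ N] allI impI power_mono) auto
qed

text \<open>Each \<open>X n\<close> is approximated within 1/(n+1) by a single finite combination.
  These combinations form a Cauchy sequence, and the function it represents is the limit of the
  given sequence.\<close>

lemma rkhs_complete:
  assumes X: "\<And>n. \<exists>L. rep L (X n)"
    and cau: "\<And>e. e > 0 \<Longrightarrow> \<exists>N. \<forall>m\<ge>N. \<forall>n\<ge>N. hnorm rkhs (hdiff rkhs (X m) (X n)) < e"
  shows "\<exists>f. (\<exists>L. rep L f) \<and> (\<lambda>n. hnorm rkhs (hdiff rkhs (X n) f)) \<longlonglongrightarrow> 0"
proof -
  let ?N2 = "\<lambda>f. Re (ip f f)"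
  have "\<exists>l\<in>combs C. ?N2 (\<lambda>x. X n x - ev l x) \<le> (1 / real (Suc n))\<^sup>2" for n
  proof -
    obtain L where L: "rep L (X n)" using X by blast
    obtain N where "\<forall>m\<ge>N. \<forall>i\<ge>N. nrm (sub (L m) (L i)) < 1 / real (Suc n)"
      using cauchyD[OF rep_cauchy[OF L], of "1 / real (Suc n)"] by auto
    then have "\<forall>m\<ge>N. nrm (sub (L m) (L N)) \<le> 1 / real (Suc n)"
      by (meson le_refl less_imp_le)
    moreover have "L N \<in> combs C" using rep_cauchy[OF L] by simp
    ultimately show ?thesis using rep_close[OF L, of N "L N" "1 / real (Suc n)"] by auto
  qed
  then obtain l where l: "\<And>n. l n \<in> combs C" "\<And>n. ?N2 (\<lambda>x. X n x - ev (l n) x) \<le> (1 / real (Suc n))\<^sup>2"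
    by metis
  have small: "\<exists>N. \<forall>n\<ge>N. ?N2 (\<lambda>x. X n x - ev (l n) x) < e" if "e > 0" for e
  proof -
    have "(\<lambda>n. (1 / real (Suc n))\<^sup>2) \<longlonglongrightarrow> 0\<^sup>2"
      using LIMSEQ_inverse_real_of_nat by (intro tendsto_power) (simp add: inverse_eq_divide)
    then have "\<forall>\<^sub>F n in sequentially. (1 / real (Suc n))\<^sup>2 < e"
      using that by (intro order_tendstoD(2)[where y = "0\<^sup>2"]) auto
    then show ?thesis using l(2) unfolding eventually_sequentially by (meson le_less_trans)
  qed
  have rX: "\<exists>L. rep L (\<lambda>x. X n x - ev (l n) x)" for n
    using X[of n] rep_sub[OF _ rep_const[OF l(1)]] by blast
  have "cauchy l"
    unfolding cauchy_def
  proof (intro conjI allI impI)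
    fix e :: real assume e: "e > 0"
    \<comment> \<open>Two uses of \<open>ip_add_self_le\<close> give the three squared distances the
      weights 2, 4 and 4; their sum 10 is below 12.\<close>
    obtain N1 where N1: "\<forall>n\<ge>N1. ?N2 (\<lambda>x. X n x - ev (l n) x) < e\<^sup>2 / 12"
      using small[of "e\<^sup>2 / 12"] e by auto
    obtain N2 where N2: "\<forall>m\<ge>N2. \<forall>n\<ge>N2. hnorm rkhs (hdiff rkhs (X m) (X n)) < sqrt (e\<^sup>2 / 12)"
      using cau[of "sqrt (e\<^sup>2 / 12)"] e by auto
    have "nrm (sub (l m) (l n)) < e" if m: "m \<ge> max N1 N2" and n: "n \<ge> max N1 N2" for m n
    proof -
      obtain A B D where A: "rep A (\<lambda>x. X m x - ev (l m) x)" and B: "rep B (\<lambda>x. X n x - ev (l n) x)"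
        and D: "rep D (\<lambda>x. X m x - X n x)"
        using rX rep_sub X by metis
      have hn: "hnorm rkhs (hdiff rkhs (X m) (X n)) = sqrt (?N2 (\<lambda>x. X m x - X n x))"
        by (simp add: hnorm_def)
      have "sqrt (?N2 (\<lambda>x. X m x - X n x)) < sqrt (e\<^sup>2 / 12)"
        using N2[rule_format, of m n] m n unfolding hn by simp
      then have d: "?N2 (\<lambda>x. X m x - X n x) < e\<^sup>2 / 12" by (simp only: real_sqrt_less_iff)
      have E: "rep (\<lambda>i. cscale (-1) (A i)) (\<lambda>x. (-1) * (X m x - ev (l m) x))" by (rule rep_cscale[OF A])
      have neg: "?N2 (\<lambda>x. (-1) * (X m x - ev (l m) x)) = ?N2 (\<lambda>x. X m x - ev (l m) x)"
        using ip_uminus_self[OF A] by (rule arg_cong)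
      have "(nrm (sub (l m) (l n)))\<^sup>2 = ?N2 (\<lambda>x. ev (l m) x - ev (l n) x)"
        using ip_limit_self[OF rep_sub[OF rep_const[OF l(1)] rep_const[OF l(1)]], of m n]
        by (simp add: LIMSEQ_const_iff)
      also have "\<dots> = ?N2 (\<lambda>x. (-1) * (X m x - ev (l m) x) + ((X m x - X n x) + (X n x - ev (l n) x)))"
        by (simp add: algebra_simps)
      also have "\<dots> \<le> 2 * ?N2 (\<lambda>x. (-1) * (X m x - ev (l m) x))
          + 2 * ?N2 (\<lambda>x. (X m x - X n x) + (X n x - ev (l n) x))"
        by (rule ip_add_self_le[OF E rep_append[OF D B]])
      also have "\<dots> \<le> 2 * ?N2 (\<lambda>x. X m x - ev (l m) x)
          + 2 * (2 * ?N2 (\<lambda>x. X m x - X n x) + 2 * ?N2 (\<lambda>x. X n x - ev (l n) x))"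
        unfolding neg using ip_add_self_le[OF D B] by simp
      also have "\<dots> < e\<^sup>2"
      proof -
        have "?N2 (\<lambda>x. X m x - ev (l m) x) < e\<^sup>2 / 12" "?N2 (\<lambda>x. X n x - ev (l n) x) < e\<^sup>2 / 12"
          using N1 m n by auto
        then show ?thesis using d zero_less_power[OF e, of 2] by argo
      qed
      finally show ?thesis using e by (simp add: power2_less_imp_less)
    qed
    then show "\<exists>N. \<forall>m\<ge>N. \<forall>n\<ge>N. nrm (sub (l m) (l n)) < e" by blast
  qed (rule l)
  then obtain f where f: "rep l f" using cauchy_rep by blast
  have "(\<lambda>n. hnorm rkhs (hdiff rkhs (X n) f)) \<longlonglongrightarrow> 0"
  proof (rule LIMSEQ_I)
    fix e :: real assume e: "e > 0"
    \<comment> \<open>The final estimate is 2 d^2 + 2 d^2 = (4/9) e^2, which is below e^2.\<close>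
    define d where "d = e / 3"
    have d: "d > 0" using e by (simp add: d_def)
    obtain N1 where N1: "\<forall>n\<ge>N1. ?N2 (\<lambda>x. X n x - ev (l n) x) < d\<^sup>2"
      using small[of "d\<^sup>2"] d by auto
    obtain N2 where N2: "\<forall>m\<ge>N2. \<forall>n\<ge>N2. nrm (sub (l m) (l n)) < d"
      using cauchyD[OF \<open>cauchy l\<close> d] by blast
    have "hnorm rkhs (hdiff rkhs (X n) f) < e" if n: "n \<ge> max N1 N2" for n
    proof -
      obtain A where A: "rep A (\<lambda>x. X n x - ev (l n) x)" using rX by blast
      have B: "rep (\<lambda>i. sub (l i) (l n)) (\<lambda>x. f x - ev (l n) x)"
        by (rule rep_sub[OF f rep_const[OF l(1)]])
      have E: "rep (\<lambda>i. cscale (-1) (sub (l i) (l n))) (\<lambda>x. (-1) * (f x - ev (l n) x))"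
        by (rule rep_cscale[OF B])
      have neg: "?N2 (\<lambda>x. (-1) * (f x - ev (l n) x)) = ?N2 (\<lambda>x. f x - ev (l n) x)"
        using ip_uminus_self[OF B] by (rule arg_cong)
      have "\<forall>m\<ge>N2. nrm (sub (l m) (l n)) \<le> d"
        using N2 n by (auto intro: less_imp_le)
      then have 1: "?N2 (\<lambda>x. f x - ev (l n) x) \<le> d\<^sup>2"
        using rep_close[OF f _ l(1)] d by simp
      have "?N2 (\<lambda>x. X n x - f x) = ?N2 (\<lambda>x. (X n x - ev (l n) x) + (-1) * (f x - ev (l n) x))"
        by simp
      also have "\<dots> \<le> 2 * ?N2 (\<lambda>x. X n x - ev (l n) x) + 2 * ?N2 (\<lambda>x. (-1) * (f x - ev (l n) x))"
        by (rule ip_add_self_le[OF A E])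
      also have "\<dots> < 4 * d\<^sup>2"
        unfolding neg using 1 N1[rule_format, of n] n by simp
      also have "\<dots> < e\<^sup>2"
        using e by (simp add: d_def power2_eq_square)
      finally have "sqrt (?N2 (\<lambda>x. X n x - f x)) < sqrt (e\<^sup>2)" by (simp only: real_sqrt_less_iff)
      then show ?thesis using e by (simp add: hnorm_def)
    qed
    moreover have "0 \<le> hnorm rkhs (hdiff rkhs (X n) f)" for n
    proof -
      obtain A where "rep A (X n)" using X by blast
      from ip_self_nonneg[OF rep_sub[OF this f]] show ?thesis by (simp add: hnorm_def)
    qed
    ultimately show "\<exists>no. \<forall>n\<ge>no. norm (hnorm rkhs (hdiff rkhs (X n) f) - 0) < e"
      by (intro exI[of _ "max N1 N2"]) simp
  qed
  with f show ?thesis by blast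
qed

lemma hilbert_space_rkhs: "hilbert_space rkhs"
  unfolding hilbert_space_def
proof (intro conjI)
  show "zero rkhs \<in> carrier rkhs"
  proof -
    have "ev [] = (\<lambda>_. 0)" by (simp add: ev_def fun_eq_iff)
    then show ?thesis using rep_const[of "[]"] by auto
  qed
  show "\<forall>x\<in>carrier rkhs. \<forall>y\<in>carrier rkhs. add rkhs x y \<in> carrier rkhs"
    using rep_append by fastforce
  show "\<forall>a. \<forall>x\<in>carrier rkhs. scale rkhs a x \<in> carrier rkhs"
    using rep_cscale by fastforce
  show "\<forall>x\<in>carrier rkhs. \<exists>y\<in>carrier rkhs. add rkhs x y = zero rkhs"
  proof
    fix f assume "f \<in> carrier rkhs"
    then obtain L where "rep L f" by auto
    from rep_cscale[OF this, of "-1"] show "\<exists>g\<in>carrier rkhs. add rkhs f g = zero rkhs"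
      by (intro bexI[of _ "\<lambda>x. (-1) * f x"]) auto
  qed
  show "\<forall>x\<in>carrier rkhs. \<forall>y\<in>carrier rkhs. \<forall>z\<in>carrier rkhs.
      inner rkhs (add rkhs x y) z = inner rkhs x z + inner rkhs y z"
    using ip_add_left by auto
  show "\<forall>a. \<forall>x\<in>carrier rkhs. \<forall>y\<in>carrier rkhs. inner rkhs (scale rkhs a x) y = a * inner rkhs x y"
    using ip_scale_left by auto
  show "\<forall>x\<in>carrier rkhs. \<forall>y\<in>carrier rkhs. inner rkhs y x = cnj (inner rkhs x y)"
  proof (intro ballI)
    fix f g assume "f \<in> carrier rkhs" "g \<in> carrier rkhs"
    then show "inner rkhs g f = cnj (inner rkhs f g)" by (auto intro: ip_commute)
  qed
  show "\<forall>x\<in>carrier rkhs. 0 \<le> Re (inner rkhs x x)"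
    using ip_self_nonneg by auto
  show "\<forall>x\<in>carrier rkhs. inner rkhs x x = 0 \<longrightarrow> x = zero rkhs"
    using ip_self_zeroD by auto
  show "\<forall>X. (\<forall>n. X n \<in> carrier rkhs) \<longrightarrow>
      (\<forall>e>0. \<exists>N. \<forall>m\<ge>N. \<forall>n\<ge>N. hnorm rkhs (hdiff rkhs (X m) (X n)) < e) \<longrightarrow>
      (\<exists>L\<in>carrier rkhs. (\<lambda>n. hnorm rkhs (hdiff rkhs (X n) L)) \<longlonglongrightarrow> 0)"
  proof (intro allI impI)
    fix X :: "nat \<Rightarrow> 'x \<Rightarrow> complex"
    assume "\<forall>n. X n \<in> carrier rkhs"
      and "\<forall>e>0. \<exists>N. \<forall>m\<ge>N. \<forall>n\<ge>N. hnorm rkhs (hdiff rkhs (X m) (X n)) < e"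
    then show "\<exists>L\<in>carrier rkhs. (\<lambda>n. hnorm rkhs (hdiff rkhs (X n) L)) \<longlonglongrightarrow> 0"
      using rkhs_complete[of X] by auto
  qed
qed (simp_all add: algebra_simps)

definition point :: "'x \<Rightarrow> 'x \<Rightarrow> complex" where
  "point x = ev [(1, x)]"

lemma rep_point: "x \<in> C \<Longrightarrow> rep (\<lambda>_. [(1, x)]) (point x)"
  unfolding point_def by (rule rep_const) simp

lemma point_closed: "x \<in> C \<Longrightarrow> point x \<in> carrier rkhs"
  using rep_point by auto

lemma point_apply: "x \<in> C \<Longrightarrow> y \<in> C \<Longrightarrow> point x y = F x y"
  by (simp add: point_def ev_def lform_def)

lemma reproducing: "f \<in> carrier rkhs \<Longrightarrow> x \<in> C \<Longrightarrow> inner rkhs f (point x) = f x"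
  using ip_ev by (auto simp: point_def)

lemma rkhs_outside:
  assumes "f \<in> carrier rkhs" "x \<notin> C"
  shows "f x = 0"
proof -
  from assms obtain L where "(\<lambda>n. ev (L n) x) \<longlonglongrightarrow> f x" by (auto simp: rep_def)
  then show ?thesis using assms by (simp add: ev_def LIMSEQ_const_iff)
qed

section \<open>Unitaries induced by bijections that preserve the kernel\<close>

definition pull :: "('x \<Rightarrow> 'x) \<Rightarrow> ('x \<Rightarrow> complex) \<Rightarrow> 'x \<Rightarrow> complex" where
  "pull \<tau> f = (\<lambda>x. if x \<in> C then f (\<tau> x) else 0)"

context
  fixes \<sigma> \<tau> :: "'x \<Rightarrow> 'x"
  assumes \<sigma>: "x \<in> C \<Longrightarrow> \<sigma> x \<in> C" and \<tau>: "x \<in> C \<Longrightarrow> \<tau> x \<in> C"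
    and \<sigma>\<tau>: "x \<in> C \<Longrightarrow> \<sigma> (\<tau> x) = x"
    and invariant: "x \<in> C \<Longrightarrow> y \<in> C \<Longrightarrow> F (\<sigma> x) (\<sigma> y) = F x y"
begin

lemma lform_map_invariant:
  assumes "l \<in> combs C" "m \<in> combs C"
  shows "lform F (map (map_prod id \<sigma>) l) (map (map_prod id \<sigma>) m) = lform F l m"
  unfolding lform_map
  by (rule lform_cong, rule invariant) (use assms in \<open>auto simp: combs_def\<close>)

text \<open>Since F (\<sigma> x) y = F x (\<tau> y), moving the points of a combination by \<sigma>
  amounts to composing its function with the inverse map \<tau>. The moved sequence has the same
  pairings, hence is again Cauchy.\<close>

lemma rep_pull:
  assumes L: "rep L f"
  shows "rep (\<lambda>n. map (map_prod id \<sigma>) (L n)) (pull \<tau> f)"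
proof -
  let ?M = "\<lambda>n. map (map_prod id \<sigma>) (L n)"
  have c: "cauchy L" using rep_cauchy[OF L] .
  have M: "map (map_prod id \<sigma>) l \<in> combs C" if "l \<in> combs C" for l
    using that \<sigma> by (auto simp: combs_def)
  have "nrm (sub (?M m) (?M n)) = nrm (sub (L m) (L n))" for m n
  proof -
    have "sub (?M m) (?M n) = map (map_prod id \<sigma>) (sub (L m) (L n))"
      by (auto simp: sub_def cscale_def)
    then show ?thesis using c by (simp add: nrm_def lform_map_invariant)
  qed
  then have "cauchy ?M" using c M unfolding cauchy_def by simp
  moreover have "(\<lambda>n. ev (?M n) x) \<longlonglongrightarrow> pull \<tau> f x" for x
  proof (cases "x \<in> C")
    case True
    have "ev (?M n) x = ev (L n) (\<tau> x)" for n
      using lform_map_invariant[of "L n" "[(1, \<tau> x)]"] True c \<tau> \<sigma>\<tau> by (simp add: ev_def)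
    then show ?thesis using L True by (simp add: pull_def rep_def)
  qed (simp add: ev_def pull_def)
  ultimately show ?thesis by (simp add: rep_def)
qed

lemma pull_closed: "f \<in> carrier rkhs \<Longrightarrow> pull \<tau> f \<in> carrier rkhs"
  using rep_pull by auto

lemma inner_pull:
  assumes "f \<in> carrier rkhs" "g \<in> carrier rkhs"
  shows "inner rkhs (pull \<tau> f) (pull \<tau> g) = inner rkhs f g"
proof -
  from assms obtain L M where LM: "rep L f" "rep M g" by auto
  have "ip (pull \<tau> f) (pull \<tau> g) = ip f g"
  proof (rule ip_eqI[OF rep_pull[OF LM(1)] rep_pull[OF LM(2)]])
    show "(\<lambda>n. lform F (map (map_prod id \<sigma>) (L n)) (map (map_prod id \<sigma>) (M n))) \<longlonglongrightarrow> ip f g"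
      using ip_limit[OF LM] rep_cauchy[OF LM(1)] rep_cauchy[OF LM(2)] by (simp add: lform_map_invariant)
  qed
  then show ?thesis by simp
qed

end

lemma unitary_pull:
  assumes \<sigma>: "\<And>x. x \<in> C \<Longrightarrow> \<sigma> x \<in> C" and \<tau>: "\<And>x. x \<in> C \<Longrightarrow> \<tau> x \<in> C"
    and \<sigma>\<tau>: "\<And>x. x \<in> C \<Longrightarrow> \<sigma> (\<tau> x) = x" and \<tau>\<sigma>: "\<And>x. x \<in> C \<Longrightarrow> \<tau> (\<sigma> x) = x"
    and inv: "\<And>x y. x \<in> C \<Longrightarrow> y \<in> C \<Longrightarrow> F (\<sigma> x) (\<sigma> y) = F x y"
  shows "unitary rkhs (pull \<tau>)"
proof -
  have inv': "F (\<tau> x) (\<tau> y) = F x y" if "x \<in> C" "y \<in> C" for x y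
    using inv[OF \<tau> \<tau>, of x y] \<sigma>\<tau> that by simp
  note cl = pull_closed[OF \<sigma> \<tau> \<sigma>\<tau> inv] and cl' = pull_closed[OF \<tau> \<sigma> \<tau>\<sigma> inv']
  have nrm: "hnorm rkhs (pull \<tau> f) = hnorm rkhs f" if "f \<in> carrier rkhs" for f
    using inner_pull[OF \<sigma> \<tau> \<sigma>\<tau> inv that that] by (simp add: hnorm_def)
  have "pull \<tau> (pull \<sigma> g) = g" if "g \<in> carrier rkhs" for g
    using rkhs_outside[OF that] \<tau> \<sigma>\<tau> by (auto simp: pull_def fun_eq_iff)
  then have "carrier rkhs \<subseteq> pull \<tau> ` carrier rkhs"
    using cl' by (metis imageI subsetI)
  moreover have "pull \<tau> ` carrier rkhs \<subseteq> carrier rkhs" using cl by blast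
  moreover have "bounded_op rkhs rkhs (pull \<tau>)"
    unfolding bounded_op_def
  proof (intro conjI)
    show "\<exists>c. \<forall>x\<in>carrier rkhs. hnorm rkhs (pull \<tau> x) \<le> c * hnorm rkhs x"
      using nrm by (intro exI[of _ 1]) simp
    show "\<forall>x\<in>carrier rkhs. pull \<tau> x \<in> carrier rkhs" using cl by blast
  qed (auto simp: pull_def fun_eq_iff)
  ultimately show ?thesis using nrm unfolding unitary_def isometry_def by blast
qed

lemma pull_point:
  assumes \<sigma>: "\<And>x. x \<in> C \<Longrightarrow> \<sigma> x \<in> C" and \<tau>: "\<And>x. x \<in> C \<Longrightarrow> \<tau> x \<in> C"
    and \<sigma>\<tau>: "\<And>x. x \<in> C \<Longrightarrow> \<sigma> (\<tau> x) = x"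
    and inv: "\<And>x y. x \<in> C \<Longrightarrow> y \<in> C \<Longrightarrow> F (\<sigma> x) (\<sigma> y) = F x y" and x: "x \<in> C"
  shows "pull \<tau> (point x) = point (\<sigma> x)"
proof
  fix y
  show "pull \<tau> (point x) y = point (\<sigma> x) y"
  proof (cases "y \<in> C")
    case True
    then show ?thesis
      using inv[OF x \<tau>, of y] \<sigma>\<tau>[of y] \<sigma>[OF x] \<tau>[of y] x by (simp add: pull_def point_apply)
  next
    case False
    then show ?thesis using rkhs_outside[OF point_closed[OF \<sigma>[OF x]]] by (simp add: pull_def)
  qed
qed

end

section \<open>Unitaries and the regular dilation formula\<close>

text \<open>Linearity need not be assumed: the squared norms of V (x + y) - V x - V y and of V (a x)
  - a V x expand into inner products that cancel.\<close>

lemma isometry_of_inner: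
  assumes "hilbert_space H" "hilbert_space K"
    and V: "\<And>x. x \<in> carrier H \<Longrightarrow> V x \<in> carrier K"
    and inn: "\<And>x y. x \<in> carrier H \<Longrightarrow> y \<in> carrier H \<Longrightarrow> inner K (V x) (V y) = inner H x y"
  shows "isometry H K V"
proof -
  interpret H: hilb H by standard fact
  interpret K: hilb K by standard fact
  have nrm: "hnorm K (V x) = hnorm H x" if "x \<in> carrier H" for x
    using inn[OF that that] by (simp add: hnorm_def)
  have "V (add H x y) = add K (V x) (V y)" if x: "x \<in> carrier H" and y: "y \<in> carrier H" for x y
  proof (rule K.hdiff_eq_zeroD)
    show "hdiff K (V (add H x y)) (add K (V x) (V y)) = zero K"
      by (rule K.inner_self_zeroD)
        (use x y V in \<open>simp_all add: K.inner_hdiff_left K.inner_hdiff_right K.inner_add_left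
          K.inner_add_right inn H.inner_add_left H.inner_add_right\<close>)
  qed (use x y V in auto)
  moreover have "V (scale H a x) = scale K a (V x)" if x: "x \<in> carrier H" for a x
  proof (rule K.hdiff_eq_zeroD)
    show "hdiff K (V (scale H a x)) (scale K a (V x)) = zero K"
      by (rule K.inner_self_zeroD)
        (use x V in \<open>simp_all add: K.inner_hdiff_left K.inner_hdiff_right K.inner_scale_left
          K.inner_scale_right inn H.inner_scale_left H.inner_scale_right\<close>)
  qed (use x V in auto)
  ultimately show ?thesis
    using V nrm unfolding isometry_def bounded_op_def by (auto intro: exI[of _ 1])
qed

definition phase :: "(nat \<Rightarrow> nat \<Rightarrow> complex) \<Rightarrow> nat list \<Rightarrow> (nat \<Rightarrow> int) \<Rightarrow> complex" where
  "phase q as m = (\<Prod>i<length as. \<Prod>j\<in>{i<..<length as}.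
      inverse (q (as ! i) (as ! j) ^ (mplus (m (as ! i)) * mminus (m (as ! j)))))"

lemma phase_Cons: "phase q (a # as) m =
    (\<Prod>j<length as. inverse (q a (as ! j) ^ (mplus (m a) * mminus (m (as ! j))))) * phase q as m"
proof -
  have 1: "(\<Prod>j\<in>{0<..<Suc n}. f j) = (\<Prod>j<n. f (Suc j))" for n and f :: "nat \<Rightarrow> complex"
    by (rule prod.reindex_bij_witness[of _ Suc "\<lambda>j. j - 1"]) auto
  have 2: "(\<Prod>j\<in>{Suc i<..<Suc n}. f j) = (\<Prod>j\<in>{i<..<n}. f (Suc j))" for i n and f :: "nat \<Rightarrow> complex"
    by (rule prod.reindex_bij_witness[of _ Suc "\<lambda>j. j - 1"]) auto
  show ?thesis
    unfolding phase_def list.size prod.lessThan_Suc_shift[of _ "length as"] add_Suc_right add_0_right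
    by (simp add: 1 2 prod.lessThan_Suc_shift del: prod.lessThan_Suc)
qed

context hilb
begin

lemma unitaryD:
  assumes "unitary S U"
  shows unitary_closed: "x \<in> carrier S \<Longrightarrow> U x \<in> carrier S"
    and unitary_add: "x \<in> carrier S \<Longrightarrow> y \<in> carrier S \<Longrightarrow> U (add S x y) = add S (U x) (U y)"
    and unitary_scale: "x \<in> carrier S \<Longrightarrow> U (scale S a x) = scale S a (U x)"
    and unitary_hnorm: "x \<in> carrier S \<Longrightarrow> hnorm S (U x) = hnorm S x"
    and unitary_surj: "U ` carrier S = carrier S"
  using assms unfolding unitary_def isometry_def bounded_op_def by blast+

text \<open>Polarisation: comparing the norms of x + t y and of its image for t = 1 and t = \<i>
  yields the real and the imaginary part.\<close>

lemma unitary_inner: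
  assumes U: "unitary S U" and x: "x \<in> carrier S" and y: "y \<in> carrier S"
  shows "inner S (U x) (U y) = inner S x y"
proof -
  have "Re (t * inner S (U y) (U x)) = Re (t * inner S y x)" for t
  proof -
    have "hnorm S (U (add S x (scale S t y))) = hnorm S (add S x (scale S t y))"
      using unitary_hnorm[OF U] x y by simp
    then have "(hnorm S (add S (U x) (scale S t (U y))))\<^sup>2 = (hnorm S (add S x (scale S t y)))\<^sup>2"
      using x y by (simp add: unitary_add[OF U] unitary_scale[OF U])
    moreover have "(hnorm S (U x))\<^sup>2 = (hnorm S x)\<^sup>2" "(hnorm S (U y))\<^sup>2 = (hnorm S y)\<^sup>2"
      using unitary_hnorm[OF U] x y by simp_all
    ultimately show ?thesis
      using x y unitary_closed[OF U] form_self_add_scale[OF inner_sesquilinear, of x y t]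
        form_self_add_scale[OF inner_sesquilinear, of "U x" "U y" t]
      by (simp add: hnorm_sq)
  qed
  from this[of 1] this[of "\<i>"] have "inner S (U y) (U x) = inner S y x"
    by (simp add: complex_eq_iff)
  then show ?thesis
    using inner_commute[OF y x] inner_commute[OF unitary_closed[OF U y] unitary_closed[OF U x]] by simp
qed

lemma adjoint_unitary_apply:
  assumes U: "unitary S U" and x: "x \<in> carrier S"
  shows "adjoint S S U (U x) = x"
  by (rule adjoint_eqI[OF x]) (rule unitary_inner[OF U _ x])

lemma adjoint_unitary:
  assumes U: "unitary S U" and y: "y \<in> carrier S"
  shows adjoint_unitary_closed: "adjoint S S U y \<in> carrier S"
    and unitary_adjoint_apply: "U (adjoint S S U y) = y"
proof -
  obtain x where "x \<in> carrier S" "y = U x" using unitary_surj[OF U] y by blast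
  then show "adjoint S S U y \<in> carrier S" "U (adjoint S S U y) = y"
    using adjoint_unitary_apply[OF U] by auto
qed

lemma adjoint_unitary_scale:
  assumes U: "unitary S U" and y: "y \<in> carrier S"
  shows "adjoint S S U (scale S a y) = scale S a (adjoint S S U y)"
  using adjoint_unitary_apply[OF U scale_closed[OF adjoint_unitary_closed[OF U y]], of a]
    unitary_scale[OF U adjoint_unitary_closed[OF U y]] unitary_adjoint_apply[OF U y] by simp

lemma inner_adjoint_unitary:
  assumes U: "unitary S U" and "x \<in> carrier S" "y \<in> carrier S"
  shows "inner S x (adjoint S S U y) = inner S (U x) y"
  using unitary_inner[OF U, of x "adjoint S S U y"] adjoint_unitary[OF U] assms by simp

lemma unitary_scalar:
  assumes a: "cmod a = 1"
  shows "unitary S (scale S a)"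
proof -
  have "isometry S S (scale S a)"
  proof (rule isometry_of_inner[OF hs hs])
    have "cnj a * a = 1" using a complex_norm_square[of a] by (simp add: mult.commute)
    then show "inner S (scale S a x) (scale S a y) = inner S x y" if "x \<in> carrier S" "y \<in> carrier S" for x y
      using that by (simp add: inner_scale_left inner_scale_right flip: mult.assoc)
  qed simp
  moreover have "scale S a ` carrier S = carrier S"
  proof
    show "carrier S \<subseteq> scale S a ` carrier S"
    proof
      fix x assume x: "x \<in> carrier S"
      have "a \<noteq> 0" using a by auto
      then have "x = scale S a (scale S (inverse a) x)" using x by simp
      then show "x \<in> scale S a ` carrier S" using x by blast
    qed
  qed auto
  ultimately show ?thesis by (simp add: unitary_def)
qed

text \<open>Stated for abstract adjoint pairs f and g because the two sides of the dilation formula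
  differ in form: adjoints of powers for T, powers of adjoints for U. Passing to the other argument
  reverses the product.\<close>

lemma inner_opprod_right:
  assumes f: "\<And>a x. a \<in> set as \<Longrightarrow> x \<in> carrier S \<Longrightarrow> f a x \<in> carrier S"
    and g: "\<And>a x. a \<in> set as \<Longrightarrow> x \<in> carrier S \<Longrightarrow> g a x \<in> carrier S"
    and fg: "\<And>a x y. a \<in> set as \<Longrightarrow> x \<in> carrier S \<Longrightarrow> y \<in> carrier S \<Longrightarrow> inner S x (f a y) = inner S (g a x) y"
    and y: "y \<in> carrier S"
  shows "x \<in> carrier S \<Longrightarrow> inner S x (opprod (map f as) y) = inner S (opprod (map g (rev as)) x) y"
  using f g fg
proof (induction as arbitrary: x)
  case (Cons a as)
  have "opprod (map f as) y \<in> carrier S"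
    by (rule opprod_closed) (use Cons.prems y in auto)
  then have "inner S x (opprod (map f (a # as)) y) = inner S (g a x) (opprod (map f as) y)"
    using Cons.prems by simp
  also have "\<dots> = inner S (opprod (map g (rev as)) (g a x)) y"
    using Cons.prems by (intro Cons.IH) auto
  finally show ?case by (simp add: opprod_append)
qed simp

context
  fixes U :: "nat \<Rightarrow> 'a \<Rightarrow> 'a" and q :: "nat \<Rightarrow> nat \<Rightarrow> complex" and I :: "nat set"
  assumes unitary: "a \<in> I \<Longrightarrow> unitary S (U a)"
    and nonzero: "a \<in> I \<Longrightarrow> b \<in> I \<Longrightarrow> a \<noteq> b \<Longrightarrow> q a b \<noteq> 0"
    and commute: "a \<in> I \<Longrightarrow> b \<in> I \<Longrightarrow> a \<noteq> b \<Longrightarrow> x \<in> carrier S \<Longrightarrow> U a (U b x) = scale S (q a b) (U b (U a x))"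
begin

abbreviation "adj a \<equiv> adjoint S S (U a)"

lemma U_pow_closed: "a \<in> I \<Longrightarrow> x \<in> carrier S \<Longrightarrow> (U a ^^ n) x \<in> carrier S"
  and adj_pow_closed: "a \<in> I \<Longrightarrow> x \<in> carrier S \<Longrightarrow> (adj a ^^ n) x \<in> carrier S"
  by (rule funpow_closed; use unitary unitary_closed adjoint_unitary_closed in blast)+

lemma U_pow_scale: "a \<in> I \<Longrightarrow> x \<in> carrier S \<Longrightarrow> (U a ^^ n) (scale S c x) = scale S c ((U a ^^ n) x)"
  by (induction n) (simp_all add: unitary_scale[OF unitary] U_pow_closed)

lemma adj_pow_scale: "a \<in> I \<Longrightarrow> x \<in> carrier S \<Longrightarrow> (adj a ^^ n) (scale S c x) = scale S c ((adj a ^^ n) x)"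
  by (induction n) (simp_all add: adjoint_unitary_scale[OF unitary] adj_pow_closed)

lemma inner_adj_pow: "a \<in> I \<Longrightarrow> x \<in> carrier S \<Longrightarrow> y \<in> carrier S \<Longrightarrow>
    inner S x ((adj a ^^ n) y) = inner S ((U a ^^ n) x) y"
proof (induction n arbitrary: x)
  case (Suc n)
  then have "inner S x ((adj a ^^ Suc n) y) = inner S (U a x) ((adj a ^^ n) y)"
    by (simp add: inner_adjoint_unitary[OF unitary] adj_pow_closed)
  also have "\<dots> = inner S ((U a ^^ n) (U a x)) y"
    using Suc unitary_closed[OF unitary] by simp
  finally show ?case by (simp add: funpow_swap1)
qed simp

text \<open>Write y as the image of x under U_b; the relation for U_a and U_b at x then becomes the
  claim after the inverse of U_b is applied.\<close>

lemma U_adj_commute: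
  assumes "a \<in> I" "b \<in> I" "a \<noteq> b" "y \<in> carrier S"
  shows "U a (adj b y) = scale S (inverse (q a b)) (adj b (U a y))"
proof -
  define x where "x = adj b y"
  have x: "x \<in> carrier S" "U b x = y"
    using adjoint_unitary[OF unitary[OF assms(2)] assms(4)] by (simp_all add: x_def)
  have Ux: "U a x \<in> carrier S" using unitary_closed[OF unitary] assms x by blast
  have "adj b (U a y) = adj b (scale S (q a b) (U b (U a x)))"
    using commute[OF assms(1-3) x(1)] x by simp
  also have "\<dots> = scale S (q a b) (U a x)"
    using adjoint_unitary_scale[OF unitary[OF assms(2)] unitary_closed[OF unitary[OF assms(2)] Ux]]
      adjoint_unitary_apply[OF unitary[OF assms(2)] Ux] by simp
  finally show ?thesis using nonzero[OF assms(1-3)] Ux by (simp add: x_def)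
qed

lemma U_pow_adj_pow_commute:
  assumes ab: "a \<in> I" "b \<in> I" "a \<noteq> b" and y: "y \<in> carrier S"
  shows "(U a ^^ m) ((adj b ^^ n) y) = scale S (inverse (q a b ^ (m * n))) ((adj b ^^ n) ((U a ^^ m) y))"
proof -
  have one: "(U a ^^ m) (adj b x) = scale S (inverse (q a b ^ m)) (adj b ((U a ^^ m) x))"
    if x: "x \<in> carrier S" for x
  proof (induction m)
    case (Suc m)
    have "(U a ^^ m) x \<in> carrier S" using U_pow_closed ab x by blast
    then show ?case
      using Suc ab U_adj_commute unitary_scale[OF unitary[OF ab(1)]]
        unitary_closed[OF unitary] adjoint_unitary_closed[OF unitary]
      by (simp add: mult.commute)
  qed (use x ab adjoint_unitary_closed[OF unitary] in simp)
  show ?thesis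
  proof (induction n)
    case (Suc n)
    have cl: "(adj b ^^ n) y \<in> carrier S" "(adj b ^^ n) ((U a ^^ m) y) \<in> carrier S"
      using U_pow_closed adj_pow_closed ab y by auto
    show ?case
      using one[OF cl(1)] Suc cl ab adjoint_unitary_scale[OF unitary] adjoint_unitary_closed[OF unitary]
      by (simp add: power_add mult.commute)
  qed (use U_pow_closed[OF ab(1) y] in simp)
qed

lemma opprod_adj_closed: "set as \<subseteq> I \<Longrightarrow> x \<in> carrier S \<Longrightarrow> opprod (map (\<lambda>b. adj b ^^ r b) as) x \<in> carrier S"
  by (rule opprod_closed) (auto simp: adj_pow_closed)

lemma opprod_U_closed: "set as \<subseteq> I \<Longrightarrow> x \<in> carrier S \<Longrightarrow> opprod (map (\<lambda>b. U b ^^ r b) as) x \<in> carrier S"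
  by (rule opprod_closed) (auto simp: U_pow_closed)

lemma U_pow_opprod_adj:
  assumes a: "a \<in> I" and y: "y \<in> carrier S"
  shows "set as \<subseteq> I \<Longrightarrow> a \<notin> set as \<Longrightarrow> (U a ^^ m) (opprod (map (\<lambda>b. adj b ^^ r b) as) y)
    = scale S (\<Prod>j<length as. inverse (q a (as ! j) ^ (m * r (as ! j))))
        (opprod (map (\<lambda>b. adj b ^^ r b) as) ((U a ^^ m) y))"
proof (induction as)
  case (Cons b as)
  let ?P = "opprod (map (\<lambda>b. adj b ^^ r b) as)"
  have b: "b \<in> I" "a \<noteq> b" "set as \<subseteq> I" using Cons.prems by auto
  have cl: "?P y \<in> carrier S" "?P ((U a ^^ m) y) \<in> carrier S"
    using opprod_adj_closed[OF b(3)] U_pow_closed[OF a] y by auto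
  have "(U a ^^ m) (opprod (map (\<lambda>b. adj b ^^ r b) (b # as)) y)
      = scale S (inverse (q a b ^ (m * r b))) ((adj b ^^ r b) ((U a ^^ m) (?P y)))"
    using U_pow_adj_pow_commute[OF a b(1,2) cl(1)] by simp
  also have "\<dots> = scale S (inverse (q a b ^ (m * r b)) * (\<Prod>j<length as. inverse (q a (as ! j) ^ (m * r (as ! j)))))
      ((adj b ^^ r b) (?P ((U a ^^ m) y)))"
    using Cons b cl by (simp add: adj_pow_scale adj_pow_closed)
  finally show ?case by (simp only: prod.lessThan_Suc_shift) (simp add: prod.lessThan_Suc_shift del: prod.lessThan_Suc)
qed (use U_pow_closed[OF a y] in simp)

text \<open>Sorts a monomial so that the negative powers stand to the left of the others. Only a
  positive power of U_a standing left of a negative power of U_b has to move, and this costs q_ab to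
  the power minus the product of the two exponents' sizes: the origin of the scalar in the dilation
  formula.\<close>

lemma opprod_upow:
  assumes x: "x \<in> carrier S"
  shows "distinct as \<Longrightarrow> set as \<subseteq> I \<Longrightarrow> opprod (map (\<lambda>a. upow S (U a) (m a)) as) x
    = scale S (phase q as m) (opprod (map (\<lambda>a. adj a ^^ mminus (m a)) as)
        (opprod (map (\<lambda>a. U a ^^ mplus (m a)) as) x))"
proof (induction as)
  case Nil
  then show ?case using x by (simp add: phase_def)
next
  case (Cons a as)
  let ?N = "opprod (map (\<lambda>a. adj a ^^ mminus (m a)) as)" and ?w = "opprod (map (\<lambda>a. U a ^^ mplus (m a)) as) x"
  have a: "a \<in> I" "a \<notin> set as" "set as \<subseteq> I" using Cons.prems by auto
  have cl: "?w \<in> carrier S" "?N ?w \<in> carrier S" "?N ((U a ^^ n) ?w) \<in> carrier S" for n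
    using opprod_adj_closed[OF a(3)] opprod_U_closed[OF a(3)] U_pow_closed[OF a(1)] x by auto
  have IH: "opprod (map (\<lambda>a. upow S (U a) (m a)) as) x = scale S (phase q as m) (?N ?w)"
    using Cons by simp
  show ?case
  proof (cases "0 \<le> m a")
    case True
    then have m: "mminus (m a) = 0" "mplus (m a) = nat (m a)" by (auto simp: mminus_def mplus_def)
    have "opprod (map (\<lambda>a. upow S (U a) (m a)) (a # as)) x = (U a ^^ mplus (m a)) (scale S (phase q as m) (?N ?w))"
      using True IH m by (simp add: upow_def)
    also have "\<dots> = scale S (phase q as m) ((U a ^^ mplus (m a)) (?N ?w))"
      using U_pow_scale[OF a(1) cl(2)] .
    also have "\<dots> = scale S (phase q (a # as) m) (?N ((U a ^^ mplus (m a)) ?w))"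
      using U_pow_opprod_adj[OF a(1) cl(1) a(3,2), of "mplus (m a)"] cl by (simp add: phase_Cons mult.commute)
    finally show ?thesis by (simp add: m(1))
  next
    case False
    then have m: "mplus (m a) = 0" "mminus (m a) = nat (- m a)" by (auto simp: mminus_def mplus_def)
    then have ph: "phase q (a # as) m = phase q as m" by (simp add: phase_Cons)
    have "opprod (map (\<lambda>a. upow S (U a) (m a)) (a # as)) x = (adj a ^^ mminus (m a)) (scale S (phase q as m) (?N ?w))"
      using False IH m by (simp add: upow_def)
    then show ?thesis using adj_pow_scale[OF a(1) cl(2)] ph m(1) by simp
  qed
qed

end

end

context q_tuple
begin

text \<open>Reduces the operator identity to inner products of monomials with nonnegative exponents.
  Tested against V y, the sorted monomial has its adjoints moved to the side of y; the same can be
  done with the T side, the scalar being the same on both. The scalar operators q_ij serve as the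
  family Q.\<close>

lemma regular_Q_unitary_dilationI:
  fixes K :: "('a \<times> nat) set chs"
  assumes K: "hilbert_space K" and V: "\<And>x. x \<in> carrier H \<Longrightarrow> V x \<in> carrier K"
    and U: "\<And>i. i \<in> {1..k} \<Longrightarrow> unitary K (U i)"
    and comm: "\<And>i j x. i \<in> {1..k} \<Longrightarrow> j \<in> {1..k} \<Longrightarrow> i \<noteq> j \<Longrightarrow> x \<in> carrier K \<Longrightarrow>
      U i (U j x) = scale K (q i j) (U j (U i x))"
    and regular: "\<And>as bs p r x y. distinct as \<Longrightarrow> set as \<subseteq> {1..k} \<Longrightarrow> distinct bs \<Longrightarrow> set bs \<subseteq> {1..k} \<Longrightarrow>
      (\<And>i. p i = 0 \<or> r i = 0) \<Longrightarrow> x \<in> carrier H \<Longrightarrow> y \<in> carrier H \<Longrightarrow>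
      inner K (opprod (map (\<lambda>a. U a ^^ p a) as) (V x)) (opprod (map (\<lambda>a. U a ^^ r a) bs) (V y))
      = inner H (opprod (map (\<lambda>a. T a ^^ p a) as) x) (opprod (map (\<lambda>a. T a ^^ r a) bs) y)"
  shows "regular_Q_unitary_dilation H T k q"
proof -
  interpret K: hilb K by standard fact
  have inn: "inner K (V x) (V y) = inner H x y" if "x \<in> carrier H" "y \<in> carrier H" for x y
    using regular[of "[]" "[]" "\<lambda>_. 0" "\<lambda>_. 0" x y] that by simp
  have iso: "isometry H K V" using isometry_of_inner[OF hs K V inn] .
  have Tpow: "bounded_op H H (T a ^^ n)" if "a \<in> {1..k}" for a n
    using bounded_op_funpow contr that by blast
  have TpowD: "(T a ^^ n) x \<in> carrier H" if "a \<in> {1..k}" "x \<in> carrier H" for a n x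
    using Tpow[OF that(1)] that(2) unfolding bounded_op_def by blast
  have formula: "scale H (phase q as m) (opprod (map (\<lambda>a. adjoint H H (T a ^^ mminus (m a))) as)
        (opprod (map (\<lambda>a. T a ^^ mplus (m a)) as) x))
      = adjoint H K V (opprod (map (\<lambda>a. upow K (U a) (m a)) as) (V x))"
    if as: "distinct as" "set as \<subseteq> {1..k}" and x: "x \<in> carrier H" for as m x
  proof -
    let ?c = "phase q as m"
    let ?v = "opprod (map (\<lambda>a. T a ^^ mplus (m a)) as) x"
    let ?w = "opprod (map (\<lambda>a. U a ^^ mplus (m a)) as) (V x)"
    let ?Tadj = "opprod (map (\<lambda>a. adjoint H H (T a ^^ mminus (m a))) as) ?v"
    let ?Uadj = "opprod (map (\<lambda>a. adjoint K K (U a) ^^ mminus (m a)) as) ?w"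
    have v: "?v \<in> carrier H" by (rule opprod_closed) (use as x TpowD in auto)
    have Tadj: "?Tadj \<in> carrier H"
      by (rule opprod_closed) (use as v adjoint_closed[OF Tpow] in auto)
    note U' = U q_nonzero comm
    have pow: "(U a ^^ n) \<xi> \<in> carrier K" "(adjoint K K (U a) ^^ n) \<xi> \<in> carrier K"
      "\<eta> \<in> carrier K \<Longrightarrow> inner K \<xi> ((adjoint K K (U a) ^^ n) \<eta>) = inner K ((U a ^^ n) \<xi>) \<eta>"
      if "a \<in> {1..k}" "\<xi> \<in> carrier K" for a n \<xi> \<eta>
      using K.U_pow_closed[OF U' that] K.adj_pow_closed[OF U' that] K.inner_adj_pow[OF U' that] by auto
    have w: "?w \<in> carrier K"
      using K.opprod_U_closed[OF U' as(2) V[OF x]] by simp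
    have Uadj: "?Uadj \<in> carrier K"
      using K.opprod_adj_closed[OF U' as(2) w] by simp
    have up: "opprod (map (\<lambda>a. upow K (U a) (m a)) as) (V x) = scale K ?c ?Uadj"
      using K.opprod_upow[OF U' V[OF x] as] by simp
    have "inner K (V y) (scale K ?c ?Uadj) = inner H y (scale H ?c ?Tadj)" if y: "y \<in> carrier H" for y
    proof -
      have "inner K (V y) ?Uadj = inner K (opprod (map (\<lambda>a. U a ^^ mminus (m a)) (rev as)) (V y)) ?w"
        by (rule K.inner_opprod_right)
          (use as V[OF y] w pow in \<open>auto simp del: One_nat_def atLeastAtMost_iff\<close>)
      \<comment> \<open>\<open>mplus\<close> and \<open>mminus\<close> of one integer are never both
        nonzero, which is the condition on exponents in \<open>regular\<close>.\<close>
      also have "\<dots> = inner H (opprod (map (\<lambda>a. T a ^^ mminus (m a)) (rev as)) y) ?v"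
        by (rule regular) (use as x y in \<open>auto simp: mplus_def mminus_def\<close>)
      also have "\<dots> = inner H y ?Tadj"
        by (rule inner_opprod_right[symmetric])
          (use as v y TpowD adjoint_closed[OF Tpow] inner_adjoint_right[OF Tpow] in auto)
      finally show ?thesis
        using V[OF y] Uadj Tadj y by (simp add: K.inner_scale_right inner_scale_right)
    qed
    then show ?thesis
      unfolding up using Tadj by (intro adjoint_eqI[symmetric]) auto
  qed
  show ?thesis
    unfolding regular_Q_unitary_dilation_def
  proof (rule exI[of _ K], rule exI[of _ V], rule exI[of _ "\<lambda>i j. scale K (q i j)"], rule exI[of _ U], intro conjI)
    show "\<forall>i\<in>{1..k}. \<forall>j\<in>{1..k}. i \<noteq> j \<longrightarrow>
        unitary K (scale K (q i j)) \<and> (\<forall>x\<in>carrier K. scale K (q i j) (scale K (q j i) x) = x)"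
    proof (intro ballI impI)
      fix i j assume ij: "i \<in> {1..k}" "j \<in> {1..k}" "i \<noteq> j"
      show "unitary K (scale K (q i j)) \<and> (\<forall>x\<in>carrier K. scale K (q i j) (scale K (q j i) x) = x)"
        using K.unitary_scalar[OF q_norm[OF ij]] q_inverse[OF ij] q_nonzero[OF ij] by simp
    qed
    show "\<forall>i\<in>{1..k}. \<forall>j\<in>{1..k}. \<forall>l\<in>{1..k}. i \<noteq> j \<longrightarrow>
        (\<forall>x\<in>carrier K. scale K (q i j) (U l x) = U l (scale K (q i j) x))"
      using K.unitary_scale[OF U] by simp
    show "\<forall>(\<alpha>s :: nat list) (ms :: nat \<Rightarrow> int). distinct \<alpha>s \<longrightarrow> set \<alpha>s \<subseteq> {1..k} \<longrightarrow>
        (\<forall>x\<in>carrier H.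
           scale H (\<Prod>i<length \<alpha>s. \<Prod>j\<in>{i<..<length \<alpha>s}.
                      inverse (q (\<alpha>s ! i) (\<alpha>s ! j) ^ (mplus (ms (\<alpha>s ! i)) * mminus (ms (\<alpha>s ! j)))))
             (opprod (map (\<lambda>a. adjoint H H (T a ^^ mminus (ms a))) \<alpha>s)
               (opprod (map (\<lambda>a. T a ^^ mplus (ms a)) \<alpha>s) x))
           = adjoint H K V (opprod (map (\<lambda>a. upow K (U a) (ms a)) \<alpha>s) (V x)))"
      by (intro allI impI ballI) (rule formula[unfolded phase_def])
    show "\<forall>i\<in>{1..k}. \<forall>j\<in>{1..k}. i \<noteq> j \<longrightarrow>
        (\<forall>x\<in>carrier K. U i (U j x) = scale K (q i j) (U j (U i x)))"
      using comm by blast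
  qed (use K iso U in \<open>auto simp: mult.commute\<close>)
qed

end

section \<open>Transport of Hilbert spaces along injections\<close>

text \<open>The definition of a dilation prescribes the type of the vectors of K, while the space
  constructed here consists of functions; any injection carries the whole structure over.\<close>

definition transport :: "('b \<Rightarrow> 'c) \<Rightarrow> 'b chs \<Rightarrow> 'c chs" where
  "transport e S = (let d = inv_into (carrier S) e in
     \<lparr>carrier = e ` carrier S, zero = e (zero S), add = (\<lambda>x y. e (add S (d x) (d y))),
      scale = (\<lambda>a x. e (scale S a (d x))), inner = (\<lambda>x y. inner S (d x) (d y))\<rparr>)"

context hilb
begin

context
  fixes e :: "'a \<Rightarrow> 'c"
  assumes inj: "inj_on e (carrier S)"
begin

lemma transport_simps [simp]:
  "carrier (transport e S) = e ` carrier S"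
  "zero (transport e S) = e (zero S)"
  "x \<in> carrier S \<Longrightarrow> y \<in> carrier S \<Longrightarrow> add (transport e S) (e x) (e y) = e (add S x y)"
  "x \<in> carrier S \<Longrightarrow> scale (transport e S) a (e x) = e (scale S a x)"
  "x \<in> carrier S \<Longrightarrow> y \<in> carrier S \<Longrightarrow> inner (transport e S) (e x) (e y) = inner S x y"
  using inj by (simp_all add: transport_def Let_def)

lemma transport_hnorm: "x \<in> carrier S \<Longrightarrow> hnorm (transport e S) (e x) = hnorm S x"
  by (simp add: hnorm_def)

lemma transport_hdiff: "x \<in> carrier S \<Longrightarrow> y \<in> carrier S \<Longrightarrow>
    hdiff (transport e S) (e x) (e y) = e (hdiff S x y)"
  by (simp add: hdiff_def)

lemma hilbert_space_transport: "hilbert_space (transport e S)"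
  unfolding hilbert_space_def
proof (intro conjI)
  show "\<forall>X. (\<forall>n. X n \<in> carrier (transport e S)) \<longrightarrow>
      (\<forall>r>0. \<exists>N. \<forall>m\<ge>N. \<forall>n\<ge>N. hnorm (transport e S) (hdiff (transport e S) (X m) (X n)) < r) \<longrightarrow>
      (\<exists>L\<in>carrier (transport e S). (\<lambda>n. hnorm (transport e S) (hdiff (transport e S) (X n) L)) \<longlonglongrightarrow> 0)"
  proof (intro allI impI)
    fix X :: "nat \<Rightarrow> 'c" assume X: "\<forall>n. X n \<in> carrier (transport e S)"
      and cau: "\<forall>r>0. \<exists>N. \<forall>m\<ge>N. \<forall>n\<ge>N. hnorm (transport e S) (hdiff (transport e S) (X m) (X n)) < r"
    from X have "\<forall>n. \<exists>y\<in>carrier S. X n = e y" by auto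
    then obtain Y where Y: "\<And>n. Y n \<in> carrier S" "\<And>n. X n = e (Y n)" by metis
    have nrm: "hnorm (transport e S) (hdiff (transport e S) (X n) (e y)) = hnorm S (hdiff S (Y n) y)"
      if "y \<in> carrier S" for n y
      using Y that by (simp add: transport_hdiff transport_hnorm)
    have "\<exists>N. \<forall>m\<ge>N. \<forall>n\<ge>N. hnorm S (hdiff S (Y m) (Y n)) < r" if "r > 0" for r
      using cau[rule_format, OF that] unfolding Y(2)
      by (simp add: nrm[OF Y(1), unfolded Y(2)])
    then obtain L where "L \<in> carrier S" "(\<lambda>n. hnorm S (hdiff S (Y n) L)) \<longlonglongrightarrow> 0"
      using complete[of Y] Y(1) by blast
    then show "\<exists>L\<in>carrier (transport e S). (\<lambda>n. hnorm (transport e S) (hdiff (transport e S) (X n) L)) \<longlonglongrightarrow> 0"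
      using nrm by (intro bexI[of _ "e L"]) auto
  qed
  show "\<forall>x\<in>carrier (transport e S). \<exists>y\<in>carrier (transport e S). add (transport e S) x y = zero (transport e S)"
    using hilbert_axioms[THEN conjunct2, THEN conjunct2, THEN conjunct2, THEN conjunct2, THEN conjunct2,
        THEN conjunct2, THEN conjunct1] by force
  show "\<forall>x\<in>carrier (transport e S). inner (transport e S) x x = 0 \<longrightarrow> x = zero (transport e S)"
    using inner_self_zeroD by auto
  show "\<forall>x\<in>carrier (transport e S). \<forall>y\<in>carrier (transport e S).
      inner (transport e S) y x = cnj (inner (transport e S) x y)"
  proof (intro ballI)
    fix x y assume "x \<in> carrier (transport e S)" "y \<in> carrier (transport e S)"
    then obtain x' y' where "x' \<in> carrier S" "x = e x'" "y' \<in> carrier S" "y = e y'" by auto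
    then show "inner (transport e S) y x = cnj (inner (transport e S) x y)"
      using inner_commute[of x' y'] by simp
  qed
  show "\<forall>x\<in>carrier (transport e S). \<forall>y\<in>carrier (transport e S). add (transport e S) x y = add (transport e S) y x"
  proof (intro ballI)
    fix x y assume "x \<in> carrier (transport e S)" "y \<in> carrier (transport e S)"
    then obtain x' y' where "x' \<in> carrier S" "x = e x'" "y' \<in> carrier S" "y = e y'" by auto
    then show "add (transport e S) x y = add (transport e S) y x"
      using add_comm[of x' y'] by simp
  qed
  show "\<forall>a. \<forall>x\<in>carrier (transport e S). \<forall>y\<in>carrier (transport e S).
      scale (transport e S) a (add (transport e S) x y)
        = add (transport e S) (scale (transport e S) a x) (scale (transport e S) a y)"
    using hilbert_axioms[THEN conjunct2, THEN conjunct2, THEN conjunct2, THEN conjunct2, THEN conjunct2,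
        THEN conjunct2, THEN conjunct2, THEN conjunct1] by auto
qed (auto simp: add_assoc scale_add_left inner_add_left inner_scale_left inner_self_nonneg)

lemma unitary_transport:
  assumes U: "unitary S U"
    and U': "\<And>x. x \<in> carrier S \<Longrightarrow> U' (e x) = e (U x)"
  shows "unitary (transport e S) U'"
proof -
  note cl = unitary_closed[OF U]
  have "isometry (transport e S) (transport e S) U'"
    by (rule isometry_of_inner[OF hilbert_space_transport hilbert_space_transport])
      (use U' cl unitary_inner[OF U] in auto)
  moreover have "U' ` (e ` carrier S) = e ` (U ` carrier S)"
    using U' by (simp add: image_image)
  ultimately show ?thesis by (simp add: unitary_def unitary_surj[OF U])
qed

end

end

section \<open>The dilation space\<close>

text \<open>Complex-valued functions on \<open>pts\<close> are encoded in \<open>('a \<times> nat) set\<close> by the rational lower cuts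
  of their real and imaginary parts.\<close>

lemma rat_cut_inject:
  fixes a b :: real
  assumes "\<And>r::rat. of_rat r < a \<longleftrightarrow> of_rat r < b"
  shows "a = b"
proof (rule ccontr)
  assume "a \<noteq> b"
  then consider "a < b" | "b < a" by linarith
  then show False
  proof cases
    case 1 then show False using of_rat_dense[OF 1] assms by force
  next
    case 2 then show False using of_rat_dense[OF 2] assms by force
  qed
qed

context q_tuple
begin

text \<open>Apart from its vector, a point is given by k integers, since the coordinates outside
  {1..k} are 0. These, the rational bound and the flag b for real or imaginary part are countable
  data and fit into one natural number.\<close>

definition encode :: "((nat \<Rightarrow> int) \<times> 'a \<Rightarrow> complex) \<Rightarrow> ('a \<times> nat) set" where
  "encode f = {(snd z, to_nat (map (fst z) [1..<Suc k], r, b)) | z (r::rat) (b::bool).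
     z \<in> pts \<and> of_rat r < (if b then Re (f z) else Im (f z))}"

lemma pts_eqI:
  assumes "z \<in> pts" "w \<in> pts" "snd z = snd w" "map (fst z) [1..<Suc k] = map (fst w) [1..<Suc k]"
  shows "z = w"
proof -
  have "fst z i = fst w i" for i
  proof (cases "i \<in> {1..k}")
    case True
    then have "i \<in> set [1..<Suc k]" by auto
    then show ?thesis using assms(4) by (meson map_eq_conv)
  next
    case False
    then show ?thesis using assms unfolding pts_def by simp
  qed
  then show ?thesis using assms(3) by (simp add: prod_eq_iff fun_eq_iff)
qed

lemma encode_mem:
  assumes "z \<in> pts"
  shows "(snd z, to_nat (map (fst z) [1..<Suc k], r, b)) \<in> encode f
    \<longleftrightarrow> of_rat r < (if b then Re (f z) else Im (f z))"
proof -
  have "w = z" if "w \<in> pts" "snd w = snd z" "map (fst w) [1..<Suc k] = map (fst z) [1..<Suc k]" for w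
    using pts_eqI[OF that(1) assms that(2,3)] .
  then show ?thesis
    unfolding encode_def mem_Collect_eq prod.inject inj_eq[OF inj_to_nat]
    using assms by metis
qed

lemma encode_inject:
  assumes "encode f = encode g" "z \<in> pts"
  shows "f z = g z"
proof (rule complex_eqI)
  have cut: "of_rat r < (if b then Re (f z) else Im (f z)) \<longleftrightarrow> of_rat r < (if b then Re (g z) else Im (g z))" for r b
    using encode_mem[OF assms(2), of r b f] encode_mem[OF assms(2), of r b g] assms(1) by simp
  show "Re (f z) = Re (g z)" using cut[of _ True] by (intro rat_cut_inject) simp
  show "Im (f z) = Im (g z)" using cut[of _ False] by (intro rat_cut_inject) simp
qed

lemma stage_op_inv:
  assumes "i \<in> {1..k}" "z \<in> pts"
  shows "inv_into pts (stage_op k i) z \<in> pts"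
    and "stage_op k i (inv_into pts (stage_op k i) z) = z"
    and "inv_into pts (stage_op k i) (stage_op k i z) = z"
  using bij_betw_stage_op[of i k] assms
  by (auto simp: bij_betw_def inv_into_into f_inv_into_f)

lemma stage_op_inject:
  assumes "i \<in> {1..k}" "z \<in> pts" "w \<in> pts" "stage_op k i z = stage_op k i w"
  shows "z = w"
  using stage_op_inv(3)[OF assms(1,2)] unfolding assms(4) stage_op_inv(3)[OF assms(1,3)] by (rule sym)

lemma regular_dilation_of_brehmer:
  assumes brehmer: "\<And>is. sorted_wrt (<) is \<Longrightarrow> set is \<subseteq> {1..k} \<Longrightarrow>
      psd_on (carrier H) (defects T is (inner H))"
  shows "regular_Q_unitary_dilation H T k q"
proof -
  have "psd_on pts (defects (stage_op 0) is (stage_kernel 0))"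
    if "sorted_wrt (<) is" "set is \<subseteq> {1..k}" for "is"
  proof -
    have "defects (stage_op 0) is (stage_kernel 0) z w = defects T is (inner H) (snd z) (snd w)" for z w
      by (induction "is" arbitrary: z w) (simp_all add: defect_def)
    then have eq: "defects (stage_op 0) is (stage_kernel 0) = (\<lambda>z w. defects T is (inner H) (snd z) (snd w))"
      by (intro ext)
    show ?thesis
      unfolding eq by (rule psd_on_pullback[OF brehmer[OF that]]) (auto simp: pts_def)
  qed
  \<comment> \<open>At stage k no operator is left, and the invariant for the empty list is
    positivity of the final kernel itself.\<close>
  from psd_on_stage_kernel[OF this, of k "[]"] have psd: "psd_on pts (stage_kernel k)" by simp
  interpret P: psd_kernel pts "stage_kernel k"
    by unfold_locales (rule stage_kernel_commute[OF order_refl], assumption+, rule psd)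
  interpret K: hilb P.rkhs
    by unfold_locales (rule P.hilbert_space_rkhs)
  define U where "U i = P.pull (inv_into pts (stage_op k i))" for i
  have inv: "stage_kernel k (stage_op k i z) (stage_op k i w) = stage_kernel k z w"
    if "i \<in> {1..k}" "z \<in> pts" "w \<in> pts" for i z w
    using that by (intro stage_kernel_invariant) auto
  have U: "unitary P.rkhs (U i)" if "i \<in> {1..k}" for i
    unfolding U_def
    by (rule P.unitary_pull[of "stage_op k i"])
      (use that stage_op_inv[OF that] inv[OF that] in simp_all)
  have U_point: "U i (P.point z) = P.point (stage_op k i z)" if "i \<in> {1..k}" "z \<in> pts" for i z
    unfolding U_def
    by (rule P.pull_point[of "stage_op k i"])
      (use that stage_op_inv[OF that(1)] inv[OF that(1)] in simp_all)
  \<comment> \<open>\<open>P.point\<close> respects scaling, and f is evaluated by pairing with it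
    in the second, conjugate-linear argument; hence the conjugate.\<close>
  have hom: "f (pscale a z) = cnj a * f z" if f: "f \<in> carrier P.rkhs" and z: "z \<in> pts" for f a z
  proof -
    have "P.point (pscale a z) w = a * P.point z w" for w
    proof (cases "w \<in> pts")
      case True
      then show ?thesis
        using homogeneousD(1)[OF homogeneous_stage_kernel z] z by (simp add: P.point_apply)
    next
      case False
      then show ?thesis
        using P.rkhs_outside[OF P.point_closed] z by simp
    qed
    then have "P.point (pscale a z) = scale P.rkhs a (P.point z)" by (simp add: fun_eq_iff)
    then have "f (pscale a z) = inner P.rkhs f (scale P.rkhs a (P.point z))"
      using P.reproducing[OF f, of "pscale a z"] z by (simp del: P.rkhs_simps)
    also have "\<dots> = cnj a * f z"
      using K.inner_scale_right[OF f P.point_closed[OF z]] P.reproducing[OF f z] by (simp del: P.rkhs_simps)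
    finally show ?thesis .
  qed
  have comm: "U i (U j f) = scale P.rkhs (q i j) (U j (U i f))"
    if i: "i \<in> {1..k}" and j: "j \<in> {1..k}" and ij: "i \<noteq> j" and f: "f \<in> carrier P.rkhs" for i j f
  proof
    fix z
    let ?s = "stage_op k" and ?t = "\<lambda>i. inv_into pts (stage_op k i)"
    show "U i (U j f) z = scale P.rkhs (q i j) (U j (U i f)) z"
    proof (cases "z \<in> pts")
      case True
      \<comment> \<open>\<open>U i (U j f)\<close> and \<open>U j (U i f)\<close> evaluate f at u
        and at w. The relation for the stage operators gives w as q_ij times u, and conjugate
        homogeneity of f with |q_ij| = 1 turns this into f u = q_ij f w.\<close>
      define w u where "w = ?t i (?t j z)" and "u = ?t j (?t i z)"
      have cl: "w \<in> pts" "u \<in> pts" and wz: "?s j (?s i w) = z" and uz: "?s i (?s j u) = z"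
        using True stage_op_inv[OF i] stage_op_inv[OF j] by (simp_all add: w_def u_def)
      have "?s i (?s j w) = ?s i (?s j (pscale (q i j) u))"
        using stage_op_commute[OF i j ij cl(1) order_refl] wz uz i j cl by (simp add: stage_op_pscale)
      then have "w = pscale (q i j) u"
        using stage_op_inject[OF i, of "?s j w" "?s j (pscale (q i j) u)"]
          stage_op_inject[OF j, of w "pscale (q i j) u"] cl j by simp
      then have "f w = cnj (q i j) * f u" using hom[OF f cl(2)] by simp
      moreover have "q i j * cnj (q i j) = 1"
        using q_norm[OF i j ij] complex_norm_square[of "q i j"] by simp
      ultimately have "f u = q i j * f w" by (simp flip: mult.assoc)
      then show ?thesis
        using True stage_op_inv[OF i] stage_op_inv[OF j] by (simp add: U_def P.pull_def w_def u_def)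
    qed (simp add: U_def P.pull_def)
  qed
  \<comment> \<open>\<open>encode\<close> records values on \<open>pts\<close> only; this is enough
    because the functions in the space vanish elsewhere.\<close>
  have inj: "inj_on encode (carrier P.rkhs)"
  proof (rule inj_onI)
    fix f g assume f: "f \<in> carrier P.rkhs" and g: "g \<in> carrier P.rkhs" and eq: "encode f = encode g"
    show "f = g"
    proof
      fix z show "f z = g z"
        using encode_inject[OF eq, of z] P.rkhs_outside[OF f, of z] P.rkhs_outside[OF g, of z]
        by (cases "z \<in> pts") auto
    qed
  qed
  define decode where "decode = inv_into (carrier P.rkhs) encode"
  define W where "W i = encode \<circ> U i \<circ> decode" for i
  define V where "V x = P.point (\<lambda>_. 0, x)" for x
  have decode: "decode (encode f) = f" if "f \<in> carrier P.rkhs" for f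
    unfolding decode_def using inj that by (rule inv_into_f_f)
  have W: "W i (encode f) = encode (U i f)" if "f \<in> carrier P.rkhs" for i f
    using decode[OF that] by (simp add: W_def)
  note ts = K.transport_simps[OF inj]
  have origin: "(\<lambda>_. 0, x) \<in> pts" if "x \<in> carrier H" for x
    using that by (simp add: pts_def)
  show ?thesis
  proof (rule regular_Q_unitary_dilationI[of "transport encode P.rkhs" "encode \<circ> V" W])
    show "hilbert_space (transport encode P.rkhs)" by (rule K.hilbert_space_transport[OF inj])
    show "(encode \<circ> V) x \<in> carrier (transport encode P.rkhs)" if "x \<in> carrier H" for x
      unfolding ts V_def comp_def using P.point_closed[OF origin[OF that]] by (rule imageI)
    show "unitary (transport encode P.rkhs) (W i)" if "i \<in> {1..k}" for i
      using inj U[OF that] W[of _ i] by (rule K.unitary_transport)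
    show "W i (W j x) = scale (transport encode P.rkhs) (q i j) (W j (W i x))"
      if i: "i \<in> {1..k}" and j: "j \<in> {1..k}" and ij: "i \<noteq> j"
        and x: "x \<in> carrier (transport encode P.rkhs)" for i j x
    proof -
      obtain f where f: "f \<in> carrier P.rkhs" "x = encode f" using x unfolding ts by blast
      note cl = K.unitary_closed[OF U[OF i]] K.unitary_closed[OF U[OF j]]
      show ?thesis
        unfolding f(2) W[OF f(1)] W[OF cl(1)[OF f(1)]] W[OF cl(2)[OF f(1)]]
          ts(4)[OF cl(2)[OF cl(1)[OF f(1)]]] comm[OF i j ij f(1)] ..
    qed
    show "inner (transport encode P.rkhs) (opprod (map (\<lambda>a. W a ^^ p a) as) ((encode \<circ> V) x))
          (opprod (map (\<lambda>a. W a ^^ r a) bs) ((encode \<circ> V) y))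
        = inner H (opprod (map (\<lambda>a. T a ^^ p a) as) x) (opprod (map (\<lambda>a. T a ^^ r a) bs) y)"
      if as: "distinct as" "set as \<subseteq> {1..k}" and bs: "distinct bs" "set bs \<subseteq> {1..k}"
        and pr: "\<And>i. p i = 0 \<or> r i = 0" and x: "x \<in> carrier H" and y: "y \<in> carrier H" for as bs p r x y
    proof -
      have pow: "(W a ^^ n) (encode (P.point z)) = encode (P.point ((stage_op k a ^^ n) z))"
        if "a \<in> {1..k}" "z \<in> pts" for a n z
        using that by (induction n) (simp_all add: W[OF P.point_closed] U_point del: P.rkhs_simps)
      have mono: "opprod (map (\<lambda>a. W a ^^ p a) as) (encode (P.point z)) = encode (P.point (stage_prod k as p z))"
        if "set as \<subseteq> {1..k}" "z \<in> pts" for as p z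
        using that(1)
      proof (induction as)
        case (Cons a as)
        then show ?case using pow[of a "stage_prod k as p z" "p a"] stage_prod_closed[of as z k p] that(2) by simp
      qed simp
      have cl: "stage_prod k as p (\<lambda>_. 0, x) \<in> pts" "stage_prod k bs r (\<lambda>_. 0, y) \<in> pts"
        using stage_prod_closed as bs origin x y by blast+
      have "inner (transport encode P.rkhs) (opprod (map (\<lambda>a. W a ^^ p a) as) ((encode \<circ> V) x))
          (opprod (map (\<lambda>a. W a ^^ r a) bs) ((encode \<circ> V) y))
        = inner P.rkhs (P.point (stage_prod k as p (\<lambda>_. 0, x))) (P.point (stage_prod k bs r (\<lambda>_. 0, y)))"
        unfolding comp_def V_def mono[OF as(2) origin[OF x]] mono[OF bs(2) origin[OF y]]
        by (rule ts(5)[OF P.point_closed[OF cl(1)] P.point_closed[OF cl(2)]])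
      also have "\<dots> = stage_kernel k (stage_prod k as p (\<lambda>_. 0, x)) (stage_prod k bs r (\<lambda>_. 0, y))"
        unfolding P.reproducing[OF P.point_closed[OF cl(1)] cl(2)] P.point_apply[OF cl] ..
      also have "\<dots> = inner H (opprod (map (\<lambda>a. T a ^^ p a) as) x) (opprod (map (\<lambda>a. T a ^^ r a) bs) y)"
        by (rule stage_kernel_regular[OF as bs pr x y order_refl])
      finally show ?thesis .
    qed
  qed
qed

end

section \<open>Brehmer positivity\<close>

context q_tuple
begin

lemma sesquilinear_defects:
  assumes "set is \<subseteq> {1..k}"
  shows "sesquilinear H (defects T is (inner H))"
  using assms
proof (induction "is")
  case Nil
  show ?case using inner_sesquilinear by simp
next
  case (Cons i "is")
  let ?G = "defects T is (inner H)"
  have G: "sesquilinear H ?G" and i: "i \<in> {1..k}" using Cons by auto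
  note G' = form_add_left[OF G] form_scale_left[OF G] T_closed[OF i] T_add[OF i] T_scale[OF i]
  show ?case
    unfolding sesquilinear_def
  proof (intro conjI ballI allI)
    fix x y assume xy: "x \<in> carrier H" "y \<in> carrier H"
    show "defects T (i # is) (inner H) y x = cnj (defects T (i # is) (inner H) x y)"
      using form_commute[OF G xy] form_commute[OF G T_closed[OF i xy(1)] T_closed[OF i xy(2)]]
      by (simp add: defect_def)
  qed (simp_all add: defect_def G' algebra_simps)
qed

text \<open>For isometries the innermost defect already vanishes on the diagonal, and each further
  defect is a difference of two such diagonal values.\<close>

lemma defects_isometry:
  assumes "\<And>i. i \<in> {1..k} \<Longrightarrow> isometry H H (T i)" "set is \<subseteq> {1..k}" "is \<noteq> []"
    "x \<in> carrier H"
  shows "defects T is (inner H) x x = 0"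
  using assms(2-)
proof (induction "is" arbitrary: x)
  case (Cons i "is")
  have i: "i \<in> {1..k}" using Cons.prems by simp
  show ?case
  proof (cases "is = []")
    case True
    have "hnorm H (T i x) = hnorm H x" using assms(1)[OF i] Cons.prems by (simp add: isometry_def)
    then show ?thesis using True i Cons.prems by (simp add: defect_def inner_self_hnorm)
  next
    case False
    then show ?thesis using Cons i by (simp add: defect_def)
  qed
qed simp

lemma brehmer_isometry:
  assumes "\<And>i. i \<in> {1..k} \<Longrightarrow> isometry H H (T i)" "set is \<subseteq> {1..k}" "x \<in> carrier H"
  shows "0 \<le> Re (defects T is (inner H) x x)"
  using defects_isometry[OF assms(1,2) _ assms(3)] inner_self_nonneg[OF assms(3)]
  by (cases "is = []") auto

text \<open>The two bounds support each other. The upper bound at T_i x costs the lower bound at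
  most the squared norm of T_i times that of x; the lower bound at T_i x is nonnegative as the
  squares sum to at most 1, so subtracting the defect's second term preserves the upper
  bound.\<close>

lemma brehmer_small_norms:
  assumes small: "(\<Sum>i=1..k. (opnorm H H (T i))\<^sup>2) \<le> 1"
  shows "distinct is \<Longrightarrow> set is \<subseteq> {1..k} \<Longrightarrow> x \<in> carrier H \<Longrightarrow>
    (1 - (\<Sum>i\<in>set is. (opnorm H H (T i))\<^sup>2)) * (hnorm H x)\<^sup>2 \<le> Re (defects T is (inner H) x x) \<and>
    Re (defects T is (inner H) x x) \<le> (hnorm H x)\<^sup>2"
proof (induction "is" arbitrary: x)
  case Nil
  then show ?case by (simp add: hnorm_sq)
next
  case (Cons i "is")
  let ?t = "\<lambda>i. (opnorm H H (T i))\<^sup>2" and ?G = "\<lambda>x. Re (defects T is (inner H) x x)"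
  have i: "i \<in> {1..k}" "i \<notin> set is" and Tx: "T i x \<in> carrier H" using Cons.prems by auto
  have IH: "(1 - sum ?t (set is)) * (hnorm H y)\<^sup>2 \<le> ?G y" "?G y \<le> (hnorm H y)\<^sup>2"
    if "y \<in> carrier H" for y using Cons that by auto
  have "sum ?t (set is) \<le> sum ?t {1..k}" using Cons.prems by (intro sum_mono2) auto
  then have "0 \<le> (1 - sum ?t (set is)) * (hnorm H (T i x))\<^sup>2" using small by simp
  then have 1: "0 \<le> ?G (T i x)" using IH(1)[OF Tx] by linarith
  have "(hnorm H (T i x))\<^sup>2 \<le> (opnorm H H (T i) * hnorm H x)\<^sup>2"
    using hnorm_le_opnorm[OF T_bounded[OF i(1)] Cons.prems(3)] hnorm_nonneg[OF Tx] by (rule power_mono)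
  then have 2: "?G (T i x) \<le> ?t i * (hnorm H x)\<^sup>2"
    using IH(2)[OF Tx] by (simp add: power_mult_distrib)
  have "Re (defects T (i # is) (inner H) x x) = ?G x - ?G (T i x)"
    by (simp add: defect_def)
  then show ?case
    using 1 2 IH[OF Cons.prems(3)] i(2) by (simp add: algebra_simps)
qed

text \<open>Logarithmic convexity makes the ratios of successive terms nondecreasing. A first ratio
  above 1 would therefore force geometric growth, against the bound.\<close>

lemma log_convex_bounded:
  fixes u :: "nat \<Rightarrow> real"
  assumes nonneg: "\<And>n. 0 \<le> u n" and convex: "\<And>n. (u (Suc n))\<^sup>2 \<le> u n * u (Suc (Suc n))"
    and bound: "\<And>n. u n \<le> B"
  shows "u 1 \<le> u 0"
proof (rule ccontr)
  assume "\<not> u 1 \<le> u 0"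
  then have less: "u 0 < u 1" by simp
  \<comment> \<open>Excludes u 0 = 0, for which convexity would give u 1 = 0; the ratio below is
    then defined.\<close>
  have "(u 1)\<^sup>2 > 0" using less nonneg[of 0] by simp
  then have "u 0 * u 2 > 0" using convex[of 0] by (simp add: numeral_2_eq_2)
  then have pos: "u 0 > 0" using nonneg[of 0] by (metis less_eq_real_def mult_zero_left less_irrefl)
  define \<rho> where "\<rho> = u 1 / u 0"
  have \<rho>: "\<rho> > 1" using less pos by (simp add: \<rho>_def)
  have step: "0 < u n \<and> \<rho> * u n \<le> u (Suc n)" for n
  proof (induction n)
    case 0
    then show ?case using pos by (simp add: \<rho>_def)
  next
    case (Suc n)
    have "0 < \<rho> * u n" using Suc \<rho> by simp
    then have p: "0 < u (Suc n)" using Suc by linarith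
    have "u n * (\<rho> * u (Suc n)) \<le> u (Suc n) * u (Suc n)"
      using Suc p by (simp add: mult.left_commute mult.assoc[symmetric] mult_right_mono)
    also have "\<dots> \<le> u n * u (Suc (Suc n))" using convex[of n] by (simp add: power2_eq_square)
    finally show ?case using Suc p by simp
  qed
  have grow: "\<rho> ^ n * u 0 \<le> u n" for n
  proof (induction n)
    case (Suc n)
    have "\<rho> * (\<rho> ^ n * u 0) \<le> \<rho> * u n" using Suc \<rho> by (intro mult_left_mono) auto
    then show ?case using step[of n] by simp
  qed simp
  obtain n where "B / u 0 < \<rho> ^ n" using real_arch_pow[OF \<rho>] by blast
  then have "B < \<rho> ^ n * u 0" using pos by (simp add: field_simps)
  with grow[of n] bound[of n] show False by linarith
qed

text \<open>Krein's symmetrisation trick: \<open>T\<^sub>i\<^sup>* T\<^sub>i\<close> is symmetric for the form \<open>G\<close>, so the norms of the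
  iterates are logarithmically convex; being bounded, they cannot increase at the first step.\<close>

lemma form_contraction:
  assumes G: "sesquilinear H G" and pos: "\<And>x. x \<in> carrier H \<Longrightarrow> 0 \<le> Re (G x x)"
    and bound: "\<And>x. x \<in> carrier H \<Longrightarrow> Re (G x x) \<le> (hnorm H x)\<^sup>2"
    and A: "contraction H A"
    and sym: "\<And>x y. x \<in> carrier H \<Longrightarrow> y \<in> carrier H \<Longrightarrow> G (A x) y = G x (adjoint H H A y)"
    and x: "x \<in> carrier H"
  shows "Re (G (A x) (A x)) \<le> Re (G x x)"
proof -
  have bd: "bounded_op H H A" using contraction_bounded_op[OF A] .
  have Acl: "A y \<in> carrier H" if "y \<in> carrier H" for y using bd that by (simp add: bounded_op_def)
  have adjcl: "adjoint H H A y \<in> carrier H" if "y \<in> carrier H" for y using adjoint_closed[OF bd that] .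
  define N where "N = adjoint H H A \<circ> A"
  have N: "N y \<in> carrier H" if "y \<in> carrier H" for y using Acl adjcl that by (simp add: N_def)
  have pw: "(N ^^ n) x \<in> carrier H" for n using N x by (rule funpow_closed)
  have adj_le: "hnorm H (adjoint H H A y) \<le> hnorm H y" if y: "y \<in> carrier H" for y
  proof -
    have "(hnorm H (adjoint H H A y))\<^sup>2 = Re (inner H (A (adjoint H H A y)) y)"
      using y adjcl inner_adjoint_right[OF bd adjcl[OF y] y] by (simp add: hnorm_sq)
    also have "\<dots> \<le> hnorm H (A (adjoint H H A y)) * hnorm H y"
      using cauchy_schwarz[OF Acl[OF adjcl[OF y]] y] complex_Re_le_cmod order_trans by blast
    also have "\<dots> \<le> hnorm H (adjoint H H A y) * hnorm H y"
      using contraction_hnorm_le[OF A adjcl[OF y]] y by (intro mult_right_mono) auto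
    finally have "hnorm H (adjoint H H A y) * hnorm H (adjoint H H A y) \<le> hnorm H (adjoint H H A y) * hnorm H y"
      by (simp add: power2_eq_square)
    then show ?thesis
      using hnorm_nonneg[OF adjcl[OF y]] hnorm_nonneg[OF y]
      by (cases "hnorm H (adjoint H H A y) = 0") (auto simp: mult_le_cancel_left)
  qed
  have le: "hnorm H ((N ^^ n) x) \<le> hnorm H x" for n
  proof (induction n)
    case (Suc n)
    have "hnorm H (N ((N ^^ n) x)) \<le> hnorm H (A ((N ^^ n) x))"
      using adj_le[OF Acl[OF pw]] by (simp add: N_def)
    also have "\<dots> \<le> hnorm H ((N ^^ n) x)" using contraction_hnorm_le[OF A pw] .
    finally show ?case using Suc by simp
  qed simp
  define g where "g y = sqrt (Re (G y y))" for y
  have cs: "cmod (G y z) \<le> g y * g z" if "y \<in> carrier H" "z \<in> carrier H" for y z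
  proof -
    have "(cmod (G y z))\<^sup>2 \<le> (g y * g z)\<^sup>2"
      using form_cauchy_schwarz[OF G pos that] pos that by (simp add: g_def power_mult_distrib)
    then show ?thesis using pos that by (simp add: power2_le_iff_abs_le g_def)
  qed
  have symN: "G (A y) (A z) = G y (N z)" if "y \<in> carrier H" "z \<in> carrier H" for y z
    using sym[OF that(1) Acl[OF that(2)]] by (simp add: N_def)
  have symN': "G (N y) z = G y (N z)" if "y \<in> carrier H" "z \<in> carrier H" for y z
    using symN[OF that] symN[OF that(2,1)] form_commute[OF G N[OF that(1)] that(2)]
      form_commute[OF G Acl[OF that(1)] Acl[OF that(2)]] by simp
  have "g ((N ^^ 1) x) \<le> g ((N ^^ 0) x)"
  proof (rule log_convex_bounded[where u = "\<lambda>n. g ((N ^^ n) x)"])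
    show "0 \<le> g ((N ^^ n) x)" for n using pos[OF pw] by (simp add: g_def)
    show "(g ((N ^^ Suc n) x))\<^sup>2 \<le> g ((N ^^ n) x) * g ((N ^^ Suc (Suc n)) x)" for n
    proof -
      have "(g ((N ^^ Suc n) x))\<^sup>2 = Re (G (N ((N ^^ n) x)) ((N ^^ Suc n) x))"
        using pos[OF pw, of "Suc n"] by (simp add: g_def)
      also have "\<dots> = Re (G ((N ^^ n) x) ((N ^^ Suc (Suc n)) x))"
        using symN'[OF pw pw, of n "Suc n"] by simp
      also have "\<dots> \<le> g ((N ^^ n) x) * g ((N ^^ Suc (Suc n)) x)"
        using cs[OF pw pw] complex_Re_le_cmod order_trans by blast
      finally show ?thesis .
    qed
    show "g ((N ^^ n) x) \<le> hnorm H x" for n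
    proof -
      have "g ((N ^^ n) x) \<le> sqrt ((hnorm H ((N ^^ n) x))\<^sup>2)"
        unfolding g_def using bound[OF pw] by (rule real_sqrt_le_mono)
      then show ?thesis using le[of n] pw[of n] by simp
    qed
  qed
  then have "g (N x) \<le> g x" by simp
  \<comment> \<open>The estimate so far concerns N; as \<open>G (A x) (A x)\<close> equals
    \<open>G x (N x)\<close>, Cauchy-Schwarz for the form carries it over to A.\<close>
  have "Re (G (A x) (A x)) \<le> cmod (G x (N x))"
    using symN[OF x x] complex_Re_le_cmod by simp
  also have "\<dots> \<le> g x * g (N x)" using cs[OF x N[OF x]] .
  also have "\<dots> \<le> g x * g x" using \<open>g (N x) \<le> g x\<close> pos[OF x] by (intro mult_left_mono) (auto simp: g_def)
  also have "\<dots> = Re (G x x)" using pos[OF x] by (simp add: g_def)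
  finally show ?thesis .
qed

text \<open>Positivity alone does not sustain the induction. \<open>form_contraction\<close> also
  needs the upper bound and the fact that an operator still to be used has the same adjoint for the
  form as for the inner product. As the list increases, such an operator has a smaller index than
  all members of the list, so the hypothesis is used in the order in which it is given.\<close>

lemma brehmer_doubly_commuting:
  assumes doubly: "\<And>i j x. 1 \<le> i \<Longrightarrow> i < j \<Longrightarrow> j \<le> k \<Longrightarrow> x \<in> carrier H \<Longrightarrow>
      T i (adjoint H H (T j) x) = scale H (cnj (q i j)) (adjoint H H (T j) (T i x))"
  shows "sorted_wrt (<) is \<Longrightarrow> set is \<subseteq> {1..k} \<Longrightarrow>
    (\<forall>x\<in>carrier H. 0 \<le> Re (defects T is (inner H) x x) \<and> Re (defects T is (inner H) x x) \<le> (hnorm H x)\<^sup>2) \<and>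
    (\<forall>j\<in>{1..k}. (\<forall>i\<in>set is. j < i) \<longrightarrow> (\<forall>x\<in>carrier H. \<forall>y\<in>carrier H.
       defects T is (inner H) (T j x) y = defects T is (inner H) x (adjoint H H (T j) y)))"
proof (induction "is")
  case Nil
  show ?case using inner_self_nonneg inner_adjoint_right[OF T_bounded] by (simp add: hnorm_sq)
next
  case (Cons i "is")
  let ?G = "defects T is (inner H)"
  have i: "i \<in> {1..k}" "\<forall>l\<in>set is. i < l" "set is \<subseteq> {1..k}" using Cons.prems by auto
  have G: "sesquilinear H ?G" using sesquilinear_defects[OF i(3)] .
  have bounds: "0 \<le> Re (?G x x)" "Re (?G x x) \<le> (hnorm H x)\<^sup>2" if "x \<in> carrier H" for x
    using Cons that by auto
  have sym: "?G (T j x) y = ?G x (adjoint H H (T j) y)"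
    if "j \<in> {1..k}" "j \<le> i" "x \<in> carrier H" "y \<in> carrier H" for j x y
    using Cons that i(2) by fastforce
  have "0 \<le> Re (?G x x) - Re (?G (T i x) (T i x)) \<and> Re (?G x x) - Re (?G (T i x) (T i x)) \<le> (hnorm H x)\<^sup>2"
    if x: "x \<in> carrier H" for x
    using form_contraction[OF G bounds contr[OF i(1)] sym[OF i(1) order_refl] x] bounds[OF x]
      bounds(1)[OF T_closed[OF i(1) x]] by auto
  moreover have "?G (T j x) y - ?G (T i (T j x)) (T i y)
      = ?G x (adjoint H H (T j) y) - ?G (T i x) (T i (adjoint H H (T j) y))"
    if j: "j \<in> {1..k}" "j < i" and x: "x \<in> carrier H" and y: "y \<in> carrier H" for j x y
  proof -
    note bj = T_bounded[OF j(1)] and bi = T_bounded[OF i(1)]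
    note cl = T_closed[OF i(1)] T_closed[OF j(1)] adjoint_closed[OF bj] adjoint_closed[OF bi]
    have ne: "i \<noteq> j" using j by simp
    \<comment> \<open>The hypothesis for j < i concerns T_j and the adjoint of T_i; taking adjoints
      on both sides gives this relation for T_i and the adjoint of T_j.\<close>
    have rel: "T i (adjoint H H (T j) y) = scale H (q j i) (adjoint H H (T j) (T i y))"
    proof (rule inner_eqI)
      fix z assume z: "z \<in> carrier H"
      have "inner H (T i (adjoint H H (T j) y)) z = inner H (adjoint H H (T j) y) (adjoint H H (T i) z)"
        using inner_adjoint_right[OF bi cl(3)[OF y] z] by simp
      also have "\<dots> = inner H y (T j (adjoint H H (T i) z))"
        using inner_adjoint_left[OF bj cl(4)[OF z] y] .
      also have "\<dots> = inner H y (scale H (cnj (q j i)) (adjoint H H (T i) (T j z)))"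
        using doubly[of j i z] j i(1) z by simp
      also have "\<dots> = q j i * inner H (T i y) (T j z)"
        using y z cl inner_adjoint_right[OF bi y cl(2)[OF z]] by (simp add: inner_scale_right)
      also have "\<dots> = inner H (scale H (q j i) (adjoint H H (T j) (T i y))) z"
        using y z cl inner_adjoint_left[OF bj z cl(1)[OF y]] by (simp add: inner_scale_left)
      finally show "inner H (T i (adjoint H H (T j) y)) z = inner H (scale H (q j i) (adjoint H H (T j) (T i y))) z" .
    qed (use y cl in auto)
    have "?G (T i (T j x)) (T i y) = q i j * ?G (T j (T i x)) (T i y)"
      using q_commute[OF i(1) j(1) ne x] form_scale_left[OF G] cl x y by simp
    also have "\<dots> = q i j * ?G (T i x) (adjoint H H (T j) (T i y))"
      using sym[of j "T i x" "T i y"] j x y cl by simp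
    \<comment> \<open>q_ij comes out of the first argument of the form by q-commutation and q_ji,
      conjugated, out of the second by \<open>rel\<close>. For unimodular scalars inverse to each
      other these agree, so the symmetry survives without a phase.\<close>
    also have "q i j = cnj (q j i)"
    proof -
      have "q j i * cnj (q j i) = 1"
        using q_norm[OF j(1) i(1)] complex_norm_square[of "q j i"] ne by simp
      then have "inverse (q j i) = cnj (q j i)" by (rule inverse_unique)
      then show ?thesis using q_inverse[OF j(1) i(1)] ne by simp
    qed
    also have "cnj (q j i) * ?G (T i x) (adjoint H H (T j) (T i y)) = ?G (T i x) (T i (adjoint H H (T j) y))"
      unfolding rel using form_scale_right[OF G cl(1)[OF x] cl(3)[OF cl(1)[OF y]]] by simp
    finally show ?thesis using sym[of j x y] j x y by simp
  qed
  ultimately show ?case by (simp add: defect_def)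
qed

end

theorem theorem4p7:
  fixes H :: "'a chs" and T :: "nat \<Rightarrow> 'a \<Rightarrow> 'a"
    and q :: "nat \<Rightarrow> nat \<Rightarrow> complex" and k :: nat
  assumes "hilbert_space H"
    and "\<forall>i\<in>{1..k}. contraction H (T i)"
    and "\<forall>i j. 1 \<le> i \<longrightarrow> i < j \<longrightarrow> j \<le> k \<longrightarrow> cmod (q i j) = 1"
    and "\<forall>i j. 1 \<le> i \<longrightarrow> i < j \<longrightarrow> j \<le> k \<longrightarrow> q j i = inverse (q i j)"
    and "\<forall>i j. 1 \<le> i \<longrightarrow> i < j \<longrightarrow> j \<le> k \<longrightarrow>
           (\<forall>x\<in>carrier H. T i (T j x) = scale H (q i j) (T j (T i x)))"
    and "(\<forall>i\<in>{1..k}. isometry H H (T i))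
         \<or> (\<forall>i j. 1 \<le> i \<longrightarrow> i < j \<longrightarrow> j \<le> k \<longrightarrow>
              (\<forall>x\<in>carrier H. T i (adjoint H H (T j) x) = scale H (cnj (q i j)) (adjoint H H (T j) (T i x))))
         \<or> (\<Sum>i=1..k. (opnorm H H (T i))\<^sup>2) \<le> 1"
  shows "regular_Q_unitary_dilation H T k q"
proof -
  interpret H: hilb H using assms(1) by (rule hilb.intro)
  have Tcl: "T i x \<in> carrier H" if "i \<in> {1..k}" "x \<in> carrier H" for i x
    using assms(2) that unfolding contraction_def bounded_op_def by blast
  interpret q_tuple H T q k
  proof
    fix i j assume i: "i \<in> {1..k}" and j: "j \<in> {1..k}" and ij: "i \<noteq> j"
    consider "i < j" | "j < i" using ij by linarith
    note cases = this
    have up: "cmod (q a b) = 1" "q b a = inverse (q a b)" if "a \<in> {1..k}" "b \<in> {1..k}" "a < b" for a b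
      using assms(3,4) that by auto
    show "cmod (q i j) = 1"
      using cases
    proof cases
      case 1 then show ?thesis using up i j by blast
    next
      case 2 then show ?thesis using up(1)[OF j i 2] up(2)[OF j i 2] by (simp add: norm_inverse)
    qed
    show "q j i = inverse (q i j)"
      using cases up(2)[OF i j] up(2)[OF j i] by cases simp_all
    fix x assume x: "x \<in> carrier H"
    show "T i (T j x) = scale H (q i j) (T j (T i x))"
      using cases
    proof cases
      case 1 then show ?thesis using assms(5) i j x by auto
    next
      case 2
      have "T j (T i x) = scale H (q j i) (T i (T j x))" using assms(5) 2 i j x by auto
      moreover have "q i j * q j i = 1"
        using up(1)[OF j i 2] up(2)[OF j i 2] by (metis left_inverse norm_zero zero_neq_one)
      ultimately show ?thesis using Tcl i j x by simp
    qed
  qed (use assms(2) in blast)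
  show ?thesis
  proof (rule regular_dilation_of_brehmer)
    fix "is" assume incr: "sorted_wrt (<) is" "set is \<subseteq> {1..k}"
    show "psd_on (carrier H) (defects T is (inner H))"
    proof (rule H.psd_on_form[OF sesquilinear_defects[OF incr(2)]])
      fix x assume x: "x \<in> carrier H"
      from assms(6) show "0 \<le> Re (defects T is (inner H) x x)"
      proof (elim disjE)
        assume "\<forall>i\<in>{1..k}. isometry H H (T i)"
        then show ?thesis using brehmer_isometry[OF _ incr(2) x] by blast
      next
        assume "\<forall>i j. 1 \<le> i \<longrightarrow> i < j \<longrightarrow> j \<le> k \<longrightarrow>
            (\<forall>x\<in>carrier H. T i (adjoint H H (T j) x) = scale H (cnj (q i j)) (adjoint H H (T j) (T i x)))"
        then show ?thesis using brehmer_doubly_commuting[OF _ incr] x by blast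
      next
        assume small: "(\<Sum>i=1..k. (opnorm H H (T i))\<^sup>2) \<le> 1"
        have "distinct is" using incr(1) by (simp add: strict_sorted_iff)
        have "(\<Sum>i\<in>set is. (opnorm H H (T i))\<^sup>2) \<le> (\<Sum>i=1..k. (opnorm H H (T i))\<^sup>2)"
          using incr(2) by (intro sum_mono2) auto
        then have "0 \<le> (1 - (\<Sum>i\<in>set is. (opnorm H H (T i))\<^sup>2)) * (hnorm H x)\<^sup>2" using small by simp
        then show ?thesis
          using brehmer_small_norms[OF small \<open>distinct is\<close> incr(2) x] by linarith
      qed
    qed
  qed
qed

end
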